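(* Let $p\in \mathbb{C}[z]\setminus \mathbb{C}$ be a nonconstant polynomial. The following conditions are equivalent: (1) The complex affine surface $D_p=\mathrm{Spec}(\mathbb{C}[x,y,z]/(xy-p(z)))$ admits a real structure. (2) There exist $a,\lambda \in \mathbb{C}^*$ and $b\in \mathbb{C}$ such that $\lambda p(az+b)\in \mathbb{R}[z]$. (3) There exists $q\in \mathbb{R}[z]$ such that the complex affine surfaces $D_p=\mathrm{Spec}(\mathbb{C}[x,y,z]/(xy-p(z)))$ and $D_q=\mathrm{Spec}(\mathbb{C}[x,y,z]/(xy-q(z)))$ are isomorphic.
   Context: A real structure on a complex algebraic variety $X$ is an action of $\mathrm{Gal}(\mathbb{C}/\mathbb{R})$ on $X$ whose nontrivial element acts by an anti-regular morphism $\rho\colon X\to X$, i.e. a morphism of schemes with $\rho\circ\rho=\mathrm{id}_X$ lying over the morphism $\mathrm{Spec}(\mathbb{C})\to\mathrm{Spec}(\mathbb{C})$ induced by complex conjugation. For affine $X$ this is the same as a ring homomorphism $\rho\colon \mathbb{C}[X]\to\mathbb{C}[X]$ with $\rho\circ\rho=\mathrm{id}$ and $\rho(\alpha f)=\overline{\alpha}\rho(f)$ for all $\alpha\in\mathbb{C}$, $f\in\mathbb{C}[X]$. *)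

theory Defs
  imports "HOL-Algebra.Algebraic_Closure_Type" Complex_Main
begin

text \<open>
  The affine scheme \<open>Spec A\<close> of a complex algebra \<open>A\<close> is represented by \<open>A\<close> itself, that is, by a
  ring together with its structure map \<open>\<complex> \<rightarrow> A\<close>; morphisms of affine schemes are ring
  homomorphisms in the opposite direction.

  The polynomial ring \<open>\<complex>[x,y,z]\<close> is taken as \<open>\<complex>[z][y][x]\<close>: the innermost polynomial variable
  is \<open>z\<close> and the outermost one is \<open>x\<close>.
\<close>

type_synonym poly_xyz = "complex poly poly poly"

abbreviation Cxyz :: "poly_xyz ring"
  where "Cxyz \<equiv> ring_of_type_algebra"

definition var_x :: poly_xyz
  where "var_x = [:0, 1:]"

definition var_y :: poly_xyz
  where "var_y = [:[:0, 1:]:]"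

definition in_z :: "complex poly \<Rightarrow> poly_xyz"
  where "in_z p = [:[:p:]:]"

definition danielewski_ideal :: "complex poly \<Rightarrow> poly_xyz set"
  where "danielewski_ideal p = Idl\<^bsub>Cxyz\<^esub> {var_x * var_y - in_z p}"

definition danielewski_ring :: "complex poly \<Rightarrow> poly_xyz set ring"
  where "danielewski_ring p = Cxyz Quot danielewski_ideal p"

definition danielewski_scalar :: "complex poly \<Rightarrow> complex \<Rightarrow> poly_xyz set"
  where "danielewski_scalar p \<alpha> = danielewski_ideal p +>\<^bsub>Cxyz\<^esub> in_z [:\<alpha>:]"

text \<open>
  In the next two definitions \<open>\<iota>\<close> is the structure map \<open>\<complex> \<rightarrow> A\<close>, so that the scalar multiple
  \<open>\<alpha> f\<close> is \<open>\<iota> \<alpha> \<otimes> f\<close>.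
\<close>

definition real_structure_on ::
    "('a, 'm) ring_scheme \<Rightarrow> (complex \<Rightarrow> 'a) \<Rightarrow> ('a \<Rightarrow> 'a) \<Rightarrow> bool"
  where "real_structure_on A \<iota> \<rho> \<longleftrightarrow>
    \<rho> \<in> ring_hom A A \<and>
    (\<forall>f\<in>carrier A. \<rho> (\<rho> f) = f) \<and>
    (\<forall>\<alpha>. \<forall>f\<in>carrier A. \<rho> (\<iota> \<alpha> \<otimes>\<^bsub>A\<^esub> f) = \<iota> (cnj \<alpha>) \<otimes>\<^bsub>A\<^esub> \<rho> f)"

definition complex_algebra_isomorphic ::
    "('a, 'm) ring_scheme \<Rightarrow> (complex \<Rightarrow> 'a) \<Rightarrow> ('b, 'n) ring_scheme \<Rightarrow> (complex \<Rightarrow> 'b) \<Rightarrow> bool"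
  where "complex_algebra_isomorphic A \<iota> B \<kappa> \<longleftrightarrow>
    (\<exists>\<phi>\<in>ring_iso A B. \<forall>\<alpha>. \<forall>f\<in>carrier A. \<phi> (\<iota> \<alpha> \<otimes>\<^bsub>A\<^esub> f) = \<kappa> \<alpha> \<otimes>\<^bsub>B\<^esub> \<phi> f)"

definition danielewski_admits_real_structure :: "complex poly \<Rightarrow> bool"
  where "danielewski_admits_real_structure p \<longleftrightarrow>
    (\<exists>\<rho>. real_structure_on (danielewski_ring p) (danielewski_scalar p) \<rho>)"

definition danielewski_isomorphic :: "complex poly \<Rightarrow> complex poly \<Rightarrow> bool"
  where "danielewski_isomorphic p q \<longleftrightarrow>
    complex_algebra_isomorphic
      (danielewski_ring p) (danielewski_scalar p) (danielewski_ring q) (danielewski_scalar q)"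

definition real_polys :: "complex poly set"
  where "real_polys = range (map_poly complex_of_real)"

end

theory Submission
  imports "HOL-Library.Poly_Mapping" Defs
begin

text \<open>
  For \<open>p \<noteq> 0\<close> the relation \<open>x y = p(z)\<close> allows \<open>y\<close> to be written as \<open>p(z)/x\<close>. The coordinate ring
  of \<open>D\<^sub>p\<close> is thereby the ring \<open>surface_ring p\<close> of those Laurent polynomials \<open>\<Sum> f\<^sub>i(z) x\<^sup>i\<close> for which
  \<open>f\<^sub>-\<^sub>i\<close> is divisible by \<open>p\<^sup>i\<close> for all \<open>i > 0\<close>, and all the work is done there.

  The heart of the matter is \<open>isomorphic_imp_affine\<close>: if \<open>deg p \<ge> 2\<close> and \<open>D\<^sub>q\<close> is isomorphic to
  \<open>D\<^sub>p\<close>, then \<open>q(az + d) = e p(z)\<close> with \<open>a, e \<noteq> 0\<close>. Granted this, condition (3) gives (2),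
  since a constant \<open>q\<close> is excluded by units and zero divisors (\<open>isomorphic_imp_nonconstant\<close>). A real
  structure on \<open>D\<^sub>p\<close>, composed with the conjugation of coefficients, is a \<open>\<complex>\<close>-linear isomorphism
  between the surfaces of \<open>p\<close> and of its conjugate \<open>r\<close>, so (1) gives \<open>r(az + d) = e p(z)\<close>.
  Move the barycentre of the roots of \<open>p\<close> to \<open>0\<close>, so that \<open>d = 0\<close>. The coefficients \<open>v\<^sub>k\<close> of the
  monic polynomial obtained are then multiplied by \<open>a\<^sup>n\<^sup>-\<^sup>k\<close> under conjugation; unless the polynomial
  is \<open>z\<^sup>n\<close> this forces \<open>|a| = 1\<close>, and rotating \<open>z\<close> by a square root of the conjugate of \<open>a\<close> makes
  them all real (\<open>conjugate_affine_imp_real\<close>). The remaining implications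
  hold because a substitution \<open>z \<mapsto> az + b\<close> is an isomorphism of surfaces and a real \<open>q\<close> lets the
  conjugation of coefficients act on \<open>D\<^sub>q\<close>. For \<open>deg p = 1\<close> condition (2) always holds.

  For the central statement let \<open>f, g, h\<close> be the images of \<open>x, y, z\<close> under an isomorphism from
  \<open>D\<^sub>q\<close> to \<open>D\<^sub>p\<close>. The surface carries the Poisson bracket with \<open>{x,z} = x\<close>, \<open>{z,y} = y\<close>,
  \<open>{x,y} = p'(z)\<close>; as \<open>x\<close> and \<open>y\<close> have only constant common divisors, an isomorphism changes it by
  a constant factor only (\<open>bracket_rigid\<close>). Since \<open>{x,\<cdot>} = x \<partial>/\<partial>z\<close> is locally nilpotent, so is
  \<open>{f,\<cdot>}\<close>. Give \<open>x\<close> the weight \<open>B\<close> and \<open>z\<close> the weight \<open>A\<close>, and attach to a nonzero element its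
  weight together with the order of vanishing, at some point, of its leading form. These pairs
  behave additively under brackets as long as the determinant of the two pairs does not vanish, so
  nilpotency forces a determinant to vanish after finitely many steps
  (\<open>nilpotent_weight_condition\<close>). It follows that the leading coefficient of \<open>f\<close> at a positive power of \<open>x\<close> is constant; that,
  if it involves both \<open>x\<^sup>k\<close> and \<open>x\<^sup>-\<^sup>l\<close> as extreme terms with \<open>l \<le> k\<close>, its leading form along the edge joining
  them is a multiple of \<open>x\<^sup>-\<^sup>l\<close> times a power of some \<open>z - c x\<^sup>s\<close> (\<open>edge_is_power\<close>,
  \<open>shear_lowers_degree\<close>); and the automorphism
  \<open>z \<mapsto> z + c x\<^sup>s\<close> then lowers \<open>k\<close>. The case \<open>k < l\<close> is the same after exchanging \<open>x\<close> and \<open>y\<close>.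
  Eventually no negative power of \<open>x\<close> is left (\<open>straighten\<close>). Then \<open>f\<close> turns out to be a multiple of
  \<open>x\<close> and \<open>h\<close> to be \<open>az + d\<close> modulo \<open>x\<close>, and \<open>f g = q(h)\<close>, read modulo \<open>x\<close> times the coordinate ring,
  says that \<open>p\<close> divides \<open>q(az + d)\<close>. The inverse isomorphism yields the equality of degrees.
\<close>

section \<open>Laurent polynomials in x over the polynomials in z\<close>

text \<open>
  The exponent of \<open>x\<close> is the index, so \<open>single i u\<close> is \<open>u(z) x\<^sup>i\<close>.
\<close>

type_synonym laurent = "int \<Rightarrow>\<^sub>0 complex poly"

abbreviation lookup where "lookup \<equiv> Poly_Mapping.lookup"
abbreviation keys where "keys \<equiv> Poly_Mapping.keys"
abbreviation single where "single \<equiv> Poly_Mapping.single"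

lemma laurent_sum_singles: "(\<Sum>i\<in>keys f. single i (lookup f i)) = f"
  by (rule poly_mapping_eqI)
     (auto simp: lookup_sum lookup_single when_def in_keys_iff sum.delta')

lemma laurent_induct [case_names single add]:
  assumes "\<And>i u. P (single i u)" and "\<And>f g. P f \<Longrightarrow> P g \<Longrightarrow> P (f + g)"
  shows "P (f :: laurent)"
proof -
  have "P (\<Sum>i\<in>A. single i (lookup f i))" if "finite A" for A
    using that
  proof induction
    case empty
    show ?case using assms(1)[of 0 0] by simp
  qed (auto intro: assms)
  from this[of "keys f"] show ?thesis by (simp add: laurent_sum_singles)
qed

lemma lookup_single_mult:
  "lookup (single j u * f) i = u * lookup (f :: laurent) (i - j)"
proof (induction f arbitrary: i rule: laurent_induct)
  case (single k v)
  show ?case by (auto simp: mult_single lookup_single when_def)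
qed (simp add: distrib_left lookup_add)

definition ring_map :: "('a :: comm_ring_1 \<Rightarrow> 'b :: comm_ring_1) \<Rightarrow> bool"
  where "ring_map c \<longleftrightarrow> c 1 = 1 \<and> (\<forall>a b. c (a + b) = c a + c b) \<and> (\<forall>a b. c (a * b) = c a * c b)"

lemma ring_mapI:
  "c 1 = 1 \<Longrightarrow> (\<And>a b. c (a + b) = c a + c b) \<Longrightarrow> (\<And>a b. c (a * b) = c a * c b) \<Longrightarrow> ring_map c"
  by (simp add: ring_map_def)

lemma ring_map:
  assumes "ring_map c"
  shows "c 0 = 0" "c 1 = 1" "c (a + b) = c a + c b" "c (a * b) = c a * c b" "c (- a) = - c a"
    "c (a - b) = c a - c b" "c (a ^ n) = c a ^ n" "c (sum f A) = (\<Sum>i\<in>A. c (f i))"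
proof -
  have add: "c (a + b) = c a + c b" and mult: "c (a * b) = c a * c b" and one: "c 1 = 1" for a b
    using assms by (auto simp: ring_map_def)
  show 0: "c 0 = 0" using add[of 0 0] by simp
  have uminus: "c (- a) = - c a" for a using add[of a "- a"] 0 by (simp add: eq_neg_iff_add_eq_0 add.commute)
  show "c 1 = 1" "c (a + b) = c a + c b" "c (a * b) = c a * c b" by fact+
  show "c (- a) = - c a" by (rule uminus)
  show "c (a - b) = c a - c b" using add[of a "- b"] uminus[of b] by simp
  show "c (a ^ n) = c a ^ n" by (induction n) (auto simp: one mult)
  show "c (sum f A) = (\<Sum>i\<in>A. c (f i))"
    by (induction A rule: infinite_finite_induct) (auto simp: 0 add)
qed

definition peval :: "('a :: comm_ring_1 \<Rightarrow> 'b :: comm_ring_1) \<Rightarrow> 'b \<Rightarrow> 'a poly \<Rightarrow> 'b"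
  where "peval c v r = poly (map_poly c r) v"

lemma peval_pCons:
  assumes "ring_map c"
  shows "peval c v (pCons a r) = c a + v * peval c v r"
  by (simp add: peval_def map_poly_pCons ring_map(1)[OF assms])

lemma ring_map_peval:
  assumes c: "ring_map c"
  shows "ring_map (peval c v)"
proof (rule ring_mapI)
  note pC = peval_pCons[OF c] and r = ring_map[OF c]
  have 0: "peval c v 0 = 0" by (simp add: peval_def)
  show "peval c v 1 = 1" by (simp add: one_pCons pC r 0)
  show add: "peval c v (a + b) = peval c v a + peval c v b" for a b
    by (induction a b rule: poly_induct2) (auto simp: pC r 0 algebra_simps)
  have sm: "peval c v (smult a b) = c a * peval c v b" for a b
    by (induction b) (auto simp: pC r 0 algebra_simps)
  show "peval c v (a * b) = peval c v a * peval c v b" for a b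
    by (induction a) (auto simp: pC r 0 algebra_simps sm add)
qed

text \<open>
  The substitution \<open>x \<mapsto> x\<^sup>B\<close> combined with a ring map \<open>c\<close> on the coefficients. All substitutions
  used below that fix \<open>x\<close> up to a power are of this form.
\<close>

definition lmap :: "(complex poly \<Rightarrow> laurent) \<Rightarrow> int \<Rightarrow> laurent \<Rightarrow> laurent"
  where "lmap c B f = (\<Sum>i\<in>keys f. single (B * i) 1 * c (lookup f i))"

lemma lmap_single: "ring_map c \<Longrightarrow> lmap c B (single i u) = single (B * i) 1 * c u"
  by (auto simp: lmap_def ring_map)

lemma lmap_superset:
  assumes c: "ring_map c" and "finite A" "keys f \<subseteq> A"
  shows "lmap c B f = (\<Sum>i\<in>A. single (B * i) 1 * c (lookup f i))"
  unfolding lmap_def using assms(2,3)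
  by (intro sum.mono_neutral_left) (auto simp: in_keys_iff ring_map[OF c])

lemma lmap_add:
  assumes c: "ring_map c"
  shows "lmap c B (f + g) = lmap c B f + lmap c B g"
proof -
  let ?A = "keys f \<union> keys g"
  have "lmap c B h = (\<Sum>i\<in>?A. single (B * i) 1 * c (lookup h i))" if "h = f + g \<or> h = f \<or> h = g" for h
    using that keys_add[of f g] by (intro lmap_superset[OF c]) auto
  thus ?thesis
    by (simp add: lookup_add ring_map[OF c] distrib_left sum.distrib)
qed

lemma ring_map_lmap:
  assumes c: "ring_map c"
  shows "ring_map (lmap c B)"
proof (rule ring_mapI)
  note r = ring_map[OF c] and a = lmap_add[OF c] and s = lmap_single[OF c]
  have "lmap c B (single 0 1) = single 0 1" unfolding s r by simp
  thus "lmap c B 1 = 1" by simp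
  show "lmap c B (f + g) = lmap c B f + lmap c B g" for f g by (rule a)
  show "lmap c B (f * g) = lmap c B f * lmap c B g" for f g
  proof (induction f rule: laurent_induct)
    case (single i u)
    show ?case
    proof (induction g rule: laurent_induct)
      case (single j v)
      have "single (B * (i + j)) (1::complex poly) = single (B * i) 1 * single (B * j) 1"
        by (simp add: mult_single algebra_simps)
      thus ?case by (simp add: mult_single s r algebra_simps)
    qed (simp add: distrib_left a)
  qed (simp add: distrib_right a)
qed

section \<open>The Poisson bracket\<close>

text \<open>
  The derivations \<open>x \<partial>/\<partial>x\<close> and \<open>\<partial>/\<partial>z\<close>; the first is the logarithmic one so that the bracket below
  takes \<open>x\<close> and \<open>z\<close> to \<open>x\<close> and preserves each \<open>surface_ring p\<close>.
\<close>

definition Dx :: "laurent \<Rightarrow> laurent" where "Dx f = Poly_Mapping.mapp (\<lambda>i u. of_int i * u) f"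
definition Dz :: "laurent \<Rightarrow> laurent" where "Dz f = Poly_Mapping.mapp (\<lambda>i. pderiv) f"

lemma lookup_Dx [simp]: "lookup (Dx f) i = of_int i * lookup f i"
  by (auto simp: Dx_def Poly_Mapping.lookup_mapp when_def in_keys_iff)
lemma lookup_Dz [simp]: "lookup (Dz f) i = pderiv (lookup f i)"
  by (auto simp: Dz_def Poly_Mapping.lookup_mapp when_def in_keys_iff)

lemma Dx_add: "Dx (f + g) = Dx f + Dx g" by (rule poly_mapping_eqI) (simp add: lookup_add algebra_simps)
lemma Dz_add: "Dz (f + g) = Dz f + Dz g" by (rule poly_mapping_eqI) (simp add: lookup_add pderiv_add)
lemma Dx_single: "Dx (single i u) = single i (of_int i * u)" by (rule poly_mapping_eqI) (simp add: lookup_single when_def)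
lemma Dz_single: "Dz (single i u) = single i (pderiv u)" by (rule poly_mapping_eqI) (simp add: lookup_single when_def)

lemma Dx_0: "Dx 0 = 0" and Dz_0: "Dz 0 = 0"
  by (rule poly_mapping_eqI; simp)+

lemma Dx_mult: "Dx (f * g) = Dx f * g + f * Dx g"
proof (induction f rule: laurent_induct)
  case (single i u)
  show ?case
    by (induction g rule: laurent_induct)
       (auto simp: mult_single Dx_single Dx_add single_add[symmetric] algebra_simps)
qed (auto simp: Dx_add algebra_simps)

lemma Dz_mult: "Dz (f * g) = Dz f * g + f * Dz g"
proof (induction f rule: laurent_induct)
  case (single i u)
  show ?case
    by (induction g rule: laurent_induct)
       (auto simp: mult_single Dz_single Dz_add single_add[symmetric] pderiv_mult algebra_simps)
qed (auto simp: Dz_add algebra_simps)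

definition bracket :: "laurent \<Rightarrow> laurent \<Rightarrow> laurent" where "bracket f g = Dx f * Dz g - Dz f * Dx g"

lemma bracket_add_left: "bracket (f + f') g = bracket f g + bracket f' g"
  and bracket_add_right: "bracket f (g + g') = bracket f g + bracket f g'"
  and bracket_mult_left: "bracket (f * f') g = f * bracket f' g + f' * bracket f g"
  and bracket_mult_right: "bracket f (g * g') = g * bracket f g' + g' * bracket f g"
  and bracket_commute: "bracket g f = - bracket f g"
  and bracket_self: "bracket f f = 0"
  by (simp_all add: bracket_def Dx_add Dz_add Dx_mult Dz_mult algebra_simps)

section \<open>Extreme terms in x\<close>

definition ldeg :: "laurent \<Rightarrow> int" where "ldeg f = Max (keys f)"
definition lcoef :: "laurent \<Rightarrow> complex poly" where "lcoef f = lookup f (ldeg f)"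
definition lbot :: "laurent \<Rightarrow> int" where "lbot f = Min (keys f)"

lemma ldeg_ge: "lookup f i \<noteq> 0 \<Longrightarrow> i \<le> ldeg f"
  by (simp add: ldeg_def in_keys_iff)
lemma lbot_le: "lookup f i \<noteq> 0 \<Longrightarrow> lbot f \<le> i"
  by (simp add: lbot_def in_keys_iff)
lemma lcoef_nonzero: "f \<noteq> 0 \<Longrightarrow> lcoef f \<noteq> 0"
  using Max_in[of "keys f"] by (auto simp: lcoef_def ldeg_def in_keys_iff)
lemma lookup_lbot_nonzero: "f \<noteq> 0 \<Longrightarrow> lookup f (lbot f) \<noteq> 0"
  using Min_in[of "keys f"] by (auto simp: lbot_def in_keys_iff)
lemma lookup_above_ldeg: "ldeg f < i \<Longrightarrow> lookup f i = 0"
  using ldeg_ge[of f i] by force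
lemma lookup_below_lbot: "i < lbot f \<Longrightarrow> lookup f i = 0"
  using lbot_le[of f i] by force

lemma ldeg_eqI: "lookup f m \<noteq> 0 \<Longrightarrow> (\<And>i. m < i \<Longrightarrow> lookup f i = 0) \<Longrightarrow> ldeg f = m"
  by (metis ldeg_ge lcoef_def lcoef_nonzero lookup_zero order_antisym_conv not_le)
lemma lbot_eqI: "lookup f m \<noteq> 0 \<Longrightarrow> (\<And>i. i < m \<Longrightarrow> lookup f i = 0) \<Longrightarrow> lbot f = m"
  by (metis lbot_le lookup_lbot_nonzero lookup_zero order_antisym_conv not_le)

lemma lookup_mult_sum:
  "lookup (f * g) k = (\<Sum>i\<in>keys f. lookup f i * lookup (g :: laurent) (k - i))"
proof -
  have "f * g = (\<Sum>i\<in>keys f. single i (lookup f i) * g)"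
    by (simp add: laurent_sum_singles flip: sum_distrib_right)
  thus ?thesis by (simp add: lookup_sum lookup_single_mult)
qed

lemma lookup_mult_upper:
  assumes f: "\<And>i. m < i \<Longrightarrow> lookup f i = 0" and g: "\<And>i. n < i \<Longrightarrow> lookup (g :: laurent) i = 0"
  shows "lookup (f * g) (m + n) = lookup f m * lookup g n"
    and "m + n < k \<Longrightarrow> lookup (f * g) k = 0"
proof -
  have "lookup (f * g) (m + n) = (\<Sum>i\<in>keys f. if m = i then lookup f m * lookup g n else 0)"
    unfolding lookup_mult_sum
  proof (rule sum.cong)
    fix i assume "i \<in> keys f"
    hence "i \<le> m" using f[of i] by (force simp: in_keys_iff)
    thus "lookup f i * lookup g (m + n - i) = (if m = i then lookup f m * lookup g n else 0)"
      using g[of "m + n - i"] by auto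
  qed simp
  thus "lookup (f * g) (m + n) = lookup f m * lookup g n"
    by (simp add: sum.delta in_keys_iff)
  show "lookup (f * g) k = 0" if "m + n < k"
    unfolding lookup_mult_sum
  proof (rule sum.neutral, rule ballI)
    fix i assume "i \<in> keys f"
    hence "i \<le> m" using f[of i] by (force simp: in_keys_iff)
    thus "lookup f i * lookup g (k - i) = 0" using g[of "k - i"] that by auto
  qed
qed

lemma lookup_mult_lower:
  assumes f: "\<And>i. i < m \<Longrightarrow> lookup f i = 0" and g: "\<And>i. i < n \<Longrightarrow> lookup (g :: laurent) i = 0"
  shows "lookup (f * g) (m + n) = lookup f m * lookup g n"
    and "k < m + n \<Longrightarrow> lookup (f * g) k = 0"
proof -
  have "lookup (f * g) (m + n) = (\<Sum>i\<in>keys f. if m = i then lookup f m * lookup g n else 0)"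
    unfolding lookup_mult_sum
  proof (rule sum.cong)
    fix i assume "i \<in> keys f"
    hence "m \<le> i" using f[of i] by (force simp: in_keys_iff)
    thus "lookup f i * lookup g (m + n - i) = (if m = i then lookup f m * lookup g n else 0)"
      using g[of "m + n - i"] by auto
  qed simp
  thus "lookup (f * g) (m + n) = lookup f m * lookup g n"
    by (simp add: sum.delta in_keys_iff)
  show "lookup (f * g) k = 0" if "k < m + n"
    unfolding lookup_mult_sum
  proof (rule sum.neutral, rule ballI)
    fix i assume "i \<in> keys f"
    hence "m \<le> i" using f[of i] by (force simp: in_keys_iff)
    thus "lookup f i * lookup g (k - i) = 0" using g[of "k - i"] that by auto
  qed
qed

lemma ldeg_mult:
  fixes f g :: laurent
  assumes "f \<noteq> 0" "g \<noteq> 0"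
  shows "ldeg (f * g) = ldeg f + ldeg g" "lcoef (f * g) = lcoef f * lcoef g"
proof -
  have *: "lookup (f * g) (ldeg f + ldeg g) = lookup f (ldeg f) * lookup g (ldeg g)"
    "\<And>k. ldeg f + ldeg g < k \<Longrightarrow> lookup (f * g) k = 0"
    by (rule lookup_mult_upper; simp add: lookup_above_ldeg)+
  have nz: "lookup (f * g) (ldeg f + ldeg g) = lcoef f * lcoef g"
    using *(1) by (simp add: lcoef_def)
  moreover have "lcoef f * lcoef g \<noteq> 0" using assms by (simp add: lcoef_nonzero)
  ultimately show "ldeg (f * g) = ldeg f + ldeg g" using *(2) by (intro ldeg_eqI) auto
  thus "lcoef (f * g) = lcoef f * lcoef g" using nz by (simp add: lcoef_def)
qed

lemma lbot_mult:
  fixes f g :: laurent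
  assumes "f \<noteq> 0" "g \<noteq> 0"
  shows "lbot (f * g) = lbot f + lbot g"
proof -
  have "lookup (f * g) (lbot f + lbot g) = lookup f (lbot f) * lookup g (lbot g)"
    "\<And>k. k < lbot f + lbot g \<Longrightarrow> lookup (f * g) k = 0"
    by (rule lookup_mult_lower; simp add: lookup_below_lbot)+
  thus ?thesis
    using assms by (intro lbot_eqI) (auto simp: lookup_lbot_nonzero)
qed

lemma ldeg_single: "u \<noteq> 0 \<Longrightarrow> ldeg (single i u) = i" and lcoef_single: "lcoef (single i u) = u"
  by (cases "u = 0"; simp add: ldeg_def lcoef_def)+
lemma lbot_single: "u \<noteq> 0 \<Longrightarrow> lbot (single i u) = i"
  by (simp add: lbot_def)

lemma eq_single_of_ldeg_eq_lbot:
  assumes "ldeg f \<le> lbot f" "f \<noteq> 0"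
  shows "f = single (ldeg f) (lcoef f)"
proof (rule poly_mapping_eqI)
  fix i
  have "lbot f \<le> ldeg f" using ldeg_ge lookup_lbot_nonzero assms(2) by blast
  moreover have "i = ldeg f \<or> ldeg f < i \<or> i < ldeg f" by linarith
  ultimately show "lookup f i = lookup (single (ldeg f) (lcoef f)) i"
    using assms(1) lookup_above_ldeg[of f i] lookup_below_lbot[of i f]
    by (auto simp: lookup_single when_def lcoef_def)
qed

text \<open>
  Both extreme degrees are additive, so neither factor can have two different ones.
\<close>

lemma factor_of_monomial:
  assumes "f * g = single i u" "u \<noteq> 0"
  shows "f = single (ldeg f) (lcoef f)"
proof -
  have "single i u \<noteq> 0" using assms(2) by (simp flip: keys_eq_empty)
  hence nz: "f \<noteq> 0" "g \<noteq> 0" using assms(1) by auto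
  have "ldeg f + ldeg g = lbot f + lbot g"
    using assms ldeg_mult(1)[OF nz] lbot_mult[OF nz] by (simp add: ldeg_single lbot_single)
  moreover have "lbot g \<le> ldeg g" using ldeg_ge lookup_lbot_nonzero nz by blast
  ultimately show ?thesis by (intro eq_single_of_ldeg_eq_lbot) (use nz in auto)
qed

section \<open>Weights and leading forms\<close>

definition cst :: "complex \<Rightarrow> laurent" where "cst \<alpha> = single 0 [:\<alpha>:]"

lemma ring_map_cst: "ring_map cst"
  by (rule ring_mapI) (simp_all add: cst_def mult_single single_add[symmetric] mult.commute flip: one_pCons)

lemma lookup_cst_mult: "lookup (cst \<alpha> * f) i = smult \<alpha> (lookup f i)"
  by (simp add: cst_def lookup_single_mult)

definition weigh_poly :: "int \<Rightarrow> complex poly \<Rightarrow> laurent"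
  where "weigh_poly A = peval cst (single A [:0, 1:])"

text \<open>
  The substitutions \<open>x \<mapsto> t\<^sup>B\<close>, \<open>z \<mapsto> t\<^sup>A \<zeta>\<close>; the results are written as Laurent polynomials in \<open>t\<close> over the
  polynomials in \<open>\<zeta>\<close>. For \<open>f\<close> nonzero, \<open>ldeg (weigh A B f)\<close> is the weighted degree of \<open>f\<close>, and the
  polynomial \<open>lcoef (weigh A B f)\<close> in \<open>\<zeta>\<close> is its leading form.
\<close>

definition weigh :: "int \<Rightarrow> int \<Rightarrow> laurent \<Rightarrow> laurent"
  where "weigh A B = lmap (weigh_poly A) B"

lemma ring_map_weigh_poly: "ring_map (weigh_poly A)"
  unfolding weigh_poly_def by (intro ring_map_peval ring_map_cst)
lemma ring_map_weigh: "ring_map (weigh A B)"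
  unfolding weigh_def by (intro ring_map_lmap ring_map_weigh_poly)
lemma weigh_single: "weigh A B (single i u) = single (B * i) 1 * weigh_poly A u"
  by (simp add: weigh_def lmap_single ring_map_weigh_poly)
lemma weigh_poly_pCons: "weigh_poly A (pCons a u) = cst a + single A [:0, 1:] * weigh_poly A u"
  by (simp add: weigh_poly_def peval_pCons ring_map_cst)
lemma weigh_poly_0: "weigh_poly A 0 = 0" by (simp add: ring_map[OF ring_map_weigh_poly])

lemma coeff_weigh_poly: "coeff (lookup (weigh_poly A u) w) j = (if w = A * int j then coeff u j else 0)"
proof (induction u arbitrary: w j)
  case 0
  show ?case by (simp add: weigh_poly_0)
next
  case (pCons a u)
  show ?case
    by (cases j) (auto simp: weigh_poly_pCons lookup_add lookup_single_mult pCons.IH cst_def lookup_single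
       when_def coeff_pCons distrib_left)
qed

lemma coeff_weigh_single:
  "coeff (lookup (weigh A B (single i u)) w) j = (if w = B * i + A * int j then coeff u j else 0)"
  by (auto simp: weigh_single lookup_single_mult coeff_weigh_poly)

text \<open>
  As long as \<open>B \<noteq> 0\<close>, the monomial \<open>x\<^sup>i z\<^sup>j\<close> can be recovered from its weight and \<open>j\<close>.
\<close>

lemma coeff_weigh:
  assumes "B \<noteq> 0"
  shows "coeff (lookup (weigh A B f) (B * i + A * int j)) j = coeff (lookup f i) j"
proof (induction f rule: laurent_induct)
  case (single k u)
  show ?case using assms by (auto simp: coeff_weigh_single lookup_single when_def)
qed (simp add: ring_map[OF ring_map_weigh] lookup_add)

lemma coeff_weigh_support:
  "coeff (lookup (weigh A B f) w) j \<noteq> 0 \<Longrightarrow> \<exists>i. w = B * i + A * int j"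
proof (induction f rule: laurent_induct)
  case (single k u)
  thus ?case by (auto simp: coeff_weigh_single split: if_splits)
next
  case (add f g)
  from add.prems have "coeff (lookup (weigh A B f) w) j \<noteq> 0 \<or> coeff (lookup (weigh A B g) w) j \<noteq> 0"
    by (auto simp: ring_map[OF ring_map_weigh] lookup_add)
  thus ?case using add.IH by blast
qed

lemma weigh_nonzero:
  assumes "B \<noteq> 0" "f \<noteq> 0"
  shows "weigh A B f \<noteq> 0"
proof
  assume *: "weigh A B f = 0"
  have "coeff (lookup f i) j = 0" for i j using coeff_weigh[OF assms(1), of A f i j] * by simp
  hence "f = 0" by (intro poly_mapping_eqI poly_eqI) auto
  thus False using assms by simp
qed

lemma Dz_weigh_poly: "Dz (weigh_poly A u) = single A 1 * weigh_poly A (pderiv u)"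
proof (induction u)
  case (pCons a u)
  have "Dz (single A [:0, 1:]) = single A 1" by (simp add: Dz_single pderiv_pCons one_pCons)
  moreover have "weigh_poly A (pderiv (pCons a u)) = weigh_poly A u + single A [:0,1:] * weigh_poly A (pderiv u)"
    by (simp add: pderiv_pCons ring_map[OF ring_map_weigh_poly] weigh_poly_pCons cst_def)
  moreover have "Dz (cst a) = 0" by (simp add: cst_def Dz_single)
  ultimately show ?case by (simp add: weigh_poly_pCons Dz_add Dz_mult pCons.IH algebra_simps)
qed (simp add: weigh_poly_0 Dz_0)

lemma Dx_weigh_poly: "Dx (weigh_poly A u) = of_int A * single A [:0, 1:] * weigh_poly A (pderiv u)"
proof (induction u)
  case (pCons a u)
  have "Dx (single A [:0, 1:]) = of_int A * single A [:0, 1:]"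
    by (rule poly_mapping_eqI) (simp add: Dx_single mult_single flip: single_of_int)
  moreover have "weigh_poly A (pderiv (pCons a u)) = weigh_poly A u + single A [:0,1:] * weigh_poly A (pderiv u)"
    by (simp add: pderiv_pCons ring_map[OF ring_map_weigh_poly] weigh_poly_pCons cst_def)
  moreover have "Dx (cst a) = 0" by (simp add: cst_def Dx_single)
  ultimately show ?case by (simp add: weigh_poly_pCons Dx_add Dx_mult pCons.IH algebra_simps)
qed (simp add: weigh_poly_0 Dx_0)

lemma weigh_poly_of_int: "weigh_poly A (of_int n) = of_int n"
proof -
  have "weigh_poly A (of_nat k) = of_nat k" for k
    by (induction k) (simp_all add: ring_map[OF ring_map_weigh_poly])
  thus ?thesis by (cases n rule: int_cases2) (simp_all add: ring_map[OF ring_map_weigh_poly])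
qed

lemma Dz_weigh: "Dz (weigh A B f) = single A 1 * weigh A B (Dz f)"
proof (induction f rule: laurent_induct)
  case (single i u)
  have "Dz (single (B * i) 1) = 0" by (simp add: Dz_single)
  thus ?case by (simp only: weigh_single Dz_mult Dz_single Dz_weigh_poly) (simp only: mult_zero_left add_0 mult_ac)
qed (simp only: ring_map[OF ring_map_weigh] Dz_add distrib_left)

lemma Dx_weigh:
  "Dx (weigh A B f) = of_int B * weigh A B (Dx f) + of_int A * single A [:0, 1:] * weigh A B (Dz f)"
proof (induction f rule: laurent_induct)
  case (single i u)
  define s e e' t where "s = single (B * i) (1 :: complex poly)" and "e = weigh_poly A u"
    and "e' = weigh_poly A (pderiv u)" and "t = single A ([:0, 1:] :: complex poly)"
  have "Dx s = of_int (B * i) * s"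
    unfolding s_def by (simp add: Dx_single mult_single flip: single_of_int)
  moreover have "Dx e = of_int A * t * e'" by (simp only: e_def e'_def t_def Dx_weigh_poly)
  moreover have "weigh A B (single i u) = s * e" by (simp only: weigh_single s_def e_def)
  moreover have "weigh A B (Dx (single i u)) = s * (of_int i * e)"
    by (simp only: weigh_single Dx_single s_def e_def ring_map[OF ring_map_weigh_poly] weigh_poly_of_int)
  moreover have "weigh A B (Dz (single i u)) = s * e'"
    by (simp only: weigh_single Dz_single s_def e'_def)
  moreover have "Dx (s * e) = Dx s * e + s * Dx e" by (rule Dx_mult)
  ultimately have "Dx (weigh A B (single i u)) =
      of_int B * weigh A B (Dx (single i u)) + of_int A * t * weigh A B (Dz (single i u))"
    by (simp only: of_int_mult) (simp only: mult_ac)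
  thus ?case by (simp only: t_def)
next
  case (add f g)
  thus ?case by (simp only: ring_map[OF ring_map_weigh] Dx_add Dz_add distrib_left add_ac)
qed

text \<open>
  The bracket is \<open>df \<and> dg\<close> divided by \<open>(dx/x) \<and> dz\<close>, and the substitution turns the latter form
  into \<open>B t\<^sup>A (dt/t) \<and> d\<zeta>\<close>.
\<close>

lemma bracket_weigh:
  "bracket (weigh A B f) (weigh A B g) = single A 1 * of_int B * weigh A B (bracket f g)"
proof -
  define t z b where "t = single A ([:0, 1:] :: complex poly)" "z = single A (1 :: complex poly)"
    "b = (of_int B :: laurent)"
  show ?thesis
    unfolding bracket_def ring_map[OF ring_map_weigh] Dx_weigh Dz_weigh t_z_b_def[symmetric]
    by (simp only: distrib_left distrib_right left_diff_distrib right_diff_distrib) (simp only: mult_ac add_ac, simp)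
qed

section \<open>Leading forms of brackets\<close>

text \<open>
  With \<open>l = \<zeta> - c\<close>, the derivation \<open>l d/d\<zeta>\<close> multiplies the lowest term \<open>l\<^sup>m\<close> of a polynomial by \<open>m\<close>. Hence in
  \<open>l r\<close> the lowest terms of \<open>a\<close> and \<open>b\<close> contribute their product times the determinant.
\<close>

lemma order_wronskian:
  fixes a b :: "complex poly"
  assumes "a \<noteq> 0" "b \<noteq> 0"
    and det: "M * int (Polynomial.order c b) - N * int (Polynomial.order c a) \<noteq> 0"
  defines "r \<equiv> of_int M * a * pderiv b - of_int N * pderiv a * b"
  shows "r \<noteq> 0" and "Polynomial.order c r + 1 = Polynomial.order c a + Polynomial.order c b"
proof -
  define l where "l = [:- c, 1:]"
  define m s where "m = Polynomial.order c a" and "s = Polynomial.order c b"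
  obtain a0 where a: "a = l ^ m * a0" and a0: "\<not> l dvd a0"
    using order_decomp[OF assms(1), of c] by (auto simp: l_def m_def)
  obtain b0 where b: "b = l ^ s * b0" and b0: "\<not> l dvd b0"
    using order_decomp[OF assms(2), of c] by (auto simp: l_def s_def)
  have dl: "pderiv l = 1" by (simp add: l_def pderiv_pCons one_pCons)
  have D: "l * pderiv (l ^ n * q) = l ^ n * (of_nat n * q + l * pderiv q)" for n q
  proof -
    have "l * pderiv (l ^ n) = of_nat n * l ^ n"
    proof (cases n)
      case (Suc k)
      have "l * pderiv (l ^ Suc k) = smult (of_nat (Suc k)) (l * l ^ k)"
        unfolding pderiv_power_Suc dl by simp
      thus ?thesis by (simp add: Suc of_nat_poly)
    qed simp
    moreover have "l * pderiv (l ^ n * q) = l ^ n * (l * pderiv q) + q * (l * pderiv (l ^ n))"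
      by (simp add: pderiv_mult algebra_simps)
    ultimately show ?thesis by (simp add: algebra_simps)
  qed
  define e where "e = of_int (M * int s - N * int m) * (a0 * b0)
    + l * (of_int M * a0 * pderiv b0 - of_int N * pderiv a0 * b0)"
  have "l * r = of_int M * a * (l * pderiv b) - of_int N * (l * pderiv a) * b"
    by (simp add: r_def algebra_simps)
  also have "\<dots> = l ^ (m + s) * e"
    unfolding a b D e_def by (simp add: algebra_simps power_add)
  finally have lr: "l * r = l ^ (m + s) * e" .
  have "poly l c = 0" by (simp add: l_def)
  moreover have "poly a0 c \<noteq> 0" "poly b0 c \<noteq> 0" using a0 b0 by (auto simp: l_def poly_eq_0_iff_dvd)
  moreover have "poly (of_int k :: complex poly) c = of_int k" for k by (simp add: of_int_poly)
  ultimately have "poly e c = of_int (M * int s - N * int m) * (poly a0 c * poly b0 c)"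
    unfolding e_def poly_add poly_mult by simp
  moreover have "(of_int (M * int s - N * int m) :: complex) \<noteq> 0"
    unfolding of_int_eq_0_iff using det by (simp add: m_def s_def)
  ultimately have e: "poly e c \<noteq> 0"
    using \<open>poly a0 c \<noteq> 0\<close> \<open>poly b0 c \<noteq> 0\<close> by (simp del: of_int_diff of_int_mult)
  hence "e \<noteq> 0" by auto
  have l: "l \<noteq> 0" by (simp add: l_def)
  from lr \<open>e \<noteq> 0\<close> l show r: "r \<noteq> 0" by auto
  have o: "Polynomial.order c (l ^ n) = n" for n unfolding l_def by (rule order_power_n_n)
  have "l ^ 1 * r \<noteq> 0" "l ^ (m + s) * e \<noteq> 0" using l r \<open>e \<noteq> 0\<close> by simp_all
  hence o': "Polynomial.order c (l ^ 1 * r) = 1 + Polynomial.order c r"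
    "Polynomial.order c (l ^ (m + s) * e) = m + s"
    using order_mult[of "l ^ 1" r c] order_mult[of "l ^ (m + s)" e c] o[of 1] o[of "m + s"] order_0I[OF e]
    by presburger+
  show "Polynomial.order c r + 1 = Polynomial.order c a + Polynomial.order c b"
    using lr o' by (simp add: m_def s_def)
qed

lemma lcoef_bracket:
  assumes "F \<noteq> 0" "G \<noteq> 0"
    and det: "ldeg F * int (Polynomial.order c (lcoef G)) \<noteq> ldeg G * int (Polynomial.order c (lcoef F))"
  shows "bracket F G \<noteq> 0" "ldeg (bracket F G) = ldeg F + ldeg G"
    "Polynomial.order c (lcoef (bracket F G)) + 1 = Polynomial.order c (lcoef F) + Polynomial.order c (lcoef G)"
proof -
  let ?M = "ldeg F" and ?N = "ldeg G"
  note * = lookup_mult_upper[of ?M "Dx F" ?N "Dz G"] lookup_mult_upper[of ?M "Dz F" ?N "Dx G"]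
  have l: "lookup (bracket F G) (?M + ?N)
     = of_int ?M * lcoef F * pderiv (lcoef G) - of_int ?N * pderiv (lcoef F) * lcoef G"
    using * by (simp add: bracket_def lookup_minus lookup_above_ldeg lcoef_def mult.assoc mult.left_commute)
  have u: "lookup (bracket F G) k = 0" if "?M + ?N < k" for k
    using * that by (simp add: bracket_def lookup_minus lookup_above_ldeg)
  note o = order_wronskian[OF lcoef_nonzero[OF assms(1)] lcoef_nonzero[OF assms(2)], of "?M" c "?N"]
  have nz: "lookup (bracket F G) (?M + ?N) \<noteq> 0" using o(1) det by (simp add: l)
  thus "bracket F G \<noteq> 0" by auto
  show d: "ldeg (bracket F G) = ?M + ?N" by (rule ldeg_eqI[OF nz u])
  show "Polynomial.order c (lcoef (bracket F G)) + 1 = Polynomial.order c (lcoef F) + Polynomial.order c (lcoef G)"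
    using o(2) det by (simp add: lcoef_def d l)
qed

text \<open>
  Attach to \<open>b\<close> the pair \<open>(v, s)\<close> of its weight and the order at \<open>c\<close> of its leading form, and \<open>(w, m)\<close>
  to \<open>f\<close>. While the determinant \<open>w s - m v\<close> is nonzero, the bracket with \<open>f\<close> is nonzero and its pair is
  \<open>(v + w - A, s + m - 1)\<close>, which changes the determinant by \<open>m A - w\<close>. So the iterated brackets can
  reach zero only if the determinant vanishes at some step.
\<close>

lemma nilpotent_weight_condition:
  fixes A B :: int and c :: complex and f b :: laurent
  assumes nil: "(bracket f ^^ N) b = 0" and B: "B \<noteq> 0" and f: "f \<noteq> 0" and b: "b \<noteq> 0"
  defines "w \<equiv> ldeg (weigh A B f)" and "m \<equiv> int (Polynomial.order c (lcoef (weigh A B f)))"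
    and "v \<equiv> ldeg (weigh A B b)" and "s \<equiv> int (Polynomial.order c (lcoef (weigh A B b)))"
  shows "\<exists>i::nat. w * s - m * v + int i * (m * A - w) = 0"
proof (rule ccontr)
  assume none: "\<not> ?thesis"
  have "(bracket f ^^ i) b \<noteq> 0 \<and> ldeg (weigh A B ((bracket f ^^ i) b)) = v + int i * (w - A)
      \<and> int (Polynomial.order c (lcoef (weigh A B ((bracket f ^^ i) b)))) = s + int i * (m - 1)" for i
  proof (induction i)
    case 0
    show ?case using b by (simp add: v_def s_def)
  next
    case (Suc i)
    define g where "g = (bracket f ^^ i) b"
    let ?F = "weigh A B f" and ?G = "weigh A B g" and ?H = "weigh A B (bracket f g)"
    from Suc.IH have g: "g \<noteq> 0" "ldeg ?G = v + int i * (w - A)"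
      "int (Polynomial.order c (lcoef ?G)) = s + int i * (m - 1)" by (auto simp: g_def)
    have nz: "?F \<noteq> 0" "?G \<noteq> 0" using weigh_nonzero[OF B] f g(1) by blast+
    have "w * s - m * v + int i * (m * A - w) \<noteq> 0" using none by blast
    hence det: "ldeg ?F * int (Polynomial.order c (lcoef ?G)) \<noteq> ldeg ?G * int (Polynomial.order c (lcoef ?F))"
      by (simp add: g flip: w_def m_def) (simp add: algebra_simps)
    note L = lcoef_bracket[OF nz det]
    have K: "bracket ?F ?G = single A (of_int B) * ?H"
      by (simp add: bracket_weigh mult_single flip: single_of_int)
    hence H: "?H \<noteq> 0" using L(1) by auto
    have S: "single A (of_int B :: complex poly) \<noteq> 0"
      using B by (simp flip: keys_eq_empty)
    have "ldeg (bracket ?F ?G) = A + ldeg ?H" "lcoef (bracket ?F ?G) = of_int B * lcoef ?H"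
      using ldeg_mult[OF S H] B by (simp_all add: K ldeg_single lcoef_single)
    moreover have "Polynomial.order c (of_int B * lcoef ?H) = Polynomial.order c (lcoef ?H)"
      using B by (simp add: of_int_poly order_smult)
    ultimately have "ldeg ?H = ldeg ?F + ldeg ?G - A"
      "int (Polynomial.order c (lcoef ?H)) + 1 = int (Polynomial.order c (lcoef ?F)) + int (Polynomial.order c (lcoef ?G))"
      using L by auto
    hence "ldeg ?H = v + int (Suc i) * (w - A)" "int (Polynomial.order c (lcoef ?H)) = s + int (Suc i) * (m - 1)"
      by (simp_all add: g flip: w_def m_def) (simp_all add: algebra_simps)
    moreover have "(bracket f ^^ Suc i) b = bracket f g" by (simp add: g_def)
    moreover have "bracket f g \<noteq> 0" using H by (auto simp: ring_map[OF ring_map_weigh])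
    ultimately show ?case by (simp only: simp_thms)
  qed
  thus False using nil by blast
qed

section \<open>The coordinate ring as a subring of the Laurent polynomials\<close>

abbreviation xx :: laurent where "xx \<equiv> single 1 1"
abbreviation yy :: "complex poly \<Rightarrow> laurent" where "yy p \<equiv> single (- 1) p"
abbreviation zz :: laurent where "zz \<equiv> single 0 [:0, 1:]"

text \<open>
  The subring generated by \<open>x\<close>, \<open>z\<close> and \<open>y = p(z)/x\<close>, described by divisibility conditions.
\<close>

definition surface_ring :: "complex poly \<Rightarrow> laurent set"
  where "surface_ring p = {f. \<forall>i. p ^ nat (- i) dvd lookup f i}"

lemma surface_ring_single: "single i u \<in> surface_ring p \<longleftrightarrow> p ^ nat (- i) dvd u"
  by (auto simp: surface_ring_def lookup_single when_def)

lemma surface_ring_add: "f \<in> surface_ring p \<Longrightarrow> g \<in> surface_ring p \<Longrightarrow> f + g \<in> surface_ring p"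
  by (auto simp: surface_ring_def lookup_add)
lemma surface_ring_uminus: "f \<in> surface_ring p \<Longrightarrow> - f \<in> surface_ring p"
  by (auto simp: surface_ring_def)
lemma surface_ring_sum: "(\<And>i. i \<in> A \<Longrightarrow> f i \<in> surface_ring p) \<Longrightarrow> sum f A \<in> surface_ring p"
  by (induction A rule: infinite_finite_induct) (auto intro: surface_ring_add simp: surface_ring_single[of 0 0, simplified])

lemma surface_ring_mult:
  assumes "f \<in> surface_ring p" "g \<in> surface_ring p"
  shows "f * g \<in> surface_ring p"
  unfolding surface_ring_def
proof (intro CollectI allI)
  fix k
  have "p ^ nat (- k) dvd lookup f i * lookup g (k - i)" for i
  proof -
    have "p ^ nat (- k) dvd p ^ (nat (- i) + nat (- (k - i)))" by (rule le_imp_power_dvd) linarith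
    also have "\<dots> dvd lookup f i * lookup g (k - i)"
      using assms mult_dvd_mono[of "p ^ nat (- i)" "lookup f i" "p ^ nat (- (k - i))" "lookup g (k - i)"]
      unfolding power_add surface_ring_def by blast
    finally show ?thesis .
  qed
  thus "p ^ nat (- k) dvd lookup (f * g) k" unfolding lookup_mult_sum by (intro dvd_sum)
qed

lemma surface_ring_cst: "cst \<alpha> \<in> surface_ring p" by (simp add: cst_def surface_ring_single)
lemma surface_ring_gens: "xx \<in> surface_ring p" "yy p \<in> surface_ring p" "zz \<in> surface_ring p" "single 0 u \<in> surface_ring p" by (simp_all add: surface_ring_single)
lemma surface_ring_power: "f \<in> surface_ring p \<Longrightarrow> f ^ n \<in> surface_ring p"
  by (induction n) (auto intro: surface_ring_mult simp: surface_ring_single[of 0 1, simplified])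

lemma single_power: "single i u ^ n = single (int n * i) (u ^ n :: complex poly)"
  by (induction n) (simp_all add: mult_single algebra_simps)

lemma xx_times_yy: "xx * yy p = single 0 p" by (simp add: mult_single)

definition eval_xyz :: "laurent \<Rightarrow> laurent \<Rightarrow> laurent \<Rightarrow> poly_xyz \<Rightarrow> laurent"
  where "eval_xyz a b c = peval (peval (peval cst c) b) a"

lemma ring_map_eval_xyz: "ring_map (eval_xyz a b c)"
  unfolding eval_xyz_def by (intro ring_map_peval ring_map_cst)

lemma peval_0: "peval c v 0 = 0" by (simp add: peval_def)

lemma eval_xyz_vars: "eval_xyz a b c var_x = a" "eval_xyz a b c var_y = b" "eval_xyz a b c (in_z u) = peval cst c u"
  by (simp_all add: eval_xyz_def var_x_def var_y_def in_z_def peval_pCons ring_map_peval ring_map_cst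
        ring_map[OF ring_map_peval[OF ring_map_peval[OF ring_map_cst]]]
        ring_map[OF ring_map_peval[OF ring_map_cst]] peval_0)

lemma in_z_add: "in_z (u + v) = in_z u + in_z v" and in_z_mult: "in_z (u * v) = in_z u * in_z v"
  and in_z_0: "in_z 0 = 0"
  by (simp_all add: in_z_def flip: one_pCons)

lemma peval_cst_zz: "peval cst zz u = single 0 u"
proof -
  have "weigh_poly 0 u = single 0 u"
    by (intro poly_mapping_eqI poly_eqI) (auto simp: coeff_weigh_poly lookup_single when_def)
  thus ?thesis by (simp add: weigh_poly_def)
qed

lemma xyz_induct [case_names in_z x y add]:
  assumes "\<And>u. P (in_z u)" "\<And>F. P F \<Longrightarrow> P (var_x * F)" "\<And>F. P F \<Longrightarrow> P (var_y * F)"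
    and "\<And>F G. P F \<Longrightarrow> P G \<Longrightarrow> P (F + G)"
  shows "P F"
proof -
  have inner: "P [:a:]" for a
  proof (induction a)
    case 0
    show ?case using assms(1)[of 0] by (simp add: in_z_def)
  next
    case (pCons b s)
    have "[:pCons b s:] = in_z b + var_y * [:s:]" by (simp add: in_z_def var_y_def)
    moreover have "P (in_z b)" "P (var_y * [:s:])" using pCons assms by blast+
    ultimately show ?case using assms(4) by metis
  qed
  show ?thesis
  proof (induction F)
    case 0
    show ?case using inner[of 0] by simp
  next
    case (pCons a r)
    have "pCons a r = [:a:] + var_x * r" by (simp add: var_x_def)
    thus ?case using pCons(2) assms(2,4) inner by metis
  qed
qed

definition laurent_of :: "complex poly \<Rightarrow> poly_xyz \<Rightarrow> laurent"
  where "laurent_of p = eval_xyz xx (yy p) zz"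

lemma ring_map_laurent_of: "ring_map (laurent_of p)" by (simp add: laurent_of_def ring_map_eval_xyz)
lemma laurent_of_vars: "laurent_of p var_x = xx" "laurent_of p var_y = yy p" "laurent_of p (in_z u) = single 0 u"
  by (simp_all add: laurent_of_def eval_xyz_vars peval_cst_zz)

lemma laurent_of_in_surface_ring: "laurent_of p F \<in> surface_ring p"
  by (induction F rule: xyz_induct)
     (auto simp: ring_map[OF ring_map_laurent_of] laurent_of_vars intro: surface_ring_gens surface_ring_mult surface_ring_add)

text \<open>
  Modulo \<open>x y - p(z)\<close> every polynomial is a combination of powers of \<open>x\<close> alone and powers of \<open>y\<close> alone with
  coefficients in \<open>z\<close>; the Laurent polynomial determines these coefficients.
\<close>

definition normal_monomial :: "complex poly \<Rightarrow> int \<Rightarrow> complex poly \<Rightarrow> poly_xyz"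
  where "normal_monomial p i u = (if i \<ge> 0 then var_x ^ nat i * in_z u
      else var_y ^ nat (- i) * in_z (u div p ^ nat (- i)))"

definition normal_form :: "complex poly \<Rightarrow> laurent \<Rightarrow> poly_xyz"
  where "normal_form p f = (\<Sum>i\<in>keys f. normal_monomial p i (lookup f i))"

lemma laurent_of_normal_monomial:
  assumes "p ^ nat (- i) dvd u"
  shows "laurent_of p (normal_monomial p i u) = single i u"
  using assms
  by (auto simp: normal_monomial_def ring_map[OF ring_map_laurent_of] laurent_of_vars single_power mult_single)

lemma laurent_of_normal_form: "f \<in> surface_ring p \<Longrightarrow> laurent_of p (normal_form p f) = f"
  using laurent_sum_singles[of f]
  by (simp add: normal_form_def ring_map[OF ring_map_laurent_of] surface_ring_def laurent_of_normal_monomial)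

lemma range_laurent_of: "range (laurent_of p) = surface_ring p"
proof
  show "range (laurent_of p) \<subseteq> surface_ring p" using laurent_of_in_surface_ring by auto
  show "surface_ring p \<subseteq> range (laurent_of p)"
  proof
    fix f assume "f \<in> surface_ring p"
    thus "f \<in> range (laurent_of p)" using laurent_of_normal_form[of f p] by (metis rangeI)
  qed
qed

definition relator :: "complex poly \<Rightarrow> poly_xyz" where "relator p = var_x * var_y - in_z p"

lemma normal_monomial_0: "normal_monomial p i 0 = 0" by (simp add: normal_monomial_def in_z_0)

lemma normal_monomial_add:
  assumes "p ^ nat (- i) dvd u" "p ^ nat (- i) dvd v"
  shows "normal_monomial p i (u + v) = normal_monomial p i u + normal_monomial p i v"
  using assms by (simp add: normal_monomial_def in_z_add distrib_left div_plus_div_distrib_dvd_left)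

lemma normal_form_single: "normal_form p (single i u) = normal_monomial p i u"
  by (simp add: normal_form_def normal_monomial_0)

lemma normal_form_superset:
  assumes "finite A" "keys f \<subseteq> A"
  shows "normal_form p f = (\<Sum>i\<in>A. normal_monomial p i (lookup f i))"
  unfolding normal_form_def using assms
  by (intro sum.mono_neutral_left) (auto simp: in_keys_iff normal_monomial_0)

lemma normal_form_add:
  assumes "f \<in> surface_ring p" "g \<in> surface_ring p"
  shows "normal_form p (f + g) = normal_form p f + normal_form p g"
proof -
  let ?A = "keys f \<union> keys g"
  have "normal_form p h = (\<Sum>i\<in>?A. normal_monomial p i (lookup h i))" if "h = f + g \<or> h = f \<or> h = g" for h
    using that keys_add[of f g] by (intro normal_form_superset) auto
  thus ?thesis using assms by (simp add: lookup_add normal_monomial_add surface_ring_def sum.distrib)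
qed

lemma surface_ring_induct_monomials [consumes 1, case_names single add]:
  assumes "f \<in> surface_ring p"
    and "\<And>i u. p ^ nat (- i) dvd u \<Longrightarrow> P (single i u)"
    and "\<And>f g. f \<in> surface_ring p \<Longrightarrow> g \<in> surface_ring p \<Longrightarrow> P f \<Longrightarrow> P g \<Longrightarrow> P (f + g)"
  shows "P f"
proof -
  have "P (\<Sum>i\<in>A. single i (lookup f i))" if "finite A" for A
    using that
  proof induction
    case empty
    show ?case using assms(2)[of 0 0] by simp
  next
    case (insert i A)
    have "(\<Sum>i\<in>A. single i (lookup f i)) \<in> surface_ring p"
      using assms(1) by (intro surface_ring_sum) (simp only: surface_ring_single, simp add: surface_ring_def)
    moreover have "p ^ nat (- i) dvd lookup f i" using assms(1) by (auto simp: surface_ring_def)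
    ultimately show ?case
      using insert assms(3)[of "single i (lookup f i)"] assms(2) by (simp add: surface_ring_single)
  qed
  from this[of "keys f"] show ?thesis by (simp add: laurent_sum_singles)
qed

lemma normal_monomial_x:
  assumes u: "p ^ nat (- i) dvd u" and p: "p \<noteq> 0"
  shows "relator p dvd var_x * normal_monomial p i u - normal_monomial p (i + 1) u"
proof (cases "i \<ge> 0")
  case True
  hence "nat (i + 1) = Suc (nat i)" by simp
  thus ?thesis using True by (simp add: normal_monomial_def mult.assoc)
next
  case False
  define k where "k = nat (- i - 1)"
  from u obtain v where v: "u = p ^ Suc k * v" using False by (auto simp: k_def Suc_nat_eq_nat_zadd1 dvd_def)
  have "normal_monomial p i u = var_y ^ Suc k * in_z v"
    using False p by (simp add: normal_monomial_def v k_def Suc_nat_eq_nat_zadd1)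
  moreover have "normal_monomial p (i + 1) u = var_y ^ k * in_z (p * v)"
  proof (cases "i = -1")
    case True
    thus ?thesis by (simp add: normal_monomial_def v k_def)
  next
    case F: False
    hence "nat (- (i + 1)) = k" "i + 1 < 0" using False by (auto simp: k_def)
    thus ?thesis using p by (simp add: normal_monomial_def v mult.assoc mult.left_commute[of p])
  qed
  ultimately have "var_x * normal_monomial p i u - normal_monomial p (i + 1) u = relator p * (var_y ^ k * in_z v)"
    by (simp add: relator_def in_z_mult algebra_simps)
  thus ?thesis by simp
qed

lemma normal_monomial_y:
  assumes u: "p ^ nat (- i) dvd u" and p: "p \<noteq> 0"
  shows "relator p dvd var_y * normal_monomial p i u - normal_monomial p (i - 1) (p * u)"
proof (cases "i > 0")
  case True
  define k where "k = nat (i - 1)"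
  have "nat i = Suc k" using True by (simp add: k_def Suc_nat_eq_nat_zadd1)
  hence "var_y * normal_monomial p i u - normal_monomial p (i - 1) (p * u) = relator p * (var_x ^ k * in_z u)"
    using True by (simp add: normal_monomial_def k_def relator_def in_z_mult algebra_simps)
  thus ?thesis by simp
next
  case False
  define k where "k = nat (- i)"
  from u obtain v where v: "u = p ^ k * v" by (auto simp: k_def dvd_def)
  have "normal_monomial p i u = var_y ^ k * in_z v"
    using False p by (cases "i = 0") (simp_all add: normal_monomial_def v k_def)
  moreover have "nat (- (i - 1)) = Suc k" using False by (simp add: k_def)
  hence "normal_monomial p (i - 1) (p * u) = var_y ^ Suc k * in_z v"
    using False p by (simp add: normal_monomial_def v flip: mult.assoc)
  ultimately show ?thesis by (simp add: mult.assoc)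
qed

text \<open>
  This identifies the kernel of the map to Laurent polynomials: multiplying a normal form
  by \<open>x\<close> or \<open>y\<close> and renormalising costs a single use of the relation.
\<close>

lemma relator_dvd_diff_normal_form:
  assumes p: "p \<noteq> 0"
  shows "relator p dvd F - normal_form p (laurent_of p F)"
proof (induction F rule: xyz_induct)
  case (in_z u)
  show ?case by (simp add: laurent_of_vars normal_form_single normal_monomial_def)
next
  case (x F)
  have "relator p dvd var_x * normal_form p f - normal_form p (xx * f)" if "f \<in> surface_ring p" for f
    using that
  proof (induction rule: surface_ring_induct_monomials)
    case (single i u)
    from normal_monomial_x[OF this p] show ?case by (simp add: mult_single normal_form_single add.commute)
  next
    case (add f g)
    from dvd_add[OF add(3,4)] show ?case
      using add(1,2) by (simp add: normal_form_add distrib_left surface_ring_mult surface_ring_gens algebra_simps)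
  qed
  from dvd_add[OF this[OF laurent_of_in_surface_ring[of p F]] dvd_mult[OF x, of var_x]]
  show ?case by (simp add: ring_map[OF ring_map_laurent_of] laurent_of_vars algebra_simps)
next
  case (y F)
  have "relator p dvd var_y * normal_form p f - normal_form p (yy p * f)" if "f \<in> surface_ring p" for f
    using that
  proof (induction rule: surface_ring_induct_monomials)
    case (single i u)
    from normal_monomial_y[OF this p] show ?case by (simp add: mult_single normal_form_single)
  next
    case (add f g)
    from dvd_add[OF add(3,4)] show ?case
      using add(1,2) by (simp add: normal_form_add distrib_left surface_ring_mult surface_ring_gens algebra_simps)
  qed
  from dvd_add[OF this[OF laurent_of_in_surface_ring[of p F]] dvd_mult[OF y, of var_y]]
  show ?case by (simp add: ring_map[OF ring_map_laurent_of] laurent_of_vars algebra_simps)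
next
  case (add F G)
  from dvd_add[OF this] show ?case
    by (simp add: ring_map[OF ring_map_laurent_of] normal_form_add laurent_of_in_surface_ring algebra_simps)
qed

lemma laurent_of_relator: "laurent_of p (relator p) = 0"
  by (simp add: relator_def ring_map[OF ring_map_laurent_of] laurent_of_vars mult_single)

lemma laurent_of_eq_iff:
  assumes "p \<noteq> 0"
  shows "laurent_of p F = laurent_of p G \<longleftrightarrow> relator p dvd F - G"
proof
  assume "laurent_of p F = laurent_of p G"
  thus "relator p dvd F - G"
    using dvd_diff[OF relator_dvd_diff_normal_form[OF assms, of F] relator_dvd_diff_normal_form[OF assms, of G]] by simp
next
  assume "relator p dvd F - G"
  then obtain H where "F - G = relator p * H" by (auto simp: dvd_def)
  hence "laurent_of p (F - G) = 0" by (simp only: ring_map[OF ring_map_laurent_of] laurent_of_relator mult_zero_left)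
  thus "laurent_of p F = laurent_of p G" by (simp add: ring_map[OF ring_map_laurent_of])
qed

lemma surface_ring_induct [consumes 1, case_names cst zz xx yy add mult]:
  assumes f: "f \<in> surface_ring p" and cst: "\<And>\<alpha>. P (cst \<alpha>)" and gens: "P zz" "P xx" "P (yy p)"
    and add: "\<And>f g. f \<in> surface_ring p \<Longrightarrow> g \<in> surface_ring p \<Longrightarrow> P f \<Longrightarrow> P g \<Longrightarrow> P (f + g)"
    and mult: "\<And>f g. f \<in> surface_ring p \<Longrightarrow> g \<in> surface_ring p \<Longrightarrow> P f \<Longrightarrow> P g \<Longrightarrow> P (f * g)"
  shows "P f"
proof -
  have z: "P (single 0 u)" for u
  proof (induction u)
    case 0
    show ?case using cst[of 0] by (simp add: cst_def)
  next
    case (pCons a u)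
    have "single 0 (pCons a u) = cst a + zz * single 0 u"
      by (simp add: cst_def mult_single flip: single_add)
    thus ?case using pCons cst gens by (auto intro!: add mult surface_ring_cst surface_ring_gens surface_ring_mult)
  qed
  have "P (laurent_of p F)" for F
    by (induction F rule: xyz_induct)
       (auto simp: ring_map[OF ring_map_laurent_of] laurent_of_vars intro!: z gens add mult surface_ring_gens laurent_of_in_surface_ring surface_ring_mult)
  thus ?thesis using f range_laurent_of by (metis rangeE)
qed

section \<open>Isomorphisms of coordinate rings\<close>

text \<open>
  The map is only constrained on \<open>surface_ring q\<close>. Preservation of constants expresses \<open>\<complex>\<close>-linearity.
\<close>

definition surface_iso :: "complex poly \<Rightarrow> complex poly \<Rightarrow> (laurent \<Rightarrow> laurent) \<Rightarrow> bool"
  where "surface_iso q p \<phi> \<longleftrightarrow> bij_betw \<phi> (surface_ring q) (surface_ring p) \<and>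
    (\<forall>f\<in>surface_ring q. \<forall>g\<in>surface_ring q. \<phi> (f + g) = \<phi> f + \<phi> g \<and> \<phi> (f * g) = \<phi> f * \<phi> g) \<and>
    (\<forall>\<alpha>. \<phi> (cst \<alpha>) = cst \<alpha>)"

lemma cst_0 [simp]: "cst 0 = 0" and cst_1 [simp]: "cst 1 = 1"
  by (simp_all add: ring_map[OF ring_map_cst])
lemma cst_mult: "cst (a * b) = cst a * cst b"
  and cst_uminus: "cst (- a) = - cst a" and cst_power: "cst (a ^ n) = cst a ^ n"
  by (simp_all add: ring_map[OF ring_map_cst])
lemma cst_eq_0_iff [simp]: "cst a = 0 \<longleftrightarrow> a = 0"
  by (simp add: cst_def flip: keys_eq_empty)
lemma surface_isoD:
  assumes "surface_iso q p \<phi>"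
  shows surface_iso_in: "f \<in> surface_ring q \<Longrightarrow> \<phi> f \<in> surface_ring p"
    and surface_iso_add: "f \<in> surface_ring q \<Longrightarrow> g \<in> surface_ring q \<Longrightarrow> \<phi> (f + g) = \<phi> f + \<phi> g"
    and surface_iso_mult: "f \<in> surface_ring q \<Longrightarrow> g \<in> surface_ring q \<Longrightarrow> \<phi> (f * g) = \<phi> f * \<phi> g"
    and surface_iso_cst: "\<phi> (cst \<alpha>) = cst \<alpha>"
    and surface_iso_inj: "f \<in> surface_ring q \<Longrightarrow> g \<in> surface_ring q \<Longrightarrow> \<phi> f = \<phi> g \<longleftrightarrow> f = g"
    and surface_iso_surj: "h \<in> surface_ring p \<Longrightarrow> \<exists>f\<in>surface_ring q. \<phi> f = h"
    and surface_iso_uminus: "f \<in> surface_ring q \<Longrightarrow> \<phi> (- f) = - \<phi> f"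
    and surface_iso_0: "\<phi> 0 = 0"
    and surface_iso_eq_0: "f \<in> surface_ring q \<Longrightarrow> \<phi> f = 0 \<longleftrightarrow> f = 0"
proof -
  show add: "f \<in> surface_ring q \<Longrightarrow> g \<in> surface_ring q \<Longrightarrow> \<phi> (f + g) = \<phi> f + \<phi> g" for f g
    using assms by (simp add: surface_iso_def)
  show "f \<in> surface_ring q \<Longrightarrow> \<phi> f \<in> surface_ring p" using assms by (auto simp: surface_iso_def bij_betw_def)
  show "f \<in> surface_ring q \<Longrightarrow> g \<in> surface_ring q \<Longrightarrow> \<phi> (f * g) = \<phi> f * \<phi> g" using assms by (simp add: surface_iso_def)
  show c: "\<phi> (cst \<alpha>) = cst \<alpha>" for \<alpha> using assms by (simp add: surface_iso_def)
  show inj: "f \<in> surface_ring q \<Longrightarrow> g \<in> surface_ring q \<Longrightarrow> \<phi> f = \<phi> g \<longleftrightarrow> f = g" for f g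
    using assms by (auto simp: surface_iso_def bij_betw_def inj_on_def)
  show "h \<in> surface_ring p \<Longrightarrow> \<exists>f\<in>surface_ring q. \<phi> f = h"
    using assms by (force simp: surface_iso_def bij_betw_def)
  show 0: "\<phi> 0 = 0" using c[of 0] by simp
  show "f \<in> surface_ring q \<Longrightarrow> \<phi> (- f) = - \<phi> f"
    using add[of f "- f"] 0 by (simp add: surface_ring_uminus eq_neg_iff_add_eq_0 add.commute)
  show "f \<in> surface_ring q \<Longrightarrow> \<phi> f = 0 \<longleftrightarrow> f = 0"
    using inj[of f 0] 0 surface_ring_cst[of 0 q] by simp
qed

lemma surface_iso_inv:
  assumes "surface_iso q p \<phi>"
  shows "surface_iso p q (inv_into (surface_ring q) \<phi>)"
proof -
  let ?\<psi> = "inv_into (surface_ring q) \<phi>"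
  have bij: "bij_betw \<phi> (surface_ring q) (surface_ring p)" using assms by (simp add: surface_iso_def)
  have r: "\<phi> (?\<psi> h) = h" "?\<psi> h \<in> surface_ring q" if "h \<in> surface_ring p" for h
    using bij that by (auto simp: bij_betw_def f_inv_into_f inv_into_into)
  have l: "?\<psi> (\<phi> f) = f" if "f \<in> surface_ring q" for f
    using bij that by (auto simp: bij_betw_def inv_into_f_f)
  have "?\<psi> (f + g) = ?\<psi> f + ?\<psi> g \<and> ?\<psi> (f * g) = ?\<psi> f * ?\<psi> g" if "f \<in> surface_ring p" "g \<in> surface_ring p" for f g
    using that r(2)[OF that(1)] r(2)[OF that(2)]
    by (metis r(1) l surface_ring_add surface_ring_mult surface_iso_add[OF assms] surface_iso_mult[OF assms])
  moreover have "?\<psi> (cst \<alpha>) = cst \<alpha>" for \<alpha>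
    by (metis l surface_ring_cst surface_iso_cst[OF assms])
  ultimately show ?thesis
    using bij_betw_inv_into[OF bij] by (simp add: surface_iso_def)
qed

lemma surface_iso_comp:
  assumes "surface_iso q p \<phi>" "surface_iso p r \<psi>"
  shows "surface_iso q r (\<psi> \<circ> \<phi>)"
proof -
  have "bij_betw (\<psi> \<circ> \<phi>) (surface_ring q) (surface_ring r)"
    using assms bij_betw_trans unfolding surface_iso_def by blast
  moreover note [simp] = surface_iso_in[OF assms(1)] surface_iso_add[OF assms(1)] surface_iso_mult[OF assms(1)]
    surface_iso_cst[OF assms(1)] surface_iso_add[OF assms(2)] surface_iso_mult[OF assms(2)] surface_iso_cst[OF assms(2)]
  ultimately show ?thesis by (simp add: surface_iso_def)
qed

lemma Dx_cst: "Dx (cst a) = 0" and Dz_cst: "Dz (cst a) = 0"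
  by (simp_all add: cst_def Dx_single Dz_single)

lemma bracket_cst: "bracket (cst a) f = 0" "bracket f (cst a) = 0"
  by (simp_all add: bracket_def Dx_cst Dz_cst)

lemma bracket_zero [simp]: "bracket 0 f = 0" "bracket f 0 = 0"
  by (simp_all add: bracket_def Dx_0 Dz_0)

lemma bracket_cst_mult: "bracket f (cst a * g) = cst a * bracket f g"
  "bracket (cst a * f) g = cst a * bracket f g"
  by (simp_all add: bracket_mult_right bracket_mult_left bracket_cst)

lemma bracket_xx: "bracket xx f = xx * Dz f"
  by (simp add: bracket_def Dx_single Dz_single)

lemma bracket_gens:
  "bracket xx zz = xx" "bracket xx (yy q) = single 0 (pderiv q)" "bracket zz (yy q) = yy q"
proof -
  show "bracket xx zz = xx"
    by (simp add: bracket_xx Dz_single pderiv_pCons mult_single flip: one_pCons)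
  show "bracket xx (yy q) = single 0 (pderiv q)"
    by (simp add: bracket_xx Dz_single mult_single)
  show "bracket zz (yy q) = yy q"
    by (simp add: bracket_def Dz_single Dx_single pderiv_pCons mult_single single_uminus flip: one_pCons)
qed

lemma surface_ring_bracket:
  assumes "f \<in> surface_ring p" "g \<in> surface_ring p"
  shows "bracket f g \<in> surface_ring p"
proof -
  have neg: "bracket a b \<in> surface_ring p \<Longrightarrow> bracket b a \<in> surface_ring p" for a b
    using surface_ring_uminus[of "bracket a b" p] by (simp add: bracket_commute[of b a])
  have step: "bracket a g \<in> surface_ring p"
    if "bracket a zz \<in> surface_ring p" "bracket a xx \<in> surface_ring p" "bracket a (yy p) \<in> surface_ring p" "a \<in> surface_ring p" for a
    using assms(2)
  proof (induction rule: surface_ring_induct)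
    case (mult f g)
    thus ?case using that by (simp add: bracket_mult_right surface_ring_add surface_ring_mult)
  qed (use that in \<open>auto simp: bracket_cst bracket_add_right intro: surface_ring_add surface_ring_cst[of 0, simplified]\<close>)
  have 0: "0 \<in> surface_ring p" using surface_ring_cst[of 0 p] by simp
  have x: "bracket xx g \<in> surface_ring p"
    by (rule step) (simp_all add: bracket_gens bracket_self surface_ring_gens 0)
  have z: "bracket zz g \<in> surface_ring p"
    by (rule step) (use neg[of xx zz] in \<open>simp_all add: bracket_gens bracket_self surface_ring_gens 0\<close>)
  have y: "bracket (yy p) g \<in> surface_ring p"
    by (rule step) (use neg[of xx "yy p"] neg[of zz "yy p"] in \<open>simp_all add: bracket_gens bracket_self surface_ring_gens 0\<close>)
  show ?thesis
    using assms(1)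
  proof (induction rule: surface_ring_induct)
    case (mult a b)
    thus ?case using assms by (simp add: bracket_mult_left surface_ring_add surface_ring_mult)
  qed (use x y z in \<open>auto simp: bracket_cst bracket_add_left intro: surface_ring_add surface_ring_cst[of 0, simplified]\<close>)
qed

lemma surface_iso_single_0:
  assumes \<phi>: "surface_iso q p \<phi>"
  shows "\<phi> (single 0 u) = peval cst (\<phi> zz) u"
proof (induction u)
  case 0
  show ?case using surface_iso_0[OF \<phi>] by (simp add: peval_0)
next
  case (pCons a u)
  have "single 0 (pCons a u) = cst a + zz * single 0 u"
    by (simp add: cst_def mult_single flip: single_add)
  thus ?case
    using pCons by (simp add: peval_pCons ring_map_cst surface_iso_add[OF \<phi>] surface_iso_mult[OF \<phi>]
        surface_iso_cst[OF \<phi>] surface_ring_cst surface_ring_mult surface_ring_gens)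
qed

lemma bracket_peval: "bracket f (peval cst h u) = peval cst h (pderiv u) * bracket f h"
proof (induction u)
  case 0
  show ?case by (simp add: peval_0)
next
  case (pCons a u)
  note r = ring_map[OF ring_map_peval[OF ring_map_cst]]
  show ?case
    by (simp add: peval_pCons ring_map_cst bracket_add_right bracket_mult_right bracket_cst pCons.IH
        pderiv_pCons r algebra_simps)
qed

section \<open>Isomorphisms preserve the bracket up to a constant\<close>

text \<open>
  Both sides are biderivations along \<open>\<phi>\<close>, so it suffices to compare them on generators. For \<open>(x,z)\<close> this
  is the definition of the factor; for the pairs involving \<open>y\<close>, differentiate
  \<open>\<phi>(x) \<phi>(y) = q(\<phi>(z))\<close>.
\<close>

lemma bracket_surface_iso:
  assumes \<phi>: "surface_iso q p \<phi>" and ab: "a \<in> surface_ring q" "b \<in> surface_ring q"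
  shows "\<phi> xx * bracket (\<phi> a) (\<phi> b) = bracket (\<phi> xx) (\<phi> zz) * \<phi> (bracket a b)"
proof -
  define f g h where "f = \<phi> xx" and "g = \<phi> (yy q)" and "h = \<phi> zz"
  define E where "E = bracket f h"
  define P where "P a b \<longleftrightarrow> f * bracket (\<phi> a) (\<phi> b) = E * \<phi> (bracket a b)" for a b
  note hom = surface_iso_add[OF \<phi>] surface_iso_mult[OF \<phi>] surface_iso_cst[OF \<phi>] surface_iso_uminus[OF \<phi>] surface_iso_0[OF \<phi>]
  have sym: "P a b \<Longrightarrow> P b a" if "a \<in> surface_ring q" "b \<in> surface_ring q" for a b
    using that by (simp add: P_def bracket_commute[of b a] bracket_commute[of "\<phi> b"] hom surface_ring_bracket)
  have self: "P a a" for a by (simp add: P_def bracket_self hom)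
  have step: "P a b" if "P a zz" "P a xx" "P a (yy q)" "a \<in> surface_ring q" "b \<in> surface_ring q" for a b
    using that(5)
  proof (induction rule: surface_ring_induct)
    case (mult b c)
    have "f * bracket (\<phi> a) (\<phi> (b * c)) = \<phi> b * (f * bracket (\<phi> a) (\<phi> c)) + \<phi> c * (f * bracket (\<phi> a) (\<phi> b))"
      using mult that by (simp add: hom bracket_mult_right algebra_simps)
    also have "\<dots> = E * (\<phi> b * \<phi> (bracket a c) + \<phi> c * \<phi> (bracket a b))"
      using mult by (simp add: P_def algebra_simps)
    also have "\<dots> = E * \<phi> (bracket a (b * c))"
      using mult that by (simp add: hom bracket_mult_right surface_ring_bracket surface_ring_mult)
    finally show ?case by (simp add: P_def)
  qed (use that in \<open>auto simp: P_def hom bracket_cst bracket_add_right surface_ring_bracket distrib_left\<close>)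
  have fg: "f * g = peval cst h q"
    using surface_iso_single_0[OF \<phi>, of q] xx_times_yy[of q] hom(2)[of xx "yy q"]
    by (simp add: f_def g_def h_def surface_ring_gens)
  have "f * bracket f g = bracket f (f * g)"
    by (simp add: bracket_mult_right bracket_self)
  also have "\<dots> = peval cst h (pderiv q) * E"
    by (simp only: fg bracket_peval E_def)
  finally have xy: "P xx (yy q)"
    unfolding P_def bracket_gens surface_iso_single_0[OF \<phi>, of "pderiv q"]
      f_def[symmetric] g_def[symmetric] h_def[symmetric] by (simp only: mult.commute)
  have "f * bracket h g - g * E = bracket h (f * g)"
    by (simp add: bracket_mult_right bracket_commute[of h f] E_def)
  also have "\<dots> = 0" by (simp only: fg bracket_peval bracket_self mult_zero_right)
  finally have zy: "P zz (yy q)"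
    by (simp add: P_def bracket_gens f_def g_def h_def mult.commute)
  have xz: "P xx zz" by (simp add: P_def bracket_gens E_def f_def h_def mult.commute)
  have "P xx b" "P zz b" "P (yy q) b"
    by (rule step; use xz xy zy self ab sym in \<open>auto simp: surface_ring_gens\<close>)+
  hence "P b zz" "P b xx" "P b (yy q)"
    using sym[of zz b] sym[of xx b] sym[of "yy q" b] ab surface_ring_gens by simp_all
  hence "P b a" by (rule step) (use ab in simp_all)
  hence "P a b" using sym[of b a] ab by simp
  thus ?thesis by (simp add: P_def f_def E_def h_def)
qed

lemma surface_ring_power_dvd: "f \<in> surface_ring p \<Longrightarrow> p ^ nat (- i) dvd lookup f i"
  by (simp add: surface_ring_def)

lemma surface_ring_unit_monomial:
  assumes p: "degree p > 0" and "single i u \<in> surface_ring p" "is_unit u"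
  shows "i \<ge> 0"
proof (rule ccontr)
  assume "\<not> i \<ge> 0"
  hence "p ^ 1 dvd p ^ nat (- i)" by (intro le_imp_power_dvd) linarith
  hence "p dvd 1" using assms by (auto simp: surface_ring_single dest: dvd_trans)
  thus False using p by (auto simp: is_unit_poly_iff)
qed

text \<open>
  In other words, \<open>x\<close> is irreducible in the coordinate ring.
\<close>

lemma factor_of_xx:
  assumes q: "degree q > 0" and fg: "f \<in> surface_ring q" "g \<in> surface_ring q" "f * g = xx"
  shows "(\<exists>c. c \<noteq> 0 \<and> f = cst c) \<or> (\<exists>c. c \<noteq> 0 \<and> f = cst c * xx)"
proof -
  obtain i u j v where f: "f = single i u" and g: "g = single j v"
    using factor_of_monomial[of f g 1 1] factor_of_monomial[of g f 1 1] fg(3) by (auto simp: mult.commute)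
  have "single (i + j) (u * v) = single 1 1" using fg(3) by (simp add: f g mult_single)
  hence ij: "i + j = 1" and uv: "u * v = 1"
    by (metis lookup_single_eq lookup_single_not_eq one_neq_zero)+
  have "i \<ge> 0" "j \<ge> 0" using surface_ring_unit_monomial[OF q] fg(1,2) dvdI[OF uv[symmetric]] dvdI[of 1 v u] uv
    by (auto simp: f g mult.commute)
  hence "i = 0 \<or> i = 1" using ij by linarith
  moreover obtain c where c: "u = [:c:]" "c \<noteq> 0"
    using uv by (metis dvdI is_unit_poly_iff dvd_field_iff not_is_unit_0)
  ultimately show ?thesis by (auto simp: f cst_def mult_single)
qed

text \<open>
  With \<open>f, h\<close> the images of \<open>x, z\<close>, the quotient \<open>I = f/{f,h}\<close> is the factor between the two brackets. It
  is regular on the surface: as \<open>\<phi>\<close> is onto, \<open>I x\<close> and \<open>I y\<close> are values of \<open>\<phi>\<close> on brackets. It divides the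
  images of \<open>x\<close> and \<open>y\<close>, because \<open>{x,z} = x\<close> and \<open>{z,y} = y\<close>, and the only common divisors of
  \<open>x\<close> and \<open>y\<close> are constants.
\<close>

lemma bracket_rigid:
  assumes \<phi>: "surface_iso q p \<phi>" and q: "degree q > 0" and p: "p \<noteq> 0"
  shows "\<exists>c. c \<noteq> 0 \<and> (\<forall>a\<in>surface_ring q. \<forall>b\<in>surface_ring q. bracket (\<phi> a) (\<phi> b) = cst c * \<phi> (bracket a b))"
proof -
  define f g h where "f = \<phi> xx" and "g = \<phi> (yy q)" and "h = \<phi> zz"
  define E where "E = bracket f h"
  note key = bracket_surface_iso[OF \<phi>, folded f_def h_def E_def]
  obtain x' y' z' where pre: "x' \<in> surface_ring q" "y' \<in> surface_ring q" "z' \<in> surface_ring q"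
    "\<phi> x' = xx" "\<phi> y' = yy p" "\<phi> z' = zz"
    using surface_iso_surj[OF \<phi>] surface_ring_gens by metis
  define I where "I = \<phi> (bracket x' z') * single (- 1) 1"
  have "f * xx = E * \<phi> (bracket x' z')"
    using key[OF pre(1,3)] by (simp add: pre bracket_gens)
  hence "f * xx * single (- 1) 1 = E * I" by (simp add: I_def mult.assoc)
  hence fEI: "f = E * I" by (simp add: mult.assoc mult_single)
  have fnz: "f \<noteq> 0"
    using surface_iso_eq_0[OF \<phi> surface_ring_gens(1)] by (simp add: f_def flip: keys_eq_empty)
  hence E: "E \<noteq> 0" using fEI by auto
  have "E * (I * yy p) = E * \<phi> (bracket z' y')"
    using key[OF pre(3,2)] by (simp add: pre bracket_gens fEI mult.assoc)
  hence Iy: "I * yy p \<in> surface_ring p"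
    using E pre by (simp add: surface_iso_in[OF \<phi>] surface_ring_bracket)
  have I: "I \<in> surface_ring p"
    unfolding surface_ring_def
  proof (intro CollectI allI)
    fix i
    show "p ^ nat (- i) dvd lookup I i"
    proof (cases "i \<le> 0")
      case True
      have "p ^ nat (- (i - 1)) dvd lookup (I * yy p) (i - 1)" using Iy by (rule surface_ring_power_dvd)
      moreover have "lookup (I * yy p) (i - 1) = p * lookup I i"
        using lookup_single_mult[of "- 1" p I "i - 1"] by (simp add: mult.commute)
      moreover have "nat (- (i - 1)) = Suc (nat (- i))" using True by simp
      ultimately show ?thesis using p by simp
    qed simp
  qed
  have rig: "I * bracket (\<phi> a) (\<phi> b) = \<phi> (bracket a b)" if "a \<in> surface_ring q" "b \<in> surface_ring q" for a b
  proof -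
    have "E * (I * bracket (\<phi> a) (\<phi> b)) = E * \<phi> (bracket a b)"
      using key[OF that] by (simp add: fEI mult.assoc)
    thus ?thesis using E by simp
  qed
  obtain \<iota> where \<iota>: "\<iota> \<in> surface_ring q" "\<phi> \<iota> = I" using surface_iso_surj[OF \<phi> I] by blast
  have div: "\<exists>e\<in>surface_ring q. \<iota> * e = b"
    if b: "b \<in> surface_ring q" "\<phi> b = I * e'" and e': "e' \<in> surface_ring p" for b e'
  proof -
    obtain e where e: "e \<in> surface_ring q" "\<phi> e = e'" using surface_iso_surj[OF \<phi> e'] by blast
    hence "\<phi> (\<iota> * e) = \<phi> b" using \<iota> b by (simp add: surface_iso_mult[OF \<phi>])
    hence "\<iota> * e = b" using e(1) \<iota>(1) b(1) surface_iso_inj[OF \<phi> surface_ring_mult] by blast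
    thus ?thesis using e(1) by blast
  qed
  have fgh: "f \<in> surface_ring p" "g \<in> surface_ring p" "h \<in> surface_ring p"
    by (simp_all add: f_def g_def h_def surface_iso_in[OF \<phi>] surface_ring_gens)
  obtain e where e: "e \<in> surface_ring q" "\<iota> * e = xx"
  proof -
    have "\<phi> xx = I * E" using fEI unfolding f_def by (simp only: mult.commute)
    moreover have "E \<in> surface_ring p" unfolding E_def by (intro surface_ring_bracket fgh)
    ultimately show thesis using div[OF surface_ring_gens(1)] that by blast
  qed
  obtain e2 where e2: "e2 \<in> surface_ring q" "\<iota> * e2 = yy q"
  proof -
    have "\<phi> (yy q) = I * bracket h g"
      using rig[OF surface_ring_gens(3,2)] unfolding h_def g_def bracket_gens by (rule sym)
    moreover have "bracket h g \<in> surface_ring p" by (intro surface_ring_bracket fgh)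
    ultimately show thesis using div[OF surface_ring_gens(2)] that by blast
  qed
  have "\<nexists>c. c \<noteq> 0 \<and> \<iota> = cst c * xx"
  proof
    assume "\<exists>c. c \<noteq> 0 \<and> \<iota> = cst c * xx"
    then obtain c where c: "c \<noteq> 0" "\<iota> = single 1 [:c:]" by (auto simp: cst_def mult_single)
    have "lookup (\<iota> * e2) (- 1) = q" by (simp add: e2)
    hence l: "[:c:] * lookup e2 (- 2) = q" by (simp add: c lookup_single_mult)
    have "q ^ nat 2 dvd lookup e2 (- 2)" using surface_ring_power_dvd[OF e2(1), of "- 2"] by simp
    hence "q * q dvd [:c:] * lookup e2 (- 2)" by (simp add: power2_eq_square dvd_smult)
    hence "q * q dvd q * 1" using l by simp
    moreover have "q \<noteq> 0" using q by auto
    ultimately have "q dvd 1" by (metis dvd_mult_cancel_left)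
    thus False using q by (auto simp: is_unit_poly_iff)
  qed
  then obtain c where c: "c \<noteq> 0" "\<iota> = cst c" using factor_of_xx[OF q \<iota>(1) e] by blast
  hence "I = cst c" using \<iota> surface_iso_cst[OF \<phi>] by simp
  hence "bracket (\<phi> a) (\<phi> b) = cst (inverse c) * \<phi> (bracket a b)" if "a \<in> surface_ring q" "b \<in> surface_ring q" for a b
    using rig[OF that, symmetric] c by (simp flip: cst_mult mult.assoc)
  thus ?thesis using c by (intro exI[of _ "inverse c"]) auto
qed

section \<open>Elements with locally nilpotent bracket\<close>

definition ad_nilpotent :: "complex poly \<Rightarrow> laurent \<Rightarrow> bool"
  where "ad_nilpotent p f \<longleftrightarrow> (\<forall>b\<in>surface_ring p. \<exists>N. (bracket f ^^ N) b = 0)"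

lemma pderiv_nilpotent: "\<exists>N. (pderiv ^^ N) (u :: complex poly) = 0"
proof (induction "degree u" arbitrary: u)
  case 0
  hence "(pderiv ^^ 1) u = 0" by (simp add: pderiv_eq_0_iff)
  thus ?case by blast
next
  case (Suc n)
  hence "n = degree (pderiv u)" by (simp add: degree_pderiv)
  with Suc obtain N where "(pderiv ^^ N) (pderiv u) = 0" by blast
  hence "(pderiv ^^ Suc N) u = 0" by (simp only: funpow_Suc_right o_apply)
  thus ?case by blast
qed

lemma Dz_nilpotent: "\<exists>N. (Dz ^^ N) f = 0"
proof (induction f rule: laurent_induct)
  case (single i u)
  have "(Dz ^^ n) (single i u) = single i ((pderiv ^^ n) u)" for n
    by (induction n) (simp_all add: Dz_single)
  moreover obtain N where "(pderiv ^^ N) u = 0" using pderiv_nilpotent by blast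
  ultimately show ?case by (intro exI[of _ N]) (simp only: single_zero)
next
  case (add f g)
  then obtain M N where MN: "(Dz ^^ M) f = 0" "(Dz ^^ N) g = 0" by blast
  have 0: "(Dz ^^ n) 0 = 0" for n by (induction n) (simp_all add: Dz_0)
  have "(Dz ^^ n) (f + g) = (Dz ^^ n) f + (Dz ^^ n) g" for n
    by (induction n) (simp_all add: Dz_add)
  moreover have "(Dz ^^ (N + M)) f = 0" "(Dz ^^ (M + N)) g = 0"
    unfolding funpow_add by (simp_all add: MN 0)
  ultimately show ?case by (intro exI[of _ "M + N"]) (simp add: add.commute)
qed

lemma bracket_xx_funpow: "(bracket xx ^^ n) f = xx ^ n * (Dz ^^ n) f"
proof (induction n)
  case (Suc n)
  have "Dz (xx ^ n) = 0" by (simp add: single_power Dz_single)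
  have "(bracket xx ^^ Suc n) f = xx * Dz (xx ^ n * (Dz ^^ n) f)"
    by (simp only: funpow.simps o_apply Suc bracket_xx)
  also have "\<dots> = xx ^ Suc n * (Dz ^^ Suc n) f"
    by (simp only: Dz_mult \<open>Dz (xx ^ n) = 0\<close> mult_zero_left add_0 power_Suc mult.assoc funpow.simps o_apply)
  finally show ?case .
qed simp

lemma ad_nilpotent_image_xx:
  assumes \<phi>: "surface_iso q p \<phi>" and q: "degree q > 0" and p: "p \<noteq> 0"
  shows "ad_nilpotent p (\<phi> xx)"
  unfolding ad_nilpotent_def
proof
  fix b' assume "b' \<in> surface_ring p"
  then obtain b where b: "b \<in> surface_ring q" "\<phi> b = b'" using surface_iso_surj[OF \<phi>] by blast
  obtain c where c: "\<And>a b. a \<in> surface_ring q \<Longrightarrow> b \<in> surface_ring q \<Longrightarrow> bracket (\<phi> a) (\<phi> b) = cst c * \<phi> (bracket a b)"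
    using bracket_rigid[OF assms] by blast
  have in_dan: "(bracket xx ^^ n) b \<in> surface_ring q" for n
    by (induction n) (simp_all add: b surface_ring_bracket surface_ring_gens)
  have it: "(bracket (\<phi> xx) ^^ n) b' = cst c ^ n * \<phi> ((bracket xx ^^ n) b)" for n
  proof (induction n)
    case (Suc n)
    have "bracket (\<phi> xx) (cst c ^ n * \<phi> ((bracket xx ^^ n) b)) = cst c ^ n * bracket (\<phi> xx) (\<phi> ((bracket xx ^^ n) b))"
      by (simp add: bracket_cst_mult flip: cst_power)
    thus ?case by (simp add: Suc c[OF surface_ring_gens(1) in_dan] mult_ac)
  qed (simp add: b)
  obtain N where "(Dz ^^ N) b = 0" using Dz_nilpotent by blast
  hence "(bracket (\<phi> xx) ^^ N) b' = 0"
    by (simp add: it bracket_xx_funpow surface_iso_0[OF \<phi>])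
  thus "\<exists>N. (bracket (\<phi> xx) ^^ N) b' = 0" by blast
qed

section \<open>Automorphisms of the surface\<close>

text \<open>
  Inverses are unique, so the image of \<open>x\<close> determines that of \<open>1/x\<close>.
\<close>

lemma ring_map_laurent_eqI:
  assumes F: "ring_map F" and G: "ring_map (G :: laurent \<Rightarrow> laurent)"
    and cst: "\<And>\<alpha>. F (cst \<alpha>) = G (cst \<alpha>)" and z: "F zz = G zz" and x: "F xx = G xx"
  shows "F f = G f"
proof (induction f rule: laurent_induct)
  case (single i u)
  note r = ring_map[OF F] ring_map[OF G]
  have zu: "F (single 0 u) = G (single 0 u)" for u
  proof (induction u)
    case (pCons a u)
    have "single 0 (pCons a u) = cst a + zz * single 0 u"
      by (simp add: cst_def mult_single flip: single_add)
    thus ?case by (simp add: r cst z pCons.IH)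
  qed (simp add: r)
  have "xx * single (- 1) 1 = 1" by (simp add: mult_single)
  hence FG: "F xx * F (single (- 1) 1) = 1" "G xx * G (single (- 1) 1) = 1"
    by (simp_all flip: r(4) r(12) add: r(2) r(10))
  hence y: "F (single (- 1) 1) = G (single (- 1) 1)"
  proof -
    have "F (single (- 1) 1) = (G xx * G (single (- 1) 1)) * F (single (- 1) 1)"
      by (simp only: FG(2) mult_1_left)
    also have "\<dots> = (F xx * F (single (- 1) 1)) * G (single (- 1) 1)" by (simp only: x mult_ac)
    also have "\<dots> = G (single (- 1) 1)" by (simp only: FG(1) mult_1_left)
    finally show ?thesis .
  qed
  have "single i u = single 0 u * (if i \<ge> 0 then xx ^ nat i else single (- 1) 1 ^ nat (- i))"
    by (simp add: single_power mult_single)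
  thus ?case by (simp add: r zu x y)
qed (simp add: ring_map[OF F] ring_map[OF G])

text \<open>
  The exchange of \<open>x\<close> and \<open>y\<close> sends \<open>x\<close> to \<open>p(z)/x\<close>, which is in general not
  invertible among the Laurent polynomials; hence the detour through polynomial representatives.
\<close>

definition swap_xy :: "complex poly \<Rightarrow> laurent \<Rightarrow> laurent"
  where "swap_xy p f = eval_xyz (yy p) xx zz (normal_form p f)"

lemma swap_xy_laurent_of:
  assumes p: "p \<noteq> 0"
  shows "swap_xy p (laurent_of p F) = eval_xyz (yy p) xx zz F"
proof -
  obtain H where "F - normal_form p (laurent_of p F) = relator p * H" using relator_dvd_diff_normal_form[OF p] by (auto simp: dvd_def)
  moreover have "eval_xyz (yy p) xx zz (relator p) = 0"
    by (simp add: relator_def ring_map[OF ring_map_eval_xyz] eval_xyz_vars peval_cst_zz mult_single)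
  ultimately have "eval_xyz (yy p) xx zz (F - normal_form p (laurent_of p F)) = 0"
    by (simp only: ring_map[OF ring_map_eval_xyz] mult_zero_left)
  thus ?thesis by (simp add: swap_xy_def ring_map[OF ring_map_eval_xyz])
qed

lemma swap_xy_hom:
  assumes p: "p \<noteq> 0" and "f \<in> surface_ring p" "g \<in> surface_ring p"
  shows "swap_xy p (f + g) = swap_xy p f + swap_xy p g" "swap_xy p (f * g) = swap_xy p f * swap_xy p g"
proof -
  obtain F G where FG: "f = laurent_of p F" "g = laurent_of p G" using assms range_laurent_of by (metis rangeE)
  show "swap_xy p (f + g) = swap_xy p f + swap_xy p g" "swap_xy p (f * g) = swap_xy p f * swap_xy p g"
    unfolding FG ring_map(3,4)[OF ring_map_laurent_of, symmetric] swap_xy_laurent_of[OF p]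
    by (rule ring_map[OF ring_map_eval_xyz])+
qed

lemma swap_xy_gens:
  assumes p: "p \<noteq> 0"
  shows "swap_xy p xx = yy p" "swap_xy p (yy p) = xx" "swap_xy p zz = zz" "swap_xy p (cst \<alpha>) = cst \<alpha>"
  using swap_xy_laurent_of[OF p, of var_x] swap_xy_laurent_of[OF p, of var_y] swap_xy_laurent_of[OF p, of "in_z [:0,1:]"]
    swap_xy_laurent_of[OF p, of "in_z [:\<alpha>:]"]
  by (simp_all add: laurent_of_vars eval_xyz_vars peval_cst_zz cst_def)

lemma swap_xy_in_surface_ring:
  assumes p: "p \<noteq> 0" and f: "f \<in> surface_ring p"
  shows "swap_xy p f \<in> surface_ring p"
  using f
  by (induction rule: surface_ring_induct) (simp_all add: swap_xy_gens[OF p] swap_xy_hom[OF p] surface_ring_cst surface_ring_gens surface_ring_add surface_ring_mult)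

lemma swap_xy_swap_xy:
  assumes p: "p \<noteq> 0" and f: "f \<in> surface_ring p"
  shows "swap_xy p (swap_xy p f) = f"
  using f
  by (induction rule: surface_ring_induct) (simp_all add: swap_xy_gens[OF p] swap_xy_hom[OF p] swap_xy_in_surface_ring[OF p])

lemma surface_iso_swap_xy:
  assumes p: "p \<noteq> 0"
  shows "surface_iso p p (swap_xy p)"
  unfolding surface_iso_def
  by (auto simp: swap_xy_hom[OF p] swap_xy_gens[OF p] intro!: bij_betwI[where g = "swap_xy p"] swap_xy_in_surface_ring[OF p] swap_xy_swap_xy[OF p])

lemma lookup_swap_xy:
  assumes p: "p \<noteq> 0" and f: "f \<in> surface_ring p"
  shows "lookup (swap_xy p f) (- i) = (if i \<ge> 0 then p ^ nat i * lookup f i else lookup f i div p ^ nat (- i))"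
  using f
proof (induction rule: surface_ring_induct_monomials)
  case (single j u)
  have "swap_xy p (single j u) = single (- j) (if j \<ge> 0 then p ^ nat j * u else u div p ^ nat (- j))"
    by (auto simp: swap_xy_def normal_form_single normal_monomial_def ring_map[OF ring_map_eval_xyz] eval_xyz_vars peval_cst_zz
        single_power mult_single)
  thus ?case by (auto simp: lookup_single when_def)
next
  case (add f g)
  moreover have "(lookup f i + lookup g i) div p ^ nat (- i) = lookup f i div p ^ nat (- i) + lookup g i div p ^ nat (- i)"
    using add by (intro div_plus_div_distrib_dvd_left) (simp add: surface_ring_def)
  ultimately show ?case by (simp add: swap_xy_hom[OF p] lookup_add distrib_left)
qed

lemma lookup_swap_xy_eq_0_iff:
  assumes p: "p \<noteq> 0" and f: "f \<in> surface_ring p"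
  shows "lookup (swap_xy p f) i = 0 \<longleftrightarrow> lookup f (- i) = 0"
  using lookup_swap_xy[OF assms, of "- i"] surface_ring_power_dvd[OF f, of "- i"] p
  by (auto simp: dvd_div_eq_0_iff)

text \<open>
  The exchange turns the lowest exponent of \<open>x\<close> into the highest one and conversely, so it reduces the case
  of a large power of \<open>y\<close> to that of a large power of \<open>x\<close>.
\<close>

lemma swap_xy_degrees:
  assumes p: "p \<noteq> 0" and f: "f \<in> surface_ring p" "f \<noteq> 0"
  shows "ldeg (swap_xy p f) = - lbot f" "lbot (swap_xy p f) = - ldeg f"
proof -
  note z = lookup_swap_xy_eq_0_iff[OF p f(1)]
  show "ldeg (swap_xy p f) = - lbot f"
    using f(2) by (intro ldeg_eqI) (auto simp: z lookup_lbot_nonzero lookup_below_lbot)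
  show "lbot (swap_xy p f) = - ldeg f"
    using lcoef_nonzero[OF f(2)] by (intro lbot_eqI) (auto simp: z lcoef_def lookup_above_ldeg)
qed

text \<open>
  The automorphism \<open>z \<mapsto> z + \<mu> x\<^sup>s\<close>, the time-one flow of a multiple of the bracket with \<open>x\<^sup>s\<close>.
\<close>

definition shear :: "complex \<Rightarrow> nat \<Rightarrow> laurent \<Rightarrow> laurent"
  where "shear \<mu> s = lmap (peval cst (zz + cst \<mu> * xx ^ s)) 1"

lemma ring_map_shear: "ring_map (shear \<mu> s)"
  unfolding shear_def by (intro ring_map_lmap ring_map_peval ring_map_cst)

lemma shear_single: "shear \<mu> s (single i u) = single i 1 * peval cst (zz + cst \<mu> * xx ^ s) u"
  by (simp add: shear_def lmap_single ring_map_peval ring_map_cst)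

lemma shear_gens:
  "shear \<mu> s (cst \<alpha>) = cst \<alpha>" "shear \<mu> s zz = zz + cst \<mu> * xx ^ s" "shear \<mu> s xx = xx"
  using ring_map(2)[OF ring_map_peval[OF ring_map_cst]]
  by (simp_all add: shear_single cst_def[of \<alpha>] peval_pCons ring_map_cst peval_0)

lemma shear_shear: "shear (- \<mu>) s (shear \<mu> s f) = f"
proof -
  have "(shear (- \<mu>) s \<circ> shear \<mu> s) f = id f"
    by (rule ring_map_laurent_eqI[where F = "shear (- \<mu>) s \<circ> shear \<mu> s" and G = id])
       (auto simp: shear_gens ring_map[OF ring_map_shear] cst_uminus intro!: ring_mapI)
  thus ?thesis by simp
qed

lemma peval_shifted:
  assumes "v \<in> surface_ring p"
  shows "\<exists>w\<in>surface_ring p. peval cst (zz + xx * v) u = single 0 u + xx * w"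
proof (induction u)
  case 0
  show ?case using surface_ring_cst[of 0 p] by (intro bexI[of _ 0]) (simp_all add: peval_0)
next
  case (pCons a u)
  then obtain w where w: "w \<in> surface_ring p" "peval cst (zz + xx * v) u = single 0 u + xx * w" by blast
  have "single 0 (pCons a u) = cst a + zz * single 0 u"
    by (simp add: cst_def mult_single flip: single_add)
  hence "peval cst (zz + xx * v) (pCons a u)
      = single 0 (pCons a u) + xx * (v * single 0 u + (zz + xx * v) * w)"
    unfolding peval_pCons[OF ring_map_cst] w(2) by (simp only:) (simp add: algebra_simps)
  moreover have "v * single 0 u + (zz + xx * v) * w \<in> surface_ring p"
    using assms w by (intro surface_ring_add surface_ring_mult surface_ring_gens)
  ultimately show ?case by blast
qed

text \<open>
  Only \<open>y = p(z)/x\<close> is at stake: \<open>p(z + \<mu> x\<^sup>s) - p(z)\<close> is divisible by \<open>x\<close> when \<open>s > 0\<close>.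
\<close>

lemma shear_in_surface_ring:
  assumes s: "s > 0" and f: "f \<in> surface_ring p"
  shows "shear \<mu> s f \<in> surface_ring p"
  using f
proof (induction rule: surface_ring_induct)
  case yy
  define v where "v = cst \<mu> * xx ^ (s - 1)"
  have "v \<in> surface_ring p" unfolding v_def by (intro surface_ring_mult surface_ring_cst surface_ring_power surface_ring_gens)
  moreover have "xx * v = cst \<mu> * xx ^ s"
    using s unfolding v_def by (cases s) (simp_all add: mult_ac)
  ultimately obtain w where w: "w \<in> surface_ring p" "peval cst (zz + cst \<mu> * xx ^ s) p = single 0 p + xx * w"
    using peval_shifted[of v p p] by auto
  have "shear \<mu> s (yy p) = yy p + w"
    unfolding shear_single w distrib_left mult.assoc[symmetric] by (simp add: mult_single)
  thus ?case using w by (simp add: surface_ring_add surface_ring_gens)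
qed (simp_all add: shear_gens ring_map[OF ring_map_shear] surface_ring_cst surface_ring_gens surface_ring_add surface_ring_mult surface_ring_power)

lemma surface_iso_shear:
  assumes s: "s > 0"
  shows "surface_iso p p (shear \<mu> s)"
  unfolding surface_iso_def
  using shear_shear[of \<mu> s] shear_shear[of "- \<mu>" s]
  by (auto simp: ring_map[OF ring_map_shear] shear_gens
      intro!: bij_betwI[where g = "shear (- \<mu>) s"] shear_in_surface_ring[OF s])

lemma lookup_cst: "lookup (cst \<alpha>) i = (if i = 0 then [:\<alpha>:] else 0)"
  by (simp add: cst_def lookup_single when_def)

lemma lookup_peval_neg:
  assumes "\<And>i. i < 0 \<Longrightarrow> lookup h i = 0"
  shows "lookup (peval cst h u) 0 = pcompose u (lookup h 0)"
    and "i < 0 \<Longrightarrow> lookup (peval cst h u) i = 0"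
proof -
  have "lookup (peval cst h u) 0 = pcompose u (lookup h 0) \<and> (\<forall>i<0. lookup (peval cst h u) i = 0)"
  proof (induction u)
    case (pCons a u)
    thus ?case using lookup_mult_lower[of 0 h 0 "peval cst h u"] assms
      by (auto simp: peval_pCons ring_map_cst lookup_add lookup_cst pcompose_pCons)
  qed (simp add: peval_0)
  thus "lookup (peval cst h u) 0 = pcompose u (lookup h 0)"
    and "i < 0 \<Longrightarrow> lookup (peval cst h u) i = 0" by auto
qed

lemma lookup_shear_below:
  assumes "\<And>i. i < b \<Longrightarrow> lookup f i = 0" "j < b"
  shows "lookup (shear \<mu> s f) j = 0"
proof -
  let ?h = "zz + cst \<mu> * xx ^ s"
  have neg: "lookup (peval cst ?h u) i = 0" if "i < 0" for i u
    using that by (intro lookup_peval_neg(2))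
      (auto simp: lookup_add lookup_cst_mult single_power lookup_single when_def)
  have "shear \<mu> s f = (\<Sum>i\<in>keys f. shear \<mu> s (single i (lookup f i)))"
    using laurent_sum_singles[of f] by (simp flip: ring_map(8)[OF ring_map_shear])
  hence "lookup (shear \<mu> s f) j = (\<Sum>i\<in>keys f. lookup (peval cst ?h (lookup f i)) (j - i))"
    by (simp add: lookup_sum shear_single lookup_single_mult)
  also have "\<dots> = 0"
  proof (rule sum.neutral, rule ballI)
    fix i assume "i \<in> keys f"
    hence "b \<le> i" using assms(1)[of i] by (force simp: in_keys_iff)
    thus "lookup (peval cst ?h (lookup f i)) (j - i) = 0" using assms(2) by (intro neg) simp
  qed
  finally show ?thesis .
qed

definition subst_z :: "complex poly \<Rightarrow> laurent \<Rightarrow> laurent"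
  where "subst_z v = lmap (\<lambda>u. single 0 (pcompose u v)) 1"

lemma ring_map_subst_z_coeff: "ring_map (\<lambda>u. single 0 (pcompose u v) :: laurent)"
  by (rule ring_mapI) (simp_all add: pcompose_1 pcompose_add pcompose_mult single_add mult_single)

lemma ring_map_subst_z: "ring_map (subst_z v)"
  unfolding subst_z_def by (intro ring_map_lmap ring_map_subst_z_coeff)

lemma subst_z_single: "subst_z v (single i u) = single i (pcompose u v)"
  by (simp add: subst_z_def lmap_single ring_map_subst_z_coeff mult_single)

lemma lookup_subst_z: "lookup (subst_z v f) i = pcompose (lookup f i) v"
proof (induction f rule: laurent_induct)
  case (single j u)
  show ?case by (simp add: subst_z_single lookup_single when_def)
qed (simp add: ring_map[OF ring_map_subst_z] lookup_add pcompose_add)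

lemma weigh_gens: "weigh A B (cst \<alpha>) = cst \<alpha>" "weigh A B zz = single A [:0, 1:]" "weigh A B xx = single B 1"
  by (simp_all add: weigh_single cst_def weigh_poly_pCons weigh_poly_0 ring_map[OF ring_map_weigh_poly] flip: one_pCons)

text \<open>
  When \<open>z\<close> and \<open>x\<^sup>s\<close> have the same weight, the shear acts on leading forms as the translation
  \<open>\<zeta> \<mapsto> \<zeta> + c\<close>, which is how it moves a root \<open>c\<close> of a leading form to \<open>0\<close>.
\<close>

lemma weigh_shear:
  assumes "A = B * int s"
  shows "weigh A B (shear c s f) = subst_z [:c, 1:] (weigh A B f)"
proof -
  note t = subst_z_single[of "[:c, 1:]"]
  have "(weigh A B \<circ> shear c s) f = (subst_z [:c, 1:] \<circ> weigh A B) f"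
  proof (rule ring_map_laurent_eqI[where F = "weigh A B \<circ> shear c s" and G = "subst_z [:c, 1:] \<circ> weigh A B"])
    show "ring_map (weigh A B \<circ> shear c s)" "ring_map (subst_z [:c, 1:] \<circ> weigh A B)"
      by (auto intro!: ring_mapI simp: ring_map[OF ring_map_weigh] ring_map[OF ring_map_shear] ring_map[OF ring_map_subst_z])
    show "(weigh A B \<circ> shear c s) (cst \<alpha>) = (subst_z [:c, 1:] \<circ> weigh A B) (cst \<alpha>)" for \<alpha>
      by (simp add: shear_gens weigh_gens) (simp add: cst_def t)
    show "(weigh A B \<circ> shear c s) xx = (subst_z [:c, 1:] \<circ> weigh A B) xx"
      by (simp add: shear_gens weigh_gens t pcompose_1)
    have "cst c * single B 1 ^ s = single A [:c:]"
      by (simp add: cst_def single_power mult_single assms mult.commute)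
    thus "(weigh A B \<circ> shear c s) zz = (subst_z [:c, 1:] \<circ> weigh A B) zz"
      by (simp add: shear_gens weigh_gens t pcompose_pCons ring_map[OF ring_map_weigh] flip: single_add)
  qed
  thus ?thesis by simp
qed

section \<open>The Newton polygon of an ad-nilpotent element\<close>

lemma ldeg_weigh_xx: "ldeg (weigh A B xx) = B" "lcoef (weigh A B xx) = 1"
  by (simp_all add: weigh_gens ldeg_single lcoef_single)

lemma weigh_yy:
  assumes A: "A > 0" and p: "degree p > 0"
  shows "ldeg (weigh A B (yy p)) = A * int (degree p) - B"
    and "lcoef (weigh A B (yy p)) = monom (lead_coeff p) (degree p)"
proof -
  let ?n = "degree p"
  have c: "coeff (lookup (weigh A B (yy p)) w) j = (if w = - B + A * int j then coeff p j else 0)" for w j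
    by (simp add: coeff_weigh_single)
  have l: "lookup (weigh A B (yy p)) (A * int ?n - B) = monom (lead_coeff p) ?n"
    using A by (intro poly_eqI) (auto simp: c)
  have u: "lookup (weigh A B (yy p)) w = 0" if w: "A * int ?n - B < w" for w
  proof (rule poly_eqI)
    fix j
    have "coeff p j = 0" if "w = - B + A * int j"
    proof -
      have "A * int ?n < A * int j" using that w by simp
      hence "?n < j" using A by simp
      thus ?thesis by (rule coeff_eq_0)
    qed
    thus "coeff (lookup (weigh A B (yy p)) w) j = coeff 0 j" by (simp add: c)
  qed
  have "monom (lead_coeff p) ?n \<noteq> 0" using p by auto
  thus d: "ldeg (weigh A B (yy p)) = A * int ?n - B" using l u by (intro ldeg_eqI) auto
  show "lcoef (weigh A B (yy p)) = monom (lead_coeff p) ?n" by (simp only: lcoef_def d l)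
qed

lemma weigh_0_1: "weigh 0 1 f = f"
proof (rule poly_mapping_eqI, rule poly_eqI)
  fix i j show "coeff (lookup (weigh 0 1 f) i) j = coeff (lookup f i) j"
    using coeff_weigh[of 1 0 f i j] by simp
qed

text \<open>
  The determinant condition for \<open>b = x\<close>, whose pair is \<open>(B, 0)\<close>.
\<close>

lemma nilpotent_xx_condition:
  fixes A B :: int and c :: complex
  assumes nil: "ad_nilpotent p f" and B: "B \<noteq> 0" and f: "f \<noteq> 0"
  defines "m \<equiv> int (Polynomial.order c (lcoef (weigh A B f)))"
  shows "\<exists>i::nat. int i * (m * A - ldeg (weigh A B f)) = m * B"
proof -
  obtain N where N: "(bracket f ^^ N) xx = 0" using nil surface_ring_gens(1) by (auto simp: ad_nilpotent_def)
  have "xx \<noteq> 0" by (simp flip: keys_eq_empty)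
  from nilpotent_weight_condition[OF N B f this, of A c] show ?thesis
    by (auto simp: ldeg_weigh_xx m_def algebra_simps)
qed

lemma no_roots_imp_const:
  assumes "\<And>c. poly u (c :: complex) \<noteq> 0"
  shows "degree u = 0"
  using assms fundamental_theorem_of_algebra[of u] by (auto simp: constant_degree)

text \<open>
  Weights \<open>A = 0\<close>, \<open>B = 1\<close>: for a root of order \<open>m\<close> of the leading coefficient the condition reads
  \<open>m + i k = 0\<close> with \<open>i \<ge> 0\<close> and \<open>k > 0\<close>, so \<open>m = 0\<close>.
\<close>

lemma lcoef_const:
  assumes nil: "ad_nilpotent p f" and k: "ldeg f > 0" and f: "f \<noteq> 0"
  shows "degree (lcoef f) = 0"
proof (rule no_roots_imp_const)
  fix c
  obtain i :: nat where "int i * (int (Polynomial.order c (lcoef f)) * 0 - ldeg f) = int (Polynomial.order c (lcoef f)) * 1"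
    using nilpotent_xx_condition[OF nil _ f, of 1 c 0] by (auto simp: weigh_0_1)
  moreover have "int i * ldeg f \<ge> 0" using k by simp
  ultimately have "Polynomial.order c (lcoef f) = 0" by simp
  thus "poly (lcoef f) c \<noteq> 0" using lcoef_nonzero[OF f] by (simp add: order_root)
qed

lemma ldeg_weigh_ge:
  assumes "B \<noteq> 0" "coeff (lookup f i) j \<noteq> 0"
  shows "B * i + A * int j \<le> ldeg (weigh A B f)"
proof (rule ldeg_ge)
  show "lookup (weigh A B f) (B * i + A * int j) \<noteq> 0"
    using coeff_weigh[OF assms(1), of A f i j] assms(2) by auto
qed

lemma lcoef_weigh_coeff:
  assumes "B \<noteq> 0" "coeff (lcoef (weigh A B f)) j \<noteq> 0"
  shows "\<exists>i. ldeg (weigh A B f) = B * i + A * int j \<and> coeff (lookup f i) j \<noteq> 0"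
proof -
  obtain i where i: "ldeg (weigh A B f) = B * i + A * int j"
    using coeff_weigh_support[of A B f "ldeg (weigh A B f)" j] assms(2) by (auto simp: lcoef_def)
  thus ?thesis using assms coeff_weigh[OF assms(1), of A f i j] by (auto simp: lcoef_def)
qed

lemma coeff_order_0:
  assumes "u \<noteq> (0 :: complex poly)"
  shows "coeff u (Polynomial.order 0 u) \<noteq> 0"
proof -
  obtain v where v: "u = [:- 0, 1:] ^ Polynomial.order 0 u * v" "\<not> [:- 0, 1:] dvd v"
    using order_decomp[OF assms, of 0] by blast
  have "[:- 0, 1:] ^ n = monom (1 :: complex) n" for n by (simp only: monom_altdef smult_1_left minus_zero)
  hence "u = monom 1 (Polynomial.order 0 u) * v" using v(1) by simp
  moreover have "coeff (monom 1 n * v) n = coeff v 0" for n by (simp add: coeff_monom_mult)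
  ultimately have "coeff u (Polynomial.order 0 u) = coeff v 0" by metis
  also have "\<dots> \<noteq> 0" using v(2) poly_eq_0_iff_dvd[of v 0] by (simp add: poly_0_coeff_0)
  finally show ?thesis .
qed

text \<open>
  The weights are chosen so that \<open>x\<^sup>k\<close> and \<open>y\<^sup>l\<close> have the same weight, where \<open>k\<close> and \<open>-l\<close> are the extreme
  exponents of \<open>x\<close> in \<open>f\<close>. The point is that no monomial of \<open>f\<close> is heavier than these
  two. Take the monomial \<open>x\<^sup>i z\<^sup>j\<close> of maximal weight with the least \<open>j\<close>. The determinant conditions
  for \<open>x\<close> and for \<open>y\<close>, taken at \<open>\<zeta> = 0\<close>, leave only \<open>j = 0\<close>, or \<open>i < 0\<close> and \<open>j \<le> -n i\<close> with
  \<open>n = deg p\<close>; in both cases the bounds \<open>-l \<le> i \<le> k\<close> limit the weight.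
\<close>

lemma edge_form:
  assumes p: "degree p > 0" and f: "f \<in> surface_ring p" "f \<noteq> 0" and nil: "ad_nilpotent p f"
    and k: "ldeg f = int k" "k > 0" and l: "lbot f = - int l" "l > 0"
  defines "A \<equiv> int (k + l)" and "B \<equiv> int (degree p * l)"
  defines "F \<equiv> lcoef (weigh A B f)"
  shows "ldeg (weigh A B f) = B * int k" "coeff F 0 \<noteq> 0" "degree F = degree p * l"
proof -
  let ?n = "int (degree p)"
  define w where "w = ldeg (weigh A B f)"
  have pos: "A > 0" "B > 0" using k l p by (auto simp: A_def B_def)
  \<comment> \<open>This is the weight of \<open>y = p(z)/x\<close>.\<close>
  have nAB: "?n * A - B = ?n * int k" by (simp add: A_def B_def algebra_simps)
  have wz: "weigh A B f \<noteq> 0" using weigh_nonzero[of B f A] pos f by simp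
  hence F: "F \<noteq> 0" by (simp add: F_def lcoef_nonzero)
  have supp: "- int l \<le> i \<and> i \<le> int k" if "coeff (lookup f i) j \<noteq> 0" for i j
  proof -
    from that have "lookup f i \<noteq> 0" by (metis coeff_0)
    thus ?thesis using ldeg_ge[of f i] lbot_le[of f i] k l by simp
  qed
  have dk: "degree (lookup f (int k)) = 0" "lookup f (int k) \<noteq> 0"
    using lcoef_const[OF nil _ f(2)] lcoef_nonzero[OF f(2)] k by (auto simp: lcoef_def)
  hence ck: "coeff (lookup f (int k)) 0 \<noteq> 0" by (metis leading_coeff_0_iff)
  have wge: "B * int k \<le> w"
    using ldeg_weigh_ge[OF _ ck, of B A] pos by (simp add: w_def)
  define j where "j = Polynomial.order 0 F"
  obtain i where i: "w = B * i + A * int j" "coeff (lookup f i) j \<noteq> 0"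
    using lcoef_weigh_coeff[of B A f j] coeff_order_0[OF F] pos by (auto simp: F_def j_def w_def)
  have "w \<le> B * int k"
  proof (cases "j = 0")
    case True
    thus ?thesis using i supp[OF i(2)] pos by simp
  next
    case False
    obtain a :: nat where a: "int a * (int j * A - w) = int j * B"
      using nilpotent_xx_condition[OF nil _ f(2), of B 0 A] pos by (auto simp: F_def j_def w_def)
    have jA: "int j * A - w = B * (- i)" using i by (simp add: algebra_simps)
    have "B * (int a * (- i)) = B * int j" using a unfolding jA by (simp add: algebra_simps)
    hence "int a * (- i) = int j" using pos(2) by (simp only: mult_cancel_left) simp
    hence "int a * i < 0" using False by simp
    hence i0: "i < 0" by (simp add: mult_less_0_iff)
    obtain N where N: "(bracket f ^^ N) (yy p) = 0" using nil surface_ring_gens(2) by (auto simp: ad_nilpotent_def)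
    have yz: "yy p \<noteq> 0" using p by (auto simp flip: keys_eq_empty)
    have "Polynomial.order 0 (monom (lead_coeff p) (degree p)) = degree p" using p by (intro order_0_monom) auto
    then obtain b :: nat where b: "w * ?n - int j * (A * ?n - B) + int b * (int j * A - w) = 0"
      using nilpotent_weight_condition[OF N _ f(2) yz, of B A 0] pos
      by (auto simp: weigh_yy[OF pos(1) p] F_def j_def w_def)
    have "int b * (int j * A - w) \<ge> 0" unfolding jA using pos i0 by (simp add: mult_le_0_iff)
    hence "w * ?n \<le> int j * (A * ?n - B)" using b by linarith
    hence "B * int j \<le> B * (?n * (- i))" using i(1) by (simp add: algebra_simps)
    hence jn: "int j \<le> ?n * (- i)" using pos(2) by (simp only: mult_le_cancel_left_pos)
    have "w \<le> B * i + A * (?n * (- i))" using i(1) mult_left_mono[OF jn, of A] pos by simp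
    also have "\<dots> = (- i) * (?n * A - B)" by (simp add: algebra_simps)
    also have "\<dots> \<le> int l * (?n * A - B)"
      using supp[OF i(2)] nAB by (intro mult_right_mono) auto
    also have "\<dots> = B * int k" unfolding nAB by (simp add: B_def)
    finally show ?thesis .
  qed
  hence w: "w = B * int k" using wge by simp
  thus "ldeg (weigh A B f) = B * int k" by (simp add: w_def)
  have Fc: "coeff F j = coeff (lookup f i) j" if "w = B * i + A * int j" for i j
    using coeff_weigh[of B A f i j] pos that by (simp add: F_def lcoef_def w_def)
  show "coeff F 0 \<noteq> 0" using Fc[of "int k" 0] w ck by simp
  have le: "degree F \<le> degree p * l"
  proof (rule degree_le, intro allI impI)
    fix J assume J: "degree p * l < J"
    show "coeff F J = 0"
    proof (rule ccontr)
      assume "coeff F J \<noteq> 0"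
      then obtain i where i': "w = B * i + A * int J" "coeff (lookup f i) J \<noteq> 0"
        using lcoef_weigh_coeff[of B A f J] pos by (auto simp: F_def w_def)
      have "B * (- int l) \<le> B * i" using supp[OF i'(2)] pos by (intro mult_left_mono) auto
      hence "A * int J \<le> B * int k + B * int l" using i' w by (simp add: algebra_simps)
      also have "\<dots> = A * B" by (simp add: A_def algebra_simps)
      finally have "int J \<le> B" using pos by simp
      thus False using J by (simp only: B_def of_nat_le_iff)
    qed
  qed
  define d where "d = degree (lookup f (- int l))"
  have bnz: "lookup f (- int l) \<noteq> 0" using lookup_lbot_nonzero[OF f(2)] l by simp
  \<comment> \<open>The top coefficient of the term of exponent \<open>-l\<close>, which is divisible by \<open>p\<^sup>l\<close>, lies on the edge.\<close>
  hence cd: "coeff (lookup f (- int l)) d \<noteq> 0" by (simp add: d_def)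
  have "p ^ l dvd lookup f (- int l)" using surface_ring_power_dvd[OF f(1), of "- int l"] by simp
  hence "degree (p ^ l) \<le> d" using bnz by (auto simp: d_def intro: dvd_imp_degree_le)
  moreover have "degree (p ^ l) = degree p * l" using p by (subst degree_power_eq) auto
  ultimately have dge: "degree p * l \<le> d" by simp
  have "B * (- int l) + A * int d \<le> w"
    using ldeg_weigh_ge[OF _ cd, of B A] pos by (simp add: w_def)
  hence "A * int d \<le> A * B" using w by (simp add: A_def algebra_simps)
  hence "int d \<le> B" using pos by simp
  hence d: "d = degree p * l" using dge by (simp only: B_def of_nat_le_iff)
  have "w = B * (- int l) + A * int d"
    unfolding w d using B_def by (simp add: A_def algebra_simps)
  from Fc[OF this] have "coeff F d \<noteq> 0" using cd by simp
  thus "degree F = degree p * l" using le le_degree[of F d] d by simp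
qed

text \<open>
  By the condition for \<open>x\<close>, every root of the edge form has an order \<open>m\<close> with \<open>m A > B k\<close>, hence
  \<open>2 m > B = deg F\<close> when \<open>l \<le> k\<close>. There is no room for two such roots.
\<close>

lemma edge_is_power:
  assumes p: "degree p > 0" and f: "f \<in> surface_ring p" "f \<noteq> 0" and nil: "ad_nilpotent p f"
    and k: "ldeg f = int k" "k > 0" and l: "lbot f = - int l" "l > 0" and lk: "l \<le> k"
  defines "A \<equiv> int (k + l)" and "B \<equiv> int (degree p * l)"
  defines "F \<equiv> lcoef (weigh A B f)"
  shows "\<exists>a c. a \<noteq> 0 \<and> c \<noteq> 0 \<and> F = smult a ([:- c, 1:] ^ (degree p * l))"
proof -
  note E = edge_form[OF p f nil k l, folded A_def B_def, folded F_def]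
  have pos: "A > 0" "B > 0" using k l p by (auto simp: A_def B_def)
  have F: "F \<noteq> 0" using E(2) by auto
  have big: "2 * Polynomial.order c F > degree F" if "poly F c = 0" for c
  proof -
    let ?m = "Polynomial.order c F"
    have m: "?m > 0" using that F by (simp add: order_gt_0_iff)
    obtain i :: nat where "int i * (int ?m * A - B * int k) = int ?m * B"
      using nilpotent_xx_condition[OF nil _ f(2), of B c A] pos E(1) by (auto simp: F_def)
    hence "int i * (int ?m * A - B * int k) > 0" using m pos by simp
    hence "int ?m * A - B * int k > 0" by (simp add: zero_less_mult_iff)
    moreover have "B * A \<le> B * (2 * int k)" using pos lk by (intro mult_left_mono) (auto simp: A_def)
    ultimately have "A * B < A * (2 * int ?m)" by (simp add: algebra_simps)
    hence "B < 2 * int ?m" using pos by simp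
    thus ?thesis by (simp add: B_def E(3) flip: of_nat_mult)
  qed
  have "degree F > 0" using p l E(3) by simp
  then obtain c where c: "poly F c = 0" using no_roots_imp_const[of F] by force
  have "c \<noteq> 0" using c E(2) by (auto simp: poly_0_coeff_0)
  let ?m = "Polynomial.order c F"
  obtain G where G: "F = [:- c, 1:] ^ ?m * G" "\<not> [:- c, 1:] dvd G" using order_decomp[OF F, of c] by blast
  have Gnz: "G \<noteq> 0" using F G(1) by auto
  have dF: "degree F = ?m + degree G"
    using G(1) degree_mult_eq[of "[:- c, 1:] ^ ?m" G] Gnz by (simp add: degree_linear_power)
  have "degree G = 0"
  proof (rule ccontr)
    assume "degree G \<noteq> 0"
    then obtain d where d: "poly G d = 0" using no_roots_imp_const[of G] by metis
    hence Fd: "poly F d = 0" using G(1) by (metis mult_zero_right poly_mult)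
    have "d \<noteq> c" using d G(2) by (auto simp: poly_eq_0_iff_dvd)
    hence "Polynomial.order d ([:- c, 1:] ^ ?m) = 0" by (intro order_0I) (simp add: poly_power)
    moreover have "Polynomial.order d F = Polynomial.order d ([:- c, 1:] ^ ?m) + Polynomial.order d G"
      using G(1) F order_mult by metis
    ultimately have "Polynomial.order d F \<le> degree G" using order_degree[OF Gnz, of d] by simp
    thus False using big[OF c] big[OF Fd] dF by linarith
  qed
  then obtain a where a: "G = [:a:]" by (rule degree_eq_zeroE)
  have "F = smult a ([:- c, 1:] ^ (degree p * l))"
    using G(1) dF \<open>degree G = 0\<close> E(3) by (simp add: a)
  moreover have "a \<noteq> 0" using Gnz a by auto
  ultimately show ?thesis using \<open>c \<noteq> 0\<close> by blast
qed

lemma coeff_1_linear_power: "coeff ([:- c, 1:] ^ N) 1 = of_nat N * (- c) ^ (N - 1)" for c :: complex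
proof (cases N)
  case (Suc M)
  have "coeff ([:- c, 1:] ^ N) 1 = coeff (pderiv ([:- c, 1:] ^ N)) 0" by (simp add: coeff_pderiv)
  also have "\<dots> = poly (pderiv ([:- c, 1:] ^ N)) 0" by (simp add: poly_0_coeff_0)
  also have "\<dots> = of_nat N * (- c) ^ (N - 1)"
    unfolding Suc pderiv_power_Suc by (simp add: pderiv_pCons poly_power)
  finally show ?thesis .
qed simp

text \<open>
  As a power of \<open>\<zeta> - c\<close> with \<open>c \<noteq> 0\<close>, the edge form contains \<open>\<zeta>\<close> to the first power. The monomial
  responsible for it shows that \<open>A\<close> is a multiple \<open>s B\<close>, so \<open>z\<close> and \<open>x\<^sup>s\<close> have equal weight. The shear
  moves the root \<open>c\<close> to \<open>0\<close> and thus removes \<open>x\<^sup>k\<close>. The new leading coefficient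
  is again constant, so the new leading monomial, if it is a positive power of \<open>x\<close>, is a lower one.
\<close>

lemma shear_lowers_degree:
  assumes p: "degree p > 0" and f: "f \<in> surface_ring p" "f \<noteq> 0" and nil: "ad_nilpotent p f"
    and k: "ldeg f = int k" "k > 0" and l: "lbot f = - int l" "l > 0" and lk: "l \<le> k"
  shows "\<exists>c s. s > 0 \<and> lbot f \<le> lbot (shear c s f) \<and>
    (ad_nilpotent p (shear c s f) \<longrightarrow> ldeg (shear c s f) \<le> 0 \<or> ldeg (shear c s f) < ldeg f)"
proof -
  define A B where "A = int (k + l)" and "B = int (degree p * l)"
  define F where "F = lcoef (weigh A B f)"
  define N where "N = degree p * l"
  note E = edge_form[OF p f nil k l, folded A_def B_def, folded F_def]
  have pos: "A > 0" "B > 0" using k l p by (auto simp: A_def B_def)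
  obtain a c where ac: "a \<noteq> 0" "c \<noteq> 0" "F = smult a ([:- c, 1:] ^ N)"
    using edge_is_power[OF p f nil k l lk] by (auto simp: F_def A_def B_def N_def)
  have N: "N > 0" using p l by (simp add: N_def)
  hence "coeff F 1 \<noteq> 0" using ac by (simp only: coeff_smult coeff_1_linear_power) simp
  then obtain i where i: "B * int k = B * i + A * int 1"
    using lcoef_weigh_coeff[of B A f 1] pos E(1) by (auto simp: F_def)
  define s where "s = nat (int k - i)"
  have "A = B * (int k - i)" using i by (simp add: algebra_simps)
  moreover from this pos have "int k - i > 0" by (simp add: zero_less_mult_iff)
  ultimately have s: "s > 0" "A = B * int s" by (simp_all add: s_def)
  define g where "g = shear c s f"
  have gnz: "g \<noteq> 0" using shear_shear[of c s f] f(2) ring_map(1)[OF ring_map_shear] by (auto simp: g_def)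
  have bot: "lbot f \<le> lbot g"
  proof (rule ccontr)
    assume "\<not> lbot f \<le> lbot g"
    hence "lookup g (lbot g) = 0" unfolding g_def
      by (intro lookup_shear_below[of "lbot f"] lookup_below_lbot) auto
    thus False using lookup_lbot_nonzero[OF gnz] by simp
  qed
  have wg: "lookup (weigh A B g) v = pcompose (lookup (weigh A B f) v) [:c, 1:]" for v
    by (simp add: g_def weigh_shear[OF s(2)] lookup_subst_z)
  have "ldeg g < int k" if nilg: "ad_nilpotent p g" and pg: "ldeg g > 0"
  proof -
    have dg: "degree (lookup g (ldeg g)) = 0" "lookup g (ldeg g) \<noteq> 0"
      using lcoef_const[OF nilg pg gnz] lcoef_nonzero[OF gnz] by (auto simp: lcoef_def)
    hence cg: "coeff (lookup g (ldeg g)) 0 \<noteq> 0" by (metis leading_coeff_0_iff)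
    have nz: "coeff (lookup (weigh A B g) (B * ldeg g)) 0 \<noteq> 0"
      using coeff_weigh[of B A g "ldeg g" 0] pos cg by simp
    hence "lookup (weigh A B f) (B * ldeg g) \<noteq> 0" unfolding wg by auto
    from ldeg_ge[OF this] have "ldeg g \<le> int k" using E(1) pos by simp
    moreover have "ldeg g \<noteq> int k"
    proof
      assume "ldeg g = int k"
      hence "lookup (weigh A B g) (B * ldeg g) = pcompose F [:c, 1:]"
        by (simp add: wg F_def lcoef_def E(1))
      moreover have "coeff (pcompose F [:c, 1:]) 0 = poly F c"
        by (simp add: poly_pcompose flip: poly_0_coeff_0)
      moreover have "poly F c = 0" using N by (simp add: ac poly_power)
      ultimately show False using nz by simp
    qed
    ultimately show ?thesis by simp
  qed
  thus ?thesis using s(1) bot k by (intro exI[of _ c] exI[of _ s]) (fastforce simp: g_def)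
qed

text \<open>
  Induction on the sum of the extreme exponents \<open>k\<close> and \<open>l\<close> of the image of \<open>x\<close>, after exchanging \<open>x\<close> and \<open>y\<close> if
  \<open>k < l\<close>.
\<close>

lemma straighten:
  assumes \<phi>: "surface_iso q p \<phi>" and q: "degree q > 0" and p: "degree p > 0"
  shows "\<exists>\<psi>. surface_iso q p \<psi> \<and> lbot (\<psi> xx) \<ge> 0"
  using \<phi>
proof (induction "nat (ldeg (\<phi> xx)) + nat (- lbot (\<phi> xx))" arbitrary: \<phi> rule: less_induct)
  case less
  have p0: "p \<noteq> 0" using p by auto
  have fl: "surface_iso q p (swap_xy p \<circ> \<psi>)" "ldeg ((swap_xy p \<circ> \<psi>) xx) = - lbot (\<psi> xx)"
    "lbot ((swap_xy p \<circ> \<psi>) xx) = - ldeg (\<psi> xx)" if "surface_iso q p \<psi>" for \<psi>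
  proof -
    show "surface_iso q p (swap_xy p \<circ> \<psi>)" using surface_iso_comp[OF that surface_iso_swap_xy[OF p0]] .
    have "\<psi> xx \<in> surface_ring p" "\<psi> xx \<noteq> 0"
      using surface_iso_in[OF that surface_ring_gens(1)] surface_iso_eq_0[OF that surface_ring_gens(1)] by (auto simp flip: keys_eq_empty)
    thus "ldeg ((swap_xy p \<circ> \<psi>) xx) = - lbot (\<psi> xx)" "lbot ((swap_xy p \<circ> \<psi>) xx) = - ldeg (\<psi> xx)"
      using swap_xy_degrees[OF p0] by auto
  qed
  have step: ?case if \<psi>: "surface_iso q p \<psi>"
    and same: "nat (ldeg (\<psi> xx)) + nat (- lbot (\<psi> xx)) = nat (ldeg (\<phi> xx)) + nat (- lbot (\<phi> xx))"
    and pos: "ldeg (\<psi> xx) > 0" "lbot (\<psi> xx) < 0" and lk: "- lbot (\<psi> xx) \<le> ldeg (\<psi> xx)" for \<psi>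
  proof -
    define f where "f = \<psi> xx"
    have f: "f \<in> surface_ring p" "f \<noteq> 0"
      using surface_iso_in[OF \<psi> surface_ring_gens(1)] surface_iso_eq_0[OF \<psi> surface_ring_gens(1)] by (auto simp: f_def simp flip: keys_eq_empty)
    have nil: "ad_nilpotent p f" using ad_nilpotent_image_xx[OF \<psi> q p0] by (simp add: f_def)
    obtain c s where cs: "s > 0" "lbot f \<le> lbot (shear c s f)"
      "ad_nilpotent p (shear c s f) \<longrightarrow> ldeg (shear c s f) \<le> 0 \<or> ldeg (shear c s f) < ldeg f"
    proof -
      have "ldeg f = int (nat (ldeg f))" "0 < nat (ldeg f)" "lbot f = - int (nat (- lbot f))"
        "0 < nat (- lbot f)" "nat (- lbot f) \<le> nat (ldeg f)"
        using pos lk unfolding f_def by simp_all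
      from shear_lowers_degree[OF p f nil this] that show thesis by blast
    qed
    have iso: "surface_iso q p (shear c s \<circ> \<psi>)" using surface_iso_comp[OF \<psi> surface_iso_shear[OF cs(1)]] .
    have "ad_nilpotent p (shear c s f)" using ad_nilpotent_image_xx[OF iso q p0] by (simp add: f_def)
    hence "nat (ldeg (shear c s f)) < nat (ldeg f)" using cs(3) pos by (auto simp: f_def)
    hence "nat (ldeg ((shear c s \<circ> \<psi>) xx)) + nat (- lbot ((shear c s \<circ> \<psi>) xx)) < nat (ldeg (\<phi> xx)) + nat (- lbot (\<phi> xx))"
    proof -
      have "nat (- lbot (shear c s f)) \<le> nat (- lbot f)" using cs(2) by (intro nat_mono) simp
      with \<open>nat (ldeg (shear c s f)) < nat (ldeg f)\<close> show ?thesis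
        unfolding same[symmetric] f_def o_apply by linarith
    qed
    from less.hyps[OF this iso] show ?thesis .
  qed
  consider "lbot (\<phi> xx) \<ge> 0" | "ldeg (\<phi> xx) \<le> 0" | "ldeg (\<phi> xx) > 0" "lbot (\<phi> xx) < 0" by linarith
  thus ?case
  proof cases
    case 1
    thus ?thesis using less.prems by blast
  next
    case 2
    thus ?thesis using fl[OF less.prems] by (intro exI[of _ "swap_xy p \<circ> \<phi>"]) simp
  next
    case 3
    show ?thesis
    proof (cases "- lbot (\<phi> xx) \<le> ldeg (\<phi> xx)")
      case True
      show ?thesis by (rule step[OF less.prems _ 3 True]) simp
    next
      case False
      show ?thesis by (rule step[OF fl(1)[OF less.prems]]) (use fl[OF less.prems] 3 False in auto)
    qed
  qed
qed

section \<open>Isomorphic surfaces have affinely equivalent polynomials\<close>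

text \<open>
  Give \<open>z\<close> a weight exceeding the degree of \<open>f\<close> in \<open>x\<close>. If \<open>z\<close> occurs in \<open>f\<close>, every monomial
  \<open>x\<^sup>i z\<^sup>j\<close> of the leading form has \<open>j > 0\<close>, and the determinant condition for \<open>x\<close> at \<open>\<zeta> = 0\<close> becomes
  \<open>- a i = j\<close> with \<open>a \<ge> 0\<close>, where \<open>i \<ge> 0\<close> because \<open>f\<close> has no negative exponents. This is absurd.
\<close>

lemma no_z_if_polynomial_in_x:
  assumes f: "f \<noteq> 0" "lbot f \<ge> 0" and nil: "ad_nilpotent p f"
  shows "Dz f = 0"
proof (rule ccontr)
  assume "Dz f \<noteq> 0"
  then obtain i0 where "pderiv (lookup f i0) \<noteq> 0"
    by (metis lookup_Dz lookup_zero poly_mapping_eqI)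
  define j0 where "j0 = degree (lookup f i0)"
  have j0: "j0 > 0" using \<open>pderiv (lookup f i0) \<noteq> 0\<close> by (auto simp: j0_def pderiv_eq_0_iff)
  hence c0: "coeff (lookup f i0) j0 \<noteq> 0" by (auto simp: j0_def)
  have nn: "i \<ge> 0" if "lookup f i \<noteq> 0" for i using lbot_le[OF that] f by simp
  have c0': "lookup f i0 \<noteq> 0" using c0 by auto
  define A where "A = ldeg f + 1"
  define w where "w = ldeg (weigh A 1 f)"
  define F where "F = lcoef (weigh A 1 f)"
  have A: "A > 0" using ldeg_ge[OF c0'] nn[OF c0'] by (simp add: A_def)
  have "1 * i0 + A * int j0 \<le> w" using ldeg_weigh_ge[of 1 f i0 j0 A] c0 by (simp add: w_def)
  moreover have "A * 1 \<le> A * int j0" using A j0 by (intro mult_left_mono) auto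
  ultimately have wbig: "w > ldeg f" using nn[OF c0'] by (simp add: A_def)
  have F: "F \<noteq> 0" using weigh_nonzero[of 1 f A] f by (simp add: F_def lcoef_nonzero)
  define j where "j = Polynomial.order 0 F"
  have "coeff F 0 = coeff (lookup f w) 0"
    using coeff_weigh[of 1 A f w 0] by (simp add: F_def lcoef_def w_def)
  also have "\<dots> = 0" using lookup_above_ldeg[OF wbig] by simp
  finally have "j \<noteq> 0" using coeff_order_0[OF F] by (auto simp: j_def intro: ccontr)
  obtain i where i: "w = 1 * i + A * int j" "coeff (lookup f i) j \<noteq> 0"
    using lcoef_weigh_coeff[of 1 A f j] coeff_order_0[OF F] by (auto simp: F_def j_def w_def)
  have "i \<ge> 0" using i(2) by (intro nn) auto
  obtain a :: nat where "int a * (int j * A - w) = int j * 1"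
    using nilpotent_xx_condition[OF nil _ f(1), of 1 0 A] by (auto simp: F_def j_def w_def)
  hence "int a * (- i) = int j" using i by (simp add: algebra_simps)
  moreover have "int a * i \<ge> 0" using \<open>i \<ge> 0\<close> by simp
  ultimately show False using \<open>j \<noteq> 0\<close> by simp
qed

text \<open>
  Write \<open>f, g, h\<close> for the images of \<open>x, y, z\<close>. With \<open>f\<close> a polynomial in \<open>x\<close> alone, \<open>{f,h} = c f\<close> reads
  \<open>x f' h\<^sub>z = c f\<close>. So \<open>h\<^sub>z\<close> does not depend on \<open>z\<close> and \<open>h\<close> is at most linear in \<open>z\<close>. As \<open>deg p \<ge> 2\<close>,
  the divisibility conditions leave no negative powers of \<open>x\<close> in \<open>h\<close>. Comparing degrees in \<open>x\<close>, \<open>h\<^sub>z\<close> is a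
  constant \<open>v\<close>, and \<open>f\<close> is an eigenvector of \<open>x \<partial>/\<partial>x\<close>, that is, a multiple of a power of \<open>x\<close>.
  Being irreducible like \<open>x\<close>, it is a multiple of \<open>x\<close> itself. The terms of exponent \<open>0\<close> in
  \<open>f g = q(h)\<close> give the result, since those of exponent \<open>-1\<close> in \<open>g\<close> are divisible by \<open>p\<close>.
\<close>

lemma isomorphic_imp_dvd:
  assumes \<phi>0: "surface_iso q p \<phi>0" and q: "degree q > 0" and p: "degree p > 1"
  shows "\<exists>a d. a \<noteq> 0 \<and> p dvd pcompose q [:d, a:]"
proof -
  have p0: "p \<noteq> 0" using p by auto
  obtain \<phi> where \<phi>: "surface_iso q p \<phi>" and bot: "lbot (\<phi> xx) \<ge> 0"
    using straighten[OF \<phi>0 q] p by auto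
  define f g h where "f = \<phi> xx" and "g = \<phi> (yy q)" and "h = \<phi> zz"
  have mem: "f \<in> surface_ring p" "g \<in> surface_ring p" "h \<in> surface_ring p"
    by (simp_all add: f_def g_def h_def surface_iso_in[OF \<phi>] surface_ring_gens)
  have f0: "f \<noteq> 0" using surface_iso_eq_0[OF \<phi> surface_ring_gens(1)] by (simp add: f_def flip: keys_eq_empty)
  have Dzf: "Dz f = 0"
    using no_z_if_polynomial_in_x[OF f0] bot ad_nilpotent_image_xx[OF \<phi> q p0] by (simp add: f_def)
  obtain c where c: "c \<noteq> 0" and rigid: "\<And>a b. a \<in> surface_ring q \<Longrightarrow> b \<in> surface_ring q \<Longrightarrow> bracket (\<phi> a) (\<phi> b) = cst c * \<phi> (bracket a b)"
    using bracket_rigid[OF \<phi> q p0] by blast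
  have fh: "Dx f * Dz h = cst c * f"
    using rigid[OF surface_ring_gens(1,3)] Dzf unfolding bracket_gens by (simp add: bracket_def f_def h_def)
  have fi: "degree (lookup f i) = 0" for i
    using Dzf by (metis lookup_Dz lookup_zero pderiv_eq_0_iff)
  have Dxf: "Dx f \<noteq> 0" using fh f0 c by auto
  \<comment> \<open>Differentiate the equation \<open>fh\<close> with respect to \<open>z\<close>.\<close>
  have DzV: "Dz (Dz h) = 0"
  proof -
    have "Dz (Dx f) = Dx (Dz f)" by (rule poly_mapping_eqI) (simp add: of_int_poly pderiv_smult)
    hence "Dz (Dx f) = 0" by (simp add: Dzf Dx_0)
    hence "Dx f * Dz (Dz h) = Dz (Dx f * Dz h)" by (simp add: Dz_mult)
    also have "\<dots> = 0" by (simp add: fh Dz_mult Dz_cst Dzf)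
    finally show ?thesis using Dxf by simp
  qed
  have dh: "degree (lookup h i) \<le> 1" for i
  proof -
    have "pderiv (pderiv (lookup h i)) = 0" using DzV by (metis lookup_Dz lookup_zero)
    hence "degree (pderiv (lookup h i)) = 0" by (simp add: pderiv_eq_0_iff)
    thus ?thesis by (simp add: degree_pderiv)
  qed
  have hneg: "lookup h i = 0" if "i < 0" for i
  proof (rule ccontr)
    assume nz: "lookup h i \<noteq> 0"
    have "p ^ 1 dvd p ^ nat (- i)" using that by (intro le_imp_power_dvd) simp
    hence "p dvd lookup h i" using surface_ring_power_dvd[OF mem(3), of i] by (auto intro: dvd_trans)
    hence "degree p \<le> degree (lookup h i)" using nz by (intro dvd_imp_degree_le)
    thus False using dh[of i] p by simp
  qed
  define k where "k = ldeg f"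
  have k0: "k > 0"
  proof (rule ccontr)
    assume "\<not> k > 0"
    hence "lookup (Dx f) i = 0" for i
      using lookup_above_ldeg[of f i] lookup_below_lbot[of i f] bot
      by (cases i "0 :: int" rule: linorder_cases) (auto simp: k_def f_def)
    hence "Dx f = 0" by (intro poly_mapping_eqI) simp
    thus False using Dxf by simp
  qed
  have ldx: "ldeg (Dx f) = k"
    using lcoef_nonzero[OF f0] k0 by (intro ldeg_eqI) (auto simp: k_def lcoef_def lookup_above_ldeg)
  have V0: "Dz h \<noteq> 0" using fh f0 c by auto
  have "ldeg (Dx f) + ldeg (Dz h) = ldeg (cst c * f)"
    using ldeg_mult(1)[OF Dxf V0] fh by simp
  also have "\<dots> = k" using ldeg_mult(1)[of "cst c" f] f0 c ldeg_single[of "[:c:]" 0]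
    by (simp add: k_def flip: cst_def)
  finally have ldV: "ldeg (Dz h) = 0" by (simp add: ldx)
  define u where "u = lookup h 0"
  have V: "Dz h = single 0 (pderiv u)"
  proof (rule poly_mapping_eqI)
    fix i show "lookup (Dz h) i = lookup (single 0 (pderiv u)) i"
      using hneg[of i] lookup_above_ldeg[of "Dz h" i] ldV
      by (cases i "0 :: int" rule: linorder_cases) (auto simp: lookup_single u_def)
  qed
  define v where "v = coeff u 1"
  have u: "u = [:coeff u 0, v:]"
    using dh[of 0] by (intro poly_eqI) (auto simp: u_def v_def coeff_pCons coeff_eq_0 split: nat.splits)
  have pu: "pderiv u = [:v:]" by (subst u) (simp add: pderiv_pCons)
  have v0: "v \<noteq> 0" using V V0 by (auto simp: pu)
  have eq: "smult v (of_int i * lookup f i) = smult c (lookup f i)" for i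
  proof -
    have "cst v * Dx f = cst c * f" using fh by (simp add: V pu cst_def[of v] mult.commute)
    hence "lookup (cst v * Dx f) i = lookup (cst c * f) i" by simp
    thus ?thesis by (simp add: lookup_cst_mult)
  qed
  have vk: "v * of_int i = c" if "lookup f i \<noteq> 0" for i
  proof -
    have "smult (v * of_int i - c) (lookup f i) = 0"
      using eq[of i] by (simp add: of_int_poly smult_diff_left)
    thus ?thesis using that by simp
  qed
  have single: "lookup f i = 0" if "i \<noteq> k" for i
  proof (rule ccontr)
    assume "lookup f i \<noteq> 0"
    hence "v * of_int i = v * of_int k" using vk[of i] vk[of k] lcoef_nonzero[OF f0] by (simp add: lcoef_def k_def)
    thus False using v0 that by simp
  qed
  obtain b where b: "lookup f k = [:b:]" using fi degree_eq_zeroE by metis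
  have b0: "b \<noteq> 0" using lcoef_nonzero[OF f0] b by (auto simp: lcoef_def k_def)
  have fk: "f = single k [:b:]"
    using single b by (intro poly_mapping_eqI) (auto simp: lookup_single when_def)
  have k1: "k = 1"
  proof -
    define r where "r = single (k - 1) [:b:]"
    have r: "r \<in> surface_ring p" using k0 by (simp add: r_def surface_ring_single)
    obtain e1 e2 where e: "e1 \<in> surface_ring q" "\<phi> e1 = xx" "e2 \<in> surface_ring q" "\<phi> e2 = r"
      using surface_iso_surj[OF \<phi>] surface_ring_gens(1) r by metis
    have "\<phi> (e1 * e2) = \<phi> xx" using e by (simp add: surface_iso_mult[OF \<phi>] r_def mult_single fk flip: f_def)
    hence ee: "e1 * e2 = xx" using e surface_iso_inj[OF \<phi>] by (simp add: surface_ring_mult surface_ring_gens)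
    from factor_of_xx[OF q e(1,3) ee] show ?thesis
    proof
      assume "\<exists>a. a \<noteq> 0 \<and> e1 = cst a"
      then obtain a where "e1 = cst a" by blast
      hence "xx = cst a" using e surface_iso_cst[OF \<phi>] by simp
      hence "lookup xx 1 = lookup (cst a) 1" by simp
      thus ?thesis by (simp add: lookup_cst)
    next
      assume "\<exists>a. a \<noteq> 0 \<and> e1 = cst a * xx"
      then obtain a where "e1 = cst a * xx" by blast
      hence "xx = cst a * f" using e by (simp add: surface_iso_mult[OF \<phi>] surface_ring_cst surface_ring_gens surface_iso_cst[OF \<phi>] flip: f_def)
      hence "lookup xx 1 = lookup (cst a * f) 1" by simp
      thus ?thesis using single[of 1] by (cases "k = 1") (auto simp: lookup_cst_mult)
    qed
  qed
  have "f * g = peval cst h q"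
    using surface_iso_single_0[OF \<phi>, of q] xx_times_yy[of q] surface_iso_mult[OF \<phi> surface_ring_gens(1,2)]
    by (simp add: f_def g_def h_def)
  hence "lookup (f * g) 0 = pcompose q u"
    using lookup_peval_neg(1)[OF hneg] by (simp add: u_def)
  hence "[:b:] * lookup g (- 1) = pcompose q u" by (simp add: fk k1 lookup_single_mult)
  moreover have "p dvd lookup g (- 1)" using surface_ring_power_dvd[OF mem(2), of "- 1"] by simp
  ultimately have "p dvd pcompose q u" by (metis dvd_mult)
  hence "p dvd pcompose q [:coeff u 0, v:]" by (subst u[symmetric])
  thus ?thesis using v0 by blast
qed

theorem isomorphic_imp_affine:
  assumes \<phi>: "surface_iso q p \<phi>" and q: "degree q > 0" and p: "degree p > 1"
  shows "\<exists>a d e. a \<noteq> 0 \<and> e \<noteq> 0 \<and> pcompose q [:d, a:] = smult e p"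
proof -
  obtain a d where ad: "a \<noteq> 0" "p dvd pcompose q [:d, a:]" using isomorphic_imp_dvd[OF assms] by blast
  have deg: "degree (pcompose r [:d, a:]) = degree r" if "a \<noteq> 0" for r :: "complex poly" and a d
    using that by (simp add: degree_pcompose)
  have nz: "pcompose q [:d, a:] \<noteq> 0" using deg[OF ad(1), of q d] q by auto
  have "degree p \<le> degree q" using dvd_imp_degree_le[OF ad(2) nz] deg[OF ad(1)] by simp
  hence q1: "degree q > 1" using p by simp
  obtain a' d' where ad': "a' \<noteq> 0" "q dvd pcompose p [:d', a':]"
    using isomorphic_imp_dvd[OF surface_iso_inv[OF \<phi>] _ q1] p by auto
  have "pcompose p [:d', a':] \<noteq> 0" using deg[OF ad'(1), of p d'] p by auto
  hence le: "degree q \<le> degree p" using dvd_imp_degree_le[OF ad'(2)] deg[OF ad'(1)] by simp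
  obtain r where r: "pcompose q [:d, a:] = p * r" using ad(2) by (auto simp: dvd_def)
  have "r \<noteq> 0" "p \<noteq> 0" using r nz by auto
  hence "degree (p * r) = degree p + degree r" by (simp add: degree_mult_eq)
  hence "degree r = 0" using le deg[OF ad(1), of q d] r by simp
  then obtain e where e: "r = [:e:]" by (rule degree_eq_zeroE)
  have "e \<noteq> 0" using \<open>r \<noteq> 0\<close> e by auto
  moreover have "pcompose q [:d, a:] = smult e p" using r e by simp
  ultimately show ?thesis using ad(1) by blast
qed

section \<open>The quotient ring and the Laurent model\<close>

definition residue_of :: "complex poly \<Rightarrow> poly_xyz \<Rightarrow> poly_xyz set"
  where "residue_of p F = danielewski_ideal p +>\<^bsub>Cxyz\<^esub> F"

lemma cring_Cxyz: "cring Cxyz" by (rule cring_from_type_algebra)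

lemma Cxyz_simps [simp]: "carrier Cxyz = UNIV" "monoid.mult Cxyz = (*)" "add Cxyz = (+)" "one Cxyz = 1"
  by (auto simp: ring_of_type_algebra_def fun_eq_iff)

lemma danielewski_ideal_eq: "danielewski_ideal p = {H. relator p dvd H}"
proof -
  interpret cring Cxyz by (rule cring_Cxyz)
  have "Idl\<^bsub>Cxyz\<^esub> {relator p} = PIdl\<^bsub>Cxyz\<^esub> (relator p)" by (rule cgenideal_eq_genideal[symmetric]) simp
  thus ?thesis by (auto simp: danielewski_ideal_def relator_def[symmetric] cgenideal_def dvd_def mult.commute)
qed

lemma ideal_danielewski: "ideal (danielewski_ideal p) Cxyz"
proof -
  interpret cring Cxyz by (rule cring_Cxyz)
  show ?thesis unfolding danielewski_ideal_def by (rule genideal_ideal) simp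
qed

lemma carrier_danielewski: "carrier (danielewski_ring p) = range (residue_of p)"
  by (auto simp: danielewski_ring_def FactRing_def A_RCOSETS_def' residue_of_def)

lemma danielewski_ops:
  "residue_of p F \<otimes>\<^bsub>danielewski_ring p\<^esub> residue_of p G = residue_of p (F * G)"
  "residue_of p F \<oplus>\<^bsub>danielewski_ring p\<^esub> residue_of p G = residue_of p (F + G)"
  "\<one>\<^bsub>danielewski_ring p\<^esub> = residue_of p 1"
  "danielewski_scalar p \<alpha> = residue_of p (in_z [:\<alpha>:])"
proof -
  interpret ideal "danielewski_ideal p" Cxyz by (rule ideal_danielewski)
  show "residue_of p F \<otimes>\<^bsub>danielewski_ring p\<^esub> residue_of p G = residue_of p (F * G)"
    using rcoset_mult_add[of F G] by (simp add: danielewski_ring_def FactRing_def residue_of_def)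
  show "residue_of p F \<oplus>\<^bsub>danielewski_ring p\<^esub> residue_of p G = residue_of p (F + G)"
    using a_rcos_sum[of F G] by (simp add: danielewski_ring_def FactRing_def residue_of_def)
  show "\<one>\<^bsub>danielewski_ring p\<^esub> = residue_of p 1"
    by (simp add: danielewski_ring_def FactRing_def residue_of_def)
  show "danielewski_scalar p \<alpha> = residue_of p (in_z [:\<alpha>:])" by (simp add: danielewski_scalar_def residue_of_def)
qed

lemma residue_of_eq_iff: "residue_of p F = residue_of p G \<longleftrightarrow> relator p dvd F - G"
proof -
  interpret ideal "danielewski_ideal p" Cxyz by (rule ideal_danielewski)
  have inv: "\<ominus>\<^bsub>Cxyz\<^esub> G = - G" by (rule minus_equality) (simp_all add: ring_of_type_algebra_def)
  show ?thesis
    using quotient_eq_iff_same_a_r_cos[of "danielewski_ideal p" F G] ideal_danielewski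
    by (simp add: residue_of_def a_minus_def inv danielewski_ideal_eq)
qed

lemma scalar_in_carrier: "danielewski_scalar p \<alpha> \<in> carrier (danielewski_ring p)"
  by (simp add: danielewski_ops carrier_danielewski)

lemma scalar_mult_one:
  "danielewski_scalar p \<alpha> \<otimes>\<^bsub>danielewski_ring p\<^esub> \<one>\<^bsub>danielewski_ring p\<^esub> = danielewski_scalar p \<alpha>"
  by (simp add: danielewski_ops)

lemma image_of_scalar:
  assumes "\<Phi> \<in> ring_hom (danielewski_ring p) (danielewski_ring q)"
    and "\<And>f. f \<in> carrier (danielewski_ring p) \<Longrightarrow>
      \<Phi> (danielewski_scalar p \<alpha> \<otimes>\<^bsub>danielewski_ring p\<^esub> f) = danielewski_scalar q \<beta> \<otimes>\<^bsub>danielewski_ring q\<^esub> \<Phi> f"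
  shows "\<Phi> (danielewski_scalar p \<alpha>) = danielewski_scalar q \<beta>"
proof -
  have "\<one>\<^bsub>danielewski_ring p\<^esub> \<in> carrier (danielewski_ring p)"
    by (simp add: danielewski_ops carrier_danielewski)
  from assms(2)[OF this] show ?thesis by (simp only: ring_hom_one[OF assms(1)] scalar_mult_one)
qed

text \<open>
  For \<open>p \<noteq> 0\<close> these are mutually inverse isomorphisms between \<open>surface_ring p\<close> and the quotient ring.
\<close>

definition to_quotient :: "complex poly \<Rightarrow> laurent \<Rightarrow> poly_xyz set"
  where "to_quotient p f = residue_of p (normal_form p f)"
definition of_quotient :: "complex poly \<Rightarrow> poly_xyz set \<Rightarrow> laurent"
  where "of_quotient p C = laurent_of p (SOME F. residue_of p F = C)"

context
  fixes p :: "complex poly" assumes p: "p \<noteq> 0"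
begin

lemma to_quotient_laurent_of: "to_quotient p (laurent_of p F) = residue_of p F"
  unfolding to_quotient_def residue_of_eq_iff using relator_dvd_diff_normal_form[OF p, of F]
    dvd_minus_iff[of "relator p" "F - normal_form p (laurent_of p F)"] by simp

lemma of_quotient_residue_of: "of_quotient p (residue_of p F) = laurent_of p F"
proof -
  have "residue_of p (SOME G. residue_of p G = residue_of p F) = residue_of p F" by (rule someI) (rule refl)
  thus ?thesis by (simp add: of_quotient_def residue_of_eq_iff laurent_of_eq_iff[OF p])
qed

lemma of_quotient_to_quotient: "f \<in> surface_ring p \<Longrightarrow> of_quotient p (to_quotient p f) = f"
  by (simp add: to_quotient_def of_quotient_residue_of laurent_of_normal_form)

lemma to_quotient_of_quotient: "C \<in> carrier (danielewski_ring p) \<Longrightarrow> to_quotient p (of_quotient p C) = C"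
  by (auto simp: carrier_danielewski of_quotient_residue_of to_quotient_laurent_of)

lemma of_quotient_in_surface_ring: "C \<in> carrier (danielewski_ring p) \<Longrightarrow> of_quotient p C \<in> surface_ring p"
  by (auto simp: carrier_danielewski of_quotient_residue_of laurent_of_in_surface_ring)

lemma to_quotient_in_carrier: "to_quotient p f \<in> carrier (danielewski_ring p)"
  by (auto simp: carrier_danielewski to_quotient_def)

lemma to_quotient_hom:
  assumes "f \<in> surface_ring p" "g \<in> surface_ring p"
  shows "to_quotient p (f + g) = to_quotient p f \<oplus>\<^bsub>danielewski_ring p\<^esub> to_quotient p g"
    and "to_quotient p (f * g) = to_quotient p f \<otimes>\<^bsub>danielewski_ring p\<^esub> to_quotient p g"
proof -
  obtain F G where FG: "f = laurent_of p F" "g = laurent_of p G" using assms range_laurent_of by (metis rangeE)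
  show "to_quotient p (f + g) = to_quotient p f \<oplus>\<^bsub>danielewski_ring p\<^esub> to_quotient p g"
    "to_quotient p (f * g) = to_quotient p f \<otimes>\<^bsub>danielewski_ring p\<^esub> to_quotient p g"
    unfolding FG ring_map(3,4)[OF ring_map_laurent_of, symmetric] to_quotient_laurent_of danielewski_ops by (rule refl)+
qed

lemma of_quotient_hom:
  assumes "C \<in> carrier (danielewski_ring p)" "D \<in> carrier (danielewski_ring p)"
  shows "of_quotient p (C \<oplus>\<^bsub>danielewski_ring p\<^esub> D) = of_quotient p C + of_quotient p D"
    and "of_quotient p (C \<otimes>\<^bsub>danielewski_ring p\<^esub> D) = of_quotient p C * of_quotient p D"
  using assms
  by (auto simp: carrier_danielewski danielewski_ops of_quotient_residue_of ring_map[OF ring_map_laurent_of])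

lemma to_quotient_cst: "to_quotient p (cst \<alpha>) = danielewski_scalar p \<alpha>"
  using to_quotient_laurent_of[of "in_z [:\<alpha>:]"] by (simp add: laurent_of_vars danielewski_ops cst_def)

lemma to_quotient_one: "to_quotient p 1 = \<one>\<^bsub>danielewski_ring p\<^esub>"
  using to_quotient_laurent_of[of 1] by (simp add: ring_map[OF ring_map_laurent_of] danielewski_ops)

lemma of_quotient_scalar: "of_quotient p (danielewski_scalar p \<alpha>) = cst \<alpha>"
  using of_quotient_to_quotient[OF surface_ring_cst] by (simp add: to_quotient_cst)

lemma of_quotient_one: "of_quotient p \<one>\<^bsub>danielewski_ring p\<^esub> = 1"
  using of_quotient_scalar[of 1] of_quotient_residue_of[of 1] by (simp add: danielewski_ops ring_map[OF ring_map_laurent_of])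

lemma bij_to_quotient: "bij_betw (to_quotient p) (surface_ring p) (carrier (danielewski_ring p))"
  by (rule bij_betwI[where g = "of_quotient p"])
     (auto simp: to_quotient_in_carrier of_quotient_in_surface_ring of_quotient_to_quotient to_quotient_of_quotient)

lemma bij_of_quotient: "bij_betw (of_quotient p) (carrier (danielewski_ring p)) (surface_ring p)"
  by (rule bij_betwI[where g = "to_quotient p"])
     (auto simp: to_quotient_in_carrier of_quotient_in_surface_ring of_quotient_to_quotient to_quotient_of_quotient)

end

lemma danielewski_isomorphic_iff:
  assumes p: "p \<noteq> 0" and q: "q \<noteq> 0"
  shows "danielewski_isomorphic p q \<longleftrightarrow> (\<exists>\<phi>. surface_iso p q \<phi>)"
proof
  assume "danielewski_isomorphic p q"
  then obtain \<Phi> where \<Phi>: "\<Phi> \<in> ring_hom (danielewski_ring p) (danielewski_ring q)"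
    "bij_betw \<Phi> (carrier (danielewski_ring p)) (carrier (danielewski_ring q))"
    and scal: "\<And>\<alpha> f. f \<in> carrier (danielewski_ring p) \<Longrightarrow>
      \<Phi> (danielewski_scalar p \<alpha> \<otimes>\<^bsub>danielewski_ring p\<^esub> f) = danielewski_scalar q \<alpha> \<otimes>\<^bsub>danielewski_ring q\<^esub> \<Phi> f"
    unfolding danielewski_isomorphic_def complex_algebra_isomorphic_def ring_iso_def by blast
  note hom = ring_hom_add[OF \<Phi>(1)] ring_hom_mult[OF \<Phi>(1)] ring_hom_one[OF \<Phi>(1)] ring_hom_closed[OF \<Phi>(1)]
  define \<phi> where "\<phi> = of_quotient q \<circ> (\<Phi> \<circ> to_quotient p)"
  have "bij_betw \<phi> (surface_ring p) (surface_ring q)"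
    unfolding \<phi>_def by (intro bij_betw_trans[OF bij_betw_trans[OF bij_to_quotient[OF p] \<Phi>(2)] bij_of_quotient[OF q]])
  moreover have "\<phi> (f + g) = \<phi> f + \<phi> g \<and> \<phi> (f * g) = \<phi> f * \<phi> g" if "f \<in> surface_ring p" "g \<in> surface_ring p" for f g
    using that by (simp add: \<phi>_def to_quotient_hom[OF p] hom to_quotient_in_carrier[OF p] of_quotient_hom[OF q])
  moreover have "\<phi> (cst \<alpha>) = cst \<alpha>" for \<alpha>
    by (simp add: \<phi>_def to_quotient_cst[OF p] image_of_scalar[OF \<Phi>(1) scal] of_quotient_scalar[OF q])
  ultimately show "\<exists>\<phi>. surface_iso p q \<phi>" unfolding surface_iso_def by blast
next
  assume "\<exists>\<phi>. surface_iso p q \<phi>"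
  then obtain \<phi> where \<phi>: "surface_iso p q \<phi>" by blast
  have bij: "bij_betw \<phi> (surface_ring p) (surface_ring q)" using \<phi> by (simp add: surface_iso_def)
  define \<Phi> where "\<Phi> = to_quotient q \<circ> (\<phi> \<circ> of_quotient p)"
  have "bij_betw \<Phi> (carrier (danielewski_ring p)) (carrier (danielewski_ring q))"
    unfolding \<Phi>_def by (intro bij_betw_trans[OF bij_betw_trans[OF bij_of_quotient[OF p] bij] bij_to_quotient[OF q]])
  moreover have mult: "\<Phi> (f \<otimes>\<^bsub>danielewski_ring p\<^esub> g) = \<Phi> f \<otimes>\<^bsub>danielewski_ring q\<^esub> \<Phi> g"
    if "f \<in> carrier (danielewski_ring p)" "g \<in> carrier (danielewski_ring p)" for f g
    using that by (simp add: \<Phi>_def of_quotient_hom[OF p] of_quotient_in_surface_ring[OF p] surface_iso_mult[OF \<phi>] surface_iso_in[OF \<phi>] to_quotient_hom[OF q])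
  moreover have "\<Phi> \<in> ring_hom (danielewski_ring p) (danielewski_ring q)"
  proof (rule ring_hom_memI)
    show "\<Phi> \<one>\<^bsub>danielewski_ring p\<^esub> = \<one>\<^bsub>danielewski_ring q\<^esub>"
      using surface_iso_cst[OF \<phi>, of 1] by (simp add: \<Phi>_def of_quotient_one[OF p] to_quotient_one[OF q])
  qed (simp_all add: mult \<Phi>_def to_quotient_in_carrier[OF q] of_quotient_hom[OF p] of_quotient_in_surface_ring[OF p]
      surface_iso_add[OF \<phi>] surface_iso_in[OF \<phi>] to_quotient_hom[OF q] surface_iso_mult[OF \<phi>])
  moreover have "\<Phi> (danielewski_scalar p \<alpha>) = danielewski_scalar q \<alpha>" for \<alpha>
    by (simp add: \<Phi>_def of_quotient_scalar[OF p] surface_iso_cst[OF \<phi>] to_quotient_cst[OF q])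
  ultimately show "danielewski_isomorphic p q"
    unfolding danielewski_isomorphic_def complex_algebra_isomorphic_def ring_iso_def
    by (intro bexI[of _ \<Phi>]) (simp_all add: scalar_in_carrier)
qed

definition surface_real_structure :: "complex poly \<Rightarrow> (laurent \<Rightarrow> laurent) \<Rightarrow> bool"
  where "surface_real_structure p r \<longleftrightarrow> (\<forall>f\<in>surface_ring p. r f \<in> surface_ring p \<and> r (r f) = f) \<and>
    (\<forall>f\<in>surface_ring p. \<forall>g\<in>surface_ring p. r (f + g) = r f + r g \<and> r (f * g) = r f * r g) \<and>
    (\<forall>\<alpha>. r (cst \<alpha>) = cst (cnj \<alpha>))"

lemma danielewski_admits_real_structure_iff:
  assumes p: "p \<noteq> 0"
  shows "danielewski_admits_real_structure p \<longleftrightarrow> (\<exists>r. surface_real_structure p r)"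
proof
  let ?A = "danielewski_ring p" and ?s = "danielewski_scalar p"
  assume "danielewski_admits_real_structure p"
  then obtain \<rho> where R: "real_structure_on ?A ?s \<rho>"
    unfolding danielewski_admits_real_structure_def by blast
  have \<rho>: "\<rho> \<in> ring_hom ?A ?A" using R by (simp only: real_structure_on_def)
  have inv: "\<rho> (\<rho> f) = f" if "f \<in> carrier ?A" for f
    using R that by (simp only: real_structure_on_def)
  have scal: "\<rho> (?s \<alpha> \<otimes>\<^bsub>?A\<^esub> f) = ?s (cnj \<alpha>) \<otimes>\<^bsub>?A\<^esub> \<rho> f" if "f \<in> carrier ?A" for \<alpha> f
    using R that by (simp only: real_structure_on_def)
  note hom = ring_hom_add[OF \<rho>] ring_hom_mult[OF \<rho>] ring_hom_one[OF \<rho>] ring_hom_closed[OF \<rho>]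
  define r where "r = of_quotient p \<circ> (\<rho> \<circ> to_quotient p)"
  have "r f \<in> surface_ring p \<and> r (r f) = f" if "f \<in> surface_ring p" for f
    using that by (simp add: r_def hom to_quotient_in_carrier[OF p] of_quotient_in_surface_ring[OF p] to_quotient_of_quotient[OF p] inv of_quotient_to_quotient[OF p])
  moreover have "r (f + g) = r f + r g \<and> r (f * g) = r f * r g" if "f \<in> surface_ring p" "g \<in> surface_ring p" for f g
    using that by (simp add: r_def to_quotient_hom[OF p] hom to_quotient_in_carrier[OF p] of_quotient_hom[OF p])
  moreover have "r (cst \<alpha>) = cst (cnj \<alpha>)" for \<alpha>
    by (simp add: r_def to_quotient_cst[OF p] image_of_scalar[OF \<rho> scal] of_quotient_scalar[OF p])
  ultimately show "\<exists>r. surface_real_structure p r" unfolding surface_real_structure_def by blast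
next
  let ?A = "danielewski_ring p" and ?s = "danielewski_scalar p"
  assume "\<exists>r. surface_real_structure p r"
  then obtain r where r: "\<And>f. f \<in> surface_ring p \<Longrightarrow> r f \<in> surface_ring p" "\<And>f. f \<in> surface_ring p \<Longrightarrow> r (r f) = f"
    "\<And>f g. f \<in> surface_ring p \<Longrightarrow> g \<in> surface_ring p \<Longrightarrow> r (f + g) = r f + r g"
    "\<And>f g. f \<in> surface_ring p \<Longrightarrow> g \<in> surface_ring p \<Longrightarrow> r (f * g) = r f * r g"
    "\<And>\<alpha>. r (cst \<alpha>) = cst (cnj \<alpha>)"
    unfolding surface_real_structure_def by blast
  define \<rho> where "\<rho> = to_quotient p \<circ> (r \<circ> of_quotient p)"
  have mult: "\<rho> (f \<otimes>\<^bsub>?A\<^esub> g) = \<rho> f \<otimes>\<^bsub>?A\<^esub> \<rho> g" if "f \<in> carrier ?A" "g \<in> carrier ?A" for f g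
    using that by (simp add: \<rho>_def of_quotient_hom[OF p] of_quotient_in_surface_ring[OF p] r to_quotient_hom[OF p])
  moreover have "\<rho> \<in> ring_hom ?A ?A"
  proof (rule ring_hom_memI)
    show "\<rho> \<one>\<^bsub>?A\<^esub> = \<one>\<^bsub>?A\<^esub>"
      using r(5)[of 1] by (simp add: \<rho>_def of_quotient_one[OF p] to_quotient_one[OF p])
  qed (simp_all add: mult \<rho>_def to_quotient_in_carrier[OF p] of_quotient_hom[OF p] of_quotient_in_surface_ring[OF p] r to_quotient_hom[OF p])
  moreover have "\<rho> (\<rho> f) = f" if "f \<in> carrier ?A" for f
    using that by (simp add: \<rho>_def of_quotient_to_quotient[OF p] of_quotient_in_surface_ring[OF p] r to_quotient_of_quotient[OF p])
  moreover have "\<rho> (?s \<alpha>) = ?s (cnj \<alpha>)" for \<alpha>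
    by (simp add: \<rho>_def of_quotient_scalar[OF p] r to_quotient_cst[OF p])
  ultimately show "danielewski_admits_real_structure p"
    unfolding danielewski_admits_real_structure_def real_structure_on_def
    by (intro exI[of _ \<rho>]) (simp add: scalar_in_carrier)
qed

text \<open>
  Let \<open>q = c\<close> be constant. The map to Laurent polynomials has a larger kernel when \<open>c = 0\<close>, so the argument is
  carried out in the quotient ring.
  If \<open>c = 0\<close>, then \<open>x y = 0\<close> there, whereas the coordinate ring of \<open>D\<^sub>p\<close> is a domain.
  If \<open>c \<noteq> 0\<close>, then \<open>x\<close> is a unit but not a constant, whereas the units for \<open>D\<^sub>p\<close> are constants.
\<close>

lemma isomorphic_imp_nonconstant:
  assumes iso: "danielewski_isomorphic p q" and p: "degree p > 0"
  shows "degree q > 0"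
proof (rule ccontr)
  assume "\<not> degree q > 0"
  then obtain c where c: "q = [:c:]" by (auto elim: degree_eq_zeroE)
  have p0: "p \<noteq> 0" using p by auto
  let ?A = "danielewski_ring p" and ?B = "danielewski_ring q"
  from iso obtain \<Phi> where \<Phi>: "\<Phi> \<in> ring_hom ?A ?B" "bij_betw \<Phi> (carrier ?A) (carrier ?B)"
    and scal: "\<And>\<alpha> f. f \<in> carrier ?A \<Longrightarrow>
      \<Phi> (danielewski_scalar p \<alpha> \<otimes>\<^bsub>?A\<^esub> f) = danielewski_scalar q \<alpha> \<otimes>\<^bsub>?B\<^esub> \<Phi> f"
    unfolding danielewski_isomorphic_def complex_algebra_isomorphic_def ring_iso_def by blast
  define \<phi> where "\<phi> = \<Phi> \<circ> to_quotient p"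
  have inj: "f = g" if "f \<in> surface_ring p" "g \<in> surface_ring p" "\<phi> f = \<phi> g" for f g
    using bij_betw_trans[OF bij_to_quotient[OF p0] \<Phi>(2)] that by (auto simp: \<phi>_def bij_betw_def inj_on_def)
  have surj: "\<exists>f\<in>surface_ring p. \<phi> f = residue_of q F" for F
  proof -
    have "residue_of q F \<in> \<phi> ` surface_ring p"
      using bij_betw_trans[OF bij_to_quotient[OF p0] \<Phi>(2)] carrier_danielewski[of q]
      by (simp add: \<phi>_def bij_betw_def)
    thus ?thesis by force
  qed
  have mult: "\<phi> (f * g) = \<phi> f \<otimes>\<^bsub>?B\<^esub> \<phi> g" if "f \<in> surface_ring p" "g \<in> surface_ring p" for f g
    using that by (simp add: \<phi>_def to_quotient_hom[OF p0] ring_hom_mult[OF \<Phi>(1)] to_quotient_in_carrier[OF p0])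
  have cst: "\<phi> (cst \<alpha>) = residue_of q (in_z [:\<alpha>:])" for \<alpha>
    by (simp only: \<phi>_def o_apply to_quotient_cst[OF p0] image_of_scalar[OF \<Phi>(1) scal])
       (simp only: danielewski_ops(4))
  obtain f where f: "f \<in> surface_ring p" "\<phi> f = residue_of q var_x" using surj by blast
  obtain g where g: "g \<in> surface_ring p" "\<phi> g = residue_of q var_y" using surj by blast
  have "\<phi> (f * g) = residue_of q (var_x * var_y)" by (simp add: mult f g danielewski_ops)
  also have "\<dots> = \<phi> (cst c)" by (simp add: cst residue_of_eq_iff c relator_def)
  finally have fg: "f * g = cst c" using f g by (intro inj) (auto simp: surface_ring_mult surface_ring_cst)
  have kill: "h (F - G) = 0" if "ring_map h" "h (relator q) = 0" "residue_of q F = residue_of q G" for h :: "poly_xyz \<Rightarrow> laurent" and F G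
  proof -
    from that(3) obtain H where "F - G = relator q * H" by (auto simp: residue_of_eq_iff dvd_def)
    hence "h (F - G) = h (relator q) * h H" by (simp only: ring_map(4)[OF that(1)])
    thus ?thesis by (simp only: that(2) mult_zero_left)
  qed
  \<comment> \<open>The image of the variable \<open>x\<close> in the Laurent polynomials is not constant, even for \<open>q = 0\<close>.\<close>
  have xconst: "f \<noteq> cst \<alpha>" for \<alpha>
  proof
    assume "f = cst \<alpha>"
    hence "residue_of q var_x = residue_of q (in_z [:\<alpha>:])" using f(2) cst[of \<alpha>] by simp
    hence "laurent_of q (var_x - in_z [:\<alpha>:]) = 0" by (rule kill[OF ring_map_laurent_of laurent_of_relator])
    hence "xx = cst \<alpha>" by (simp add: ring_map[OF ring_map_laurent_of] laurent_of_vars cst_def)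
    hence "lookup xx 1 = lookup (cst \<alpha>) 1" by simp
    thus False by (simp add: lookup_cst)
  qed
  show False
  proof (cases "c = 0")
    case True
    hence "f = 0 \<or> g = 0" using fg by simp
    hence "g = cst 0" using xconst[of 0] by simp
    hence "residue_of q var_y = residue_of q (in_z [:0:])" using g(2) cst[of 0] by simp
    \<comment> \<open>For \<open>q = 0\<close>, sending \<open>x\<close> to \<open>0\<close> and \<open>y\<close> to \<open>x\<close> respects the relation.\<close>
    moreover have "eval_xyz 0 xx zz (relator q) = 0"
      by (simp add: relator_def ring_map[OF ring_map_eval_xyz] eval_xyz_vars c True peval_0)
    ultimately have "eval_xyz 0 xx zz (var_y - in_z [:0:]) = 0" by (intro kill[OF ring_map_eval_xyz])
    hence "xx = 0" by (simp add: ring_map[OF ring_map_eval_xyz] eval_xyz_vars peval_0)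
    thus False by (simp flip: keys_eq_empty)
  next
    case False
    have u: "[:c:] \<noteq> 0" using False by simp
    obtain i a j b where fi: "f = single i a" and gj: "g = single j b"
      using factor_of_monomial[of f g 0 "[:c:]"] factor_of_monomial[of g f 0 "[:c:]"] fg False
      by (auto simp: mult.commute cst_def)
    have "single (i + j) (a * b) = single 0 [:c:]" using fg by (simp add: fi gj mult_single cst_def)
    hence ij: "i + j = 0" and ab: "a * b = [:c:]"
      using u by (metis lookup_single_eq lookup_single_not_eq)+
    have "is_unit [:c:]" using False by (simp add: is_unit_const_poly_iff dvd_field_iff)
    hence units: "is_unit a" "is_unit b" using ab by (metis dvd_triv_left dvd_triv_right dvd_trans)+
    have "i \<ge> 0" using f(1) units(1) unfolding fi by (rule surface_ring_unit_monomial[OF p])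
    moreover have "j \<ge> 0" using g(1) units(2) unfolding gj by (rule surface_ring_unit_monomial[OF p])
    ultimately have "i = 0" using ij by linarith
    moreover obtain \<alpha> where "a = [:\<alpha>:]" using units(1) by (auto simp: is_unit_poly_iff)
    ultimately show False using xconst[of \<alpha>] fi by (simp add: cst_def)
  qed
qed

section \<open>Conjugation and affine substitutions\<close>

lemma real_polysI:
  assumes "\<And>k. cnj (coeff u k) = coeff u k"
  shows "u \<in> real_polys"
proof -
  have "u = map_poly complex_of_real (map_poly Re u)"
  proof (rule poly_eqI)
    fix k
    have "coeff u k \<in> \<real>" using assms[of k] by (simp add: Reals_cnj_iff)
    thus "coeff u k = coeff (map_poly complex_of_real (map_poly Re u)) k"
      by (simp add: coeff_map_poly)
  qed
  thus ?thesis unfolding real_polys_def by (metis rangeI)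
qed

lemma real_polys_cnj: "u \<in> real_polys \<Longrightarrow> map_poly cnj u = u"
  by (auto simp: real_polys_def map_poly_map_poly o_def)

lemma map_poly_cnj_mult: "map_poly cnj (u * v) = map_poly cnj u * map_poly cnj v"
  by (rule poly_eqI) (simp add: coeff_map_poly coeff_mult cnj_sum)
lemma map_poly_cnj_add: "map_poly cnj (u + v) = map_poly cnj u + map_poly cnj v"
  by (rule poly_eqI) (simp add: coeff_map_poly)
lemma map_poly_cnj_power: "map_poly cnj (u ^ n) = map_poly cnj u ^ n"
  by (induction n) (simp_all add: map_poly_cnj_mult)
lemma map_poly_cnj_cnj: "map_poly cnj (map_poly cnj u) = u"
  by (rule poly_eqI) (simp add: coeff_map_poly)
lemma map_poly_cnj_pderiv: "map_poly cnj (pderiv u) = pderiv (map_poly cnj u)"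
  by (rule poly_eqI) (simp add: coeff_map_poly coeff_pderiv)
lemma map_poly_cnj_dvd: "u dvd v \<Longrightarrow> map_poly cnj u dvd map_poly cnj v"
  by (auto simp: dvd_def map_poly_cnj_mult)
lemma map_poly_cnj_pcompose: "map_poly cnj (pcompose u v) = pcompose (map_poly cnj u) (map_poly cnj v)"
  by (induction u) (simp_all add: pcompose_pCons map_poly_pCons map_poly_cnj_add map_poly_cnj_mult)
lemma degree_map_poly_cnj: "degree (map_poly cnj u) = degree u"
  by (cases "u = 0") (auto intro: map_poly_degree_eq)

definition conjugate :: "laurent \<Rightarrow> laurent"
  where "conjugate = lmap (\<lambda>u. single 0 (map_poly cnj u)) 1"

lemma ring_map_conjugate_coeff: "ring_map (\<lambda>u. single 0 (map_poly cnj u) :: laurent)"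
  by (rule ring_mapI) (simp_all add: map_poly_cnj_add map_poly_cnj_mult single_add mult_single)

lemma ring_map_conjugate: "ring_map conjugate"
  unfolding conjugate_def by (intro ring_map_lmap ring_map_conjugate_coeff)

lemma conjugate_single: "conjugate (single i u) = single i (map_poly cnj u)"
  by (simp add: conjugate_def lmap_single ring_map_conjugate_coeff mult_single)

lemma lookup_conjugate: "lookup (conjugate f) i = map_poly cnj (lookup f i)"
proof (induction f rule: laurent_induct)
  case (single j u)
  show ?case by (simp add: conjugate_single lookup_single when_def)
qed (simp add: ring_map[OF ring_map_conjugate] lookup_add map_poly_cnj_add)

lemma conjugate_cst: "conjugate (cst \<alpha>) = cst (cnj \<alpha>)"
  by (simp add: cst_def conjugate_single map_poly_pCons)

lemma conjugate_conjugate: "conjugate (conjugate f) = f"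
  by (rule poly_mapping_eqI) (simp add: lookup_conjugate map_poly_cnj_cnj)

lemma conjugate_in_surface_ring: "f \<in> surface_ring p \<Longrightarrow> conjugate f \<in> surface_ring (map_poly cnj p)"
  using map_poly_cnj_dvd by (fastforce simp: surface_ring_def lookup_conjugate simp flip: map_poly_cnj_power)

lemma surface_real_structure_conjugate:
  assumes "q \<in> real_polys"
  shows "surface_real_structure q conjugate"
  using conjugate_in_surface_ring[of _ q] real_polys_cnj[OF assms]
  by (simp add: surface_real_structure_def conjugate_conjugate ring_map[OF ring_map_conjugate] conjugate_cst)

lemma surface_real_structure_transfer:
  assumes \<phi>: "surface_iso p q \<phi>" and r: "surface_real_structure q r"
  shows "surface_real_structure p (inv_into (surface_ring p) \<phi> \<circ> (r \<circ> \<phi>))"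
proof -
  let ?\<psi> = "inv_into (surface_ring p) \<phi>"
  note \<psi> = surface_iso_inv[OF \<phi>]
  have bij: "bij_betw \<phi> (surface_ring p) (surface_ring q)" using \<phi> by (simp add: surface_iso_def)
  have inv: "\<phi> (?\<psi> h) = h" if "h \<in> surface_ring q" for h using bij_betw_inv_into_right[OF bij that] .
  have inv': "?\<psi> (\<phi> f) = f" if "f \<in> surface_ring p" for f using bij_betw_inv_into_left[OF bij that] .
  have r: "\<And>f. f \<in> surface_ring q \<Longrightarrow> r f \<in> surface_ring q" "\<And>f. f \<in> surface_ring q \<Longrightarrow> r (r f) = f"
    "\<And>f g. f \<in> surface_ring q \<Longrightarrow> g \<in> surface_ring q \<Longrightarrow> r (f + g) = r f + r g"
    "\<And>f g. f \<in> surface_ring q \<Longrightarrow> g \<in> surface_ring q \<Longrightarrow> r (f * g) = r f * r g"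
    "\<And>\<alpha>. r (cst \<alpha>) = cst (cnj \<alpha>)"
    using r unfolding surface_real_structure_def by blast+
  show ?thesis
    unfolding surface_real_structure_def o_apply
    by (intro conjI ballI allI)
       (simp_all add: surface_iso_in[OF \<phi>] surface_iso_in[OF \<psi>] inv inv' r surface_iso_add[OF \<phi>] surface_iso_add[OF \<psi>]
          surface_iso_mult[OF \<phi>] surface_iso_mult[OF \<psi>] surface_iso_cst[OF \<phi>] surface_iso_cst[OF \<psi>])
qed

text \<open>
  The composition of two conjugate-linear maps is linear.
\<close>

lemma surface_iso_of_real_structure:
  assumes r: "surface_real_structure p r"
  shows "surface_iso (map_poly cnj p) p (r \<circ> conjugate)"
proof -
  have c: "conjugate f \<in> surface_ring p" if "f \<in> surface_ring (map_poly cnj p)" for f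
    using conjugate_in_surface_ring[OF that] by (simp add: map_poly_cnj_cnj)
  have r: "\<And>f. f \<in> surface_ring p \<Longrightarrow> r f \<in> surface_ring p" "\<And>f. f \<in> surface_ring p \<Longrightarrow> r (r f) = f"
    "\<And>f g. f \<in> surface_ring p \<Longrightarrow> g \<in> surface_ring p \<Longrightarrow> r (f + g) = r f + r g"
    "\<And>f g. f \<in> surface_ring p \<Longrightarrow> g \<in> surface_ring p \<Longrightarrow> r (f * g) = r f * r g"
    "\<And>\<alpha>. r (cst \<alpha>) = cst (cnj \<alpha>)"
    using r unfolding surface_real_structure_def by blast+
  have "bij_betw (r \<circ> conjugate) (surface_ring (map_poly cnj p)) (surface_ring p)"
    by (rule bij_betwI[where g = "conjugate \<circ> r"]) (auto simp: c r conjugate_conjugate conjugate_in_surface_ring)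
  thus ?thesis
    by (simp add: surface_iso_def ring_map[OF ring_map_conjugate] c r conjugate_cst)
qed

lemma pcompose_power: "pcompose (u ^ n) v = pcompose u v ^ n" for u v :: "complex poly"
  by (induction n) (simp_all add: pcompose_1 pcompose_mult)

lemma subst_z_in_surface_ring:
  assumes f: "f \<in> surface_ring p" and e: "e \<noteq> 0" and q: "pcompose p v = smult e q"
  shows "subst_z v f \<in> surface_ring q"
  unfolding surface_ring_def
proof (intro CollectI allI)
  fix i
  obtain u where u: "lookup f i = p ^ nat (- i) * u" using surface_ring_power_dvd[OF f, of i] by (auto simp: dvd_def)
  have "lookup (subst_z v f) i = smult (e ^ nat (- i)) (q ^ nat (- i)) * pcompose u v"
    by (simp add: lookup_subst_z u pcompose_mult pcompose_power q smult_power)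
  thus "q ^ nat (- i) dvd lookup (subst_z v f) i" by (simp add: dvd_smult)
qed

lemma linear_inverse:
  assumes "a \<noteq> (0 :: complex)"
  shows "pcompose [:b, a:] [:- (b / a), 1 / a:] = [:0, 1:]" "pcompose [:- (b / a), 1 / a:] [:b, a:] = [:0, 1:]"
  using assms by (simp_all add: pcompose_pCons field_simps)

text \<open>
  The substitution acts on coefficients only, and the factor \<open>lam\<close> does not affect divisibility by powers.
\<close>

lemma surface_iso_affine:
  assumes a: "a \<noteq> 0" and lam: "lam \<noteq> 0"
  shows "surface_iso p (smult lam (pcompose p [:b, a:])) (subst_z [:b, a:])"
proof -
  let ?q = "smult lam (pcompose p [:b, a:])" and ?l = "[:b, a:]" and ?l' = "[:- (b / a), 1 / a:]"
  have 1: "subst_z ?l f \<in> surface_ring ?q" if "f \<in> surface_ring p" for f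
    by (rule subst_z_in_surface_ring[OF that, of "1 / lam"]) (use lam in auto)
  have 2: "subst_z ?l' f \<in> surface_ring p" if "f \<in> surface_ring ?q" for f
    by (rule subst_z_in_surface_ring[OF that lam])
       (simp add: pcompose_smult linear_inverse[OF a] flip: pcompose_assoc)
  have 3: "subst_z ?l' (subst_z ?l f) = f" "subst_z ?l (subst_z ?l' f) = f" for f
    by (rule poly_mapping_eqI, simp add: lookup_subst_z linear_inverse[OF a] flip: pcompose_assoc)+
  have "bij_betw (subst_z ?l) (surface_ring p) (surface_ring ?q)"
    by (rule bij_betwI[where g = "subst_z ?l'"]) (use 1 2 3 in auto)
  moreover have "subst_z ?l (cst \<alpha>) = cst \<alpha>" for \<alpha>
    by (rule poly_mapping_eqI) (simp add: lookup_subst_z lookup_cst)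
  ultimately show ?thesis by (simp add: surface_iso_def ring_map[OF ring_map_subst_z])
qed

section \<open>Polynomials affinely equivalent to their conjugate\<close>

lemma funpow_pderiv_affine:
  "(pderiv ^^ k) (pcompose u [:d, a:]) = smult (a ^ k) (pcompose ((pderiv ^^ k) u) [:d, a:])"
  for a d :: complex
proof (induction k)
  case (Suc k)
  have "pderiv (pcompose v [:d, a:]) = smult a (pcompose (pderiv v) [:d, a:])" for v
    by (simp add: pderiv_pcompose pderiv_pCons)
  thus ?case by (simp add: Suc pderiv_smult mult.commute)
qed simp

lemma funpow_pderiv_smult: "(pderiv ^^ k) (smult e u) = smult e ((pderiv ^^ k) u)" for u :: "complex poly"
  by (induction k) (simp_all add: pderiv_smult)

lemma degree_funpow_pderiv: "degree ((pderiv ^^ k) (u :: complex poly)) = degree u - k"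
  by (induction k) (simp_all add: degree_pderiv)

lemma map_poly_cnj_funpow_pderiv: "map_poly cnj ((pderiv ^^ k) u) = (pderiv ^^ k) (map_poly cnj u)"
  by (induction k) (simp_all add: map_poly_cnj_pderiv)

lemma root_of_degree_1_unique:
  assumes "degree u = 1" "poly u s = 0" "poly u t = (0 :: complex)"
  shows "s = t"
proof -
  have u: "poly u x = coeff u 0 + x * coeff u 1" for x
    by (simp add: poly_altdef assms(1))
  have "coeff u 1 \<noteq> 0" using assms(1) by (metis leading_coeff_0_iff degree_0 zero_neq_one)
  moreover have "coeff u 0 + s * coeff u 1 = 0" "coeff u 0 + t * coeff u 1 = 0"
    using assms(2,3) by (simp_all add: u)
  ultimately show ?thesis by (metis add_left_cancel mult_right_cancel)
qed

text \<open>
  The barycentre \<open>t\<close> of the roots is the root of the derivative of order \<open>n - 1\<close>, which has degree one. This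
  description makes it obvious that \<open>z \<mapsto> az + d\<close> maps \<open>t\<close> to its conjugate, and avoids binomial
  expansions.
\<close>

lemma conjugate_affine_imp_real:
  assumes p: "degree p > 0" and a: "a \<noteq> 0" and e: "e \<noteq> 0"
    and eq: "pcompose (map_poly cnj p) [:d, a:] = smult e p"
  shows "\<exists>a lam b. a \<noteq> 0 \<and> lam \<noteq> 0 \<and> smult lam (pcompose p [:b, a:]) \<in> real_polys"
proof -
  define n where "n = degree p"
  define L where "L = (pderiv ^^ (n - 1)) p"
  have dL: "degree L = 1" using p by (simp add: L_def degree_funpow_pderiv n_def)
  then obtain t where t: "poly L t = 0"
    using no_roots_imp_const[of L] by force
  have "smult (a ^ (n - 1)) (pcompose (map_poly cnj L) [:d, a:]) = smult e L"
    using arg_cong[OF eq, of "pderiv ^^ (n - 1)"]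
    by (simp add: funpow_pderiv_affine funpow_pderiv_smult L_def map_poly_cnj_funpow_pderiv)
  hence "poly (smult (a ^ (n - 1)) (pcompose (map_poly cnj L) [:d, a:])) t = poly (smult e L) t" by simp
  hence "poly (map_poly cnj L) (d + t * a) = 0" using a t by (simp add: poly_pcompose)
  moreover have "poly (map_poly cnj L) (cnj t) = 0" using t by simp
  ultimately have dt: "d + t * a = cnj t"
    using root_of_degree_1_unique[of "map_poly cnj L"] dL by (simp add: degree_map_poly_cnj)
  define p1 where "p1 = pcompose p [:t, 1:]"
  have "smult e p1 = pcompose (map_poly cnj p) (pcompose [:d, a:] [:t, 1:])"
    using eq by (simp add: p1_def pcompose_assoc pcompose_smult)
  also have "pcompose [:d, a:] [:t, 1:] = pcompose [:cnj t, 1:] [:0, a:]"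
    using dt by (simp add: pcompose_pCons mult.commute)
  also have "pcompose (map_poly cnj p) \<dots> = pcompose (map_poly cnj p1) [:0, a:]"
    by (simp add: p1_def pcompose_assoc map_poly_cnj_pcompose map_poly_pCons)
  finally have eq1: "pcompose (map_poly cnj p1) [:0, a:] = smult e p1" by simp
  have scale: "coeff (pcompose u [:0, b:]) k = coeff u k * b ^ k" for u :: "complex poly" and b k
  proof (induction u arbitrary: k)
    case (pCons c u)
    show ?case by (cases k) (simp_all add: pcompose_pCons pCons.IH)
  qed simp
  have c: "cnj (coeff p1 k) * a ^ k = e * coeff p1 k" for k
    using arg_cong[OF eq1, of "\<lambda>u. coeff u k"] by (simp add: scale coeff_map_poly)
  have d1: "degree p1 = n" by (simp add: p1_def degree_pcompose n_def)
  define c0 where "c0 = coeff p1 n"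
  have c0: "c0 \<noteq> 0" using p d1 unfolding c0_def n_def by (metis degree_0 less_irrefl leading_coeff_0_iff)
  define v where "v k = coeff p1 k / c0" for k
  have v: "cnj (v k) = v k * a ^ (n - k)" if "k \<le> n" for k
  proof -
    have "a ^ n = a ^ k * a ^ (n - k)" using that by (simp flip: power_add)
    moreover have "cnj c0 * a ^ n = e * c0" using c[of n] by (simp add: c0_def)
    ultimately have "cnj (coeff p1 k) * a ^ k * (cnj c0 * (a ^ k * a ^ (n - k))) = e * coeff p1 k * (cnj c0 * a ^ n)"
      using c[of k] by simp
    hence "cnj (coeff p1 k) * a ^ k * (e * c0) = e * coeff p1 k * (cnj c0 * (a ^ k * a ^ (n - k)))"
      using \<open>cnj c0 * a ^ n = e * c0\<close> \<open>a ^ n = a ^ k * a ^ (n - k)\<close> c[of k] by simp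
    hence "(e * a ^ k) * (cnj (coeff p1 k) * c0) = (e * a ^ k) * (coeff p1 k * (cnj c0 * a ^ (n - k)))"
      by (simp only: mult_ac)
    hence "cnj (coeff p1 k) * c0 = coeff p1 k * (cnj c0 * a ^ (n - k))" using e a by simp
    thus ?thesis using c0 by (simp add: v_def divide_simps mult_ac)
  qed
  have "\<exists>w. w \<noteq> 0 \<and> (\<forall>k. cnj (v k / w ^ (n - k)) = v k / w ^ (n - k))"
  proof (cases "\<exists>k<n. v k \<noteq> 0")
    case False
    have "v k = (if k = n then 1 else 0)" for k
      using False c0 d1 coeff_eq_0[of p1 k] by (cases k n rule: linorder_cases) (auto simp: v_def c0_def)
    thus ?thesis by (intro exI[of _ 1]) simp
  next
    case True
    then obtain k where k: "k < n" "v k \<noteq> 0" by blast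
    have "cmod (v k) = cmod (v k) * cmod a ^ (n - k)"
      using arg_cong[OF v[of k], of cmod] k by (simp add: norm_mult norm_power)
    hence "cmod a ^ (n - k) = 1" using k by simp
    hence "cmod a = 1" using k power_eq_imp_eq_base[of "cmod a" "n - k" 1] by simp
    \<comment> \<open>With \<open>|w| = 1\<close> and \<open>a w = 1/w\<close>, dividing \<open>v\<^sub>k\<close> by \<open>w\<^sup>n\<^sup>-\<^sup>k\<close> compensates the factor \<open>a\<^sup>n\<^sup>-\<^sup>k\<close>.\<close>
    define w where "w = csqrt (cnj a)"
    have w2: "w * w = cnj a" by (simp add: w_def flip: power2_eq_square)
    have aa: "a * cnj a = 1" using \<open>cmod a = 1\<close> complex_norm_square[of a] by simp
    have "cmod w * cmod w = 1" using w2 \<open>cmod a = 1\<close> by (metis complex_mod_cnj norm_mult)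
    hence "cmod w = 1" by (metis norm_ge_zero square_eq_1_iff abs_of_nonneg abs_neg_one abs_one norm_one)
    hence ww: "w * cnj w = 1" using complex_norm_square[of w] by simp
    have w0: "w \<noteq> 0" using ww by auto
    have "cnj (v k / w ^ (n - k)) = v k / w ^ (n - k)" for k
    proof (cases "k \<le> n")
      case True
      have cw: "cnj w = 1 / w" using ww w0 by (simp add: field_simps)
      have "(a * w) * w = 1" using w2 aa by (simp add: mult.assoc)
      hence aw: "a * w = 1 / w" using w0 by (simp add: field_simps)
      have "cnj (v k / w ^ (n - k)) = v k * a ^ (n - k) / (1 / w) ^ (n - k)"
        by (simp add: v[OF True] cw)
      also have "\<dots> = v k * (a * w) ^ (n - k)" by (simp add: power_one_over power_mult_distrib)
      also have "\<dots> = v k / w ^ (n - k)" by (simp add: aw power_one_over)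
      finally show ?thesis .
    next
      case False
      thus ?thesis using d1 by (simp add: v_def coeff_eq_0)
    qed
    thus ?thesis using w0 by blast
  qed
  then obtain w where w: "w \<noteq> 0" "\<And>k. cnj (v k / w ^ (n - k)) = v k / w ^ (n - k)" by blast
  define lam where "lam = 1 / (c0 * w ^ n)"
  have comp: "pcompose p [:t, w:] = pcompose p1 [:0, w:]"
    by (simp add: p1_def pcompose_pCons flip: pcompose_assoc)
  have "smult lam (pcompose p [:t, w:]) \<in> real_polys"
  proof (rule real_polysI)
    fix k
    have "coeff (smult lam (pcompose p [:t, w:])) k = v k / w ^ (n - k)"
    proof (cases "k \<le> n")
      case True
      hence "w ^ n = w ^ k * w ^ (n - k)" by (simp flip: power_add)
      thus ?thesis using w c0 by (simp add: comp scale lam_def v_def field_simps)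
    next
      case False
      thus ?thesis using d1 by (simp add: comp scale v_def coeff_eq_0)
    qed
    thus "cnj (coeff (smult lam (pcompose p [:t, w:])) k) = coeff (smult lam (pcompose p [:t, w:])) k"
      using w(2)[of k] by simp
  qed
  moreover have "lam \<noteq> 0" using w c0 by (simp add: lam_def)
  ultimately show ?thesis using w(1) by blast
qed

lemma linear_imp_real:
  assumes p: "degree p = 1"
  shows "\<exists>a lam b. a \<noteq> 0 \<and> lam \<noteq> 0 \<and> smult lam (pcompose p [:b, a:]) \<in> real_polys"
proof -
  define u where "u = coeff p 0"
  define v where "v = coeff p 1"
  have "v \<noteq> 0" using p by (metis v_def leading_coeff_0_iff degree_0 zero_neq_one)
  have "p = [:u, v:]"
    using p by (intro poly_eqI) (auto simp: u_def v_def coeff_pCons coeff_eq_0 split: nat.splits)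
  hence "smult 1 (pcompose p [:- (u / v), 1 / v:]) = [:0, 1:]"
    using linear_inverse(1)[OF \<open>v \<noteq> 0\<close>] by simp
  moreover have "[:0, 1:] \<in> real_polys" by (rule real_polysI) (simp add: coeff_pCons split: nat.splits)
  ultimately have "smult 1 (pcompose p [:- (u / v), 1 / v:]) \<in> real_polys" by (simp only:)
  thus ?thesis using \<open>v \<noteq> 0\<close> by (metis divide_eq_0_iff one_neq_zero)
qed

section \<open>Real structures on the surfaces\<close>

theorem proposition3p11:
  fixes p :: "complex poly"
  assumes nonconstant: "degree p > 0"
  shows "(danielewski_admits_real_structure p \<longleftrightarrow>
            (\<exists>a lam b :: complex. a \<noteq> 0 \<and> lam \<noteq> 0 \<and>
               smult lam (pcompose p [:b, a:]) \<in> real_polys)) \<and>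
         ((\<exists>a lam b :: complex. a \<noteq> 0 \<and> lam \<noteq> 0 \<and>
             smult lam (pcompose p [:b, a:]) \<in> real_polys) \<longleftrightarrow>
            (\<exists>q \<in> real_polys. danielewski_isomorphic p q))"
    (is "(?real \<longleftrightarrow> ?aff) \<and> (?aff \<longleftrightarrow> ?iso)")
proof -
  have p0: "p \<noteq> 0" using nonconstant by auto
  have aff: ?real ?iso if ?aff
  proof -
    from that obtain a lam b where alb: "a \<noteq> 0" "lam \<noteq> 0" "smult lam (pcompose p [:b, a:]) \<in> real_polys"
      by blast
    define q where "q = smult lam (pcompose p [:b, a:])"
    have "degree q = degree p" using alb by (simp add: q_def degree_pcompose)
    hence q0: "q \<noteq> 0" using nonconstant by auto
    have \<phi>: "surface_iso p q (subst_z [:b, a:])" unfolding q_def by (rule surface_iso_affine[OF alb(1,2)])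
    show ?iso
      using \<phi> alb(3) danielewski_isomorphic_iff[OF p0 q0] unfolding q_def by blast
    show ?real
      using surface_real_structure_transfer[OF \<phi> surface_real_structure_conjugate] alb(3) danielewski_admits_real_structure_iff[OF p0]
      unfolding q_def by blast
  qed
  have "?aff" if ?real
  proof (cases "degree p = 1")
    case True
    thus ?thesis by (rule linear_imp_real)
  next
    case False
    hence p1: "degree p > 1" using nonconstant by simp
    from that obtain r where "surface_real_structure p r" using danielewski_admits_real_structure_iff[OF p0] by blast
    from isomorphic_imp_affine[OF surface_iso_of_real_structure[OF this] _ p1]
    obtain a d e where "a \<noteq> 0" "e \<noteq> 0" "pcompose (map_poly cnj p) [:d, a:] = smult e p"
      using nonconstant by (auto simp: degree_map_poly_cnj)
    thus ?thesis by (rule conjugate_affine_imp_real[OF nonconstant])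
  qed
  moreover have "?aff" if ?iso
  proof (cases "degree p = 1")
    case True
    thus ?thesis by (rule linear_imp_real)
  next
    case False
    hence p1: "degree p > 1" using nonconstant by simp
    from that obtain q where q: "q \<in> real_polys" "danielewski_isomorphic p q" by blast
    have dq: "degree q > 0" by (rule isomorphic_imp_nonconstant[OF q(2) nonconstant])
    hence "q \<noteq> 0" by auto
    then obtain \<phi> where "surface_iso p q \<phi>" using danielewski_isomorphic_iff[OF p0] q(2) by blast
    from isomorphic_imp_affine[OF surface_iso_inv[OF this] dq p1]
    obtain a d e where ade: "a \<noteq> 0" "e \<noteq> 0" "pcompose q [:d, a:] = smult e p" by blast
    have "smult e (pcompose p [:- (d / a), 1 / a:]) = pcompose (pcompose q [:d, a:]) [:- (d / a), 1 / a:]"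
      by (simp add: ade(3) pcompose_smult)
    also have "\<dots> = q" by (simp add: linear_inverse[OF ade(1)] flip: pcompose_assoc)
    finally have "smult e (pcompose p [:- (d / a), 1 / a:]) \<in> real_polys" using q(1) by simp
    moreover have "1 / a \<noteq> 0" using ade(1) by simp
    ultimately show ?thesis using ade(2) by blast
  qed
  ultimately show ?thesis using aff by blast
qed

end
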